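(* Let $G$ be a group. If $|Z(G)|$ and $|\mathrm{Out}(G)|$ are (finite and) coprime, then there is a one-to-one correspondence between the equivalence classes of $Z\phi$-extensions of $Z(G)$ and the $G$-isomorphism classes of extensions of $G$.
   Context: Automorphisms act on the right; $g^t=t^{-1}gt$; $\mathrm{Out}(G)=\mathrm{Aut}(G)/\mathrm{Inn}(G)$. An extension of $G$ is a group $E$ containing $G$ as a normal subgroup. Two extensions $E_1,E_2$ of $G$ are $G$-isomorphic if there is an isomorphism $E_1\to E_2$ mapping $G$ onto $G$. Every coset $\mathrm{Inn}(G)\omega\in\mathrm{Out}(G)$ induces a well-defined automorphism of $Z(G)$, so $\mathrm{Out}(G)$ acts on $Z(G)$. A $Z\phi$-extension of $Z=Z(G)$ is a pair $(S,\phi)$ where $S$ is a group containing $Z$ as a normal subgroup and $\phi:S\to \mathrm{Out}(G)$ is a homomorphism with $Z\subseteq\ker\phi$ and $z^s=z^{\phi(s)}$ for all $s\in S$, $z\in Z$. Two $Z\phi$-extensions $(S_1,\phi_1)$, $(S_2,\phi_2)$ are equivalent if there are an isomorphism $j:S_1\to S_2$ and $\pi\in\mathrm{Aut}(G)$ such that $j(z)=z^\pi$ for all $z\in Z(G)$ and $\phi_2(j(s))=\pi^{-1}\phi_1(s)\pi$ for all $s\in S_1$. *)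

theory Defs
  imports "HOL-Algebra.Algebra" "HOL-Library.Equipollence"
begin

section \<open>Centre and outer automorphisms\<close>

definition centre :: "('a, 'b) monoid_scheme \<Rightarrow> 'a set" where
  "centre G = {z \<in> carrier G. \<forall>g \<in> carrier G. z \<otimes>\<^bsub>G\<^esub> g = g \<otimes>\<^bsub>G\<^esub> z}"

text \<open>Automorphisms act on the right, so the product \<open>\<alpha>\<beta>\<close> means ``first \<open>\<alpha>\<close>, then \<open>\<beta>\<close>'';
  the multiplication of \<^const>\<open>AutoGroup\<close> is composition of functions written on the left.\<close>

definition Aut :: "('a, 'b) monoid_scheme \<Rightarrow> ('a \<Rightarrow> 'a) monoid" where
  "Aut G = (AutoGroup G)\<lparr>mult := \<lambda>\<alpha> \<beta>. \<beta> \<otimes>\<^bsub>AutoGroup G\<^esub> \<alpha>\<rparr>"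

definition conj_aut :: "('a, 'b) monoid_scheme \<Rightarrow> 'a \<Rightarrow> 'a \<Rightarrow> 'a" where
  "conj_aut G t = (\<lambda>g \<in> carrier G. inv\<^bsub>G\<^esub> t \<otimes>\<^bsub>G\<^esub> g \<otimes>\<^bsub>G\<^esub> t)"

definition Inn :: "('a, 'b) monoid_scheme \<Rightarrow> ('a \<Rightarrow> 'a) set" where
  "Inn G = conj_aut G ` carrier G"

definition Out :: "('a, 'b) monoid_scheme \<Rightarrow> ('a \<Rightarrow> 'a) set monoid" where
  "Out G = Aut G Mod Inn G"

abbreviation outer_class :: "('a, 'b) monoid_scheme \<Rightarrow> ('a \<Rightarrow> 'a) \<Rightarrow> ('a \<Rightarrow> 'a) set" where
  "outer_class G \<pi> \<equiv> Inn G #>\<^bsub>Aut G\<^esub> \<pi>"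


section \<open>Extensions\<close>

text \<open>Since a type may leave no room around \<open>G\<close>, a group containing \<open>G\<close> as a normal subgroup is a
  group \<open>E\<close> (over a possibly different type) with an embedding \<open>\<iota>\<close> of \<open>G\<close> onto a normal subgroup
  of \<open>E\<close>. The same encoding is used for groups containing \<open>Z(G)\<close>.\<close>

definition extensions :: "('a, 'b) monoid_scheme \<Rightarrow> ('u monoid \<times> ('a \<Rightarrow> 'u)) set" where
  "extensions G = {(E, \<iota>). group E \<and> \<iota> \<in> hom G E \<and> inj_on \<iota> (carrier G) \<and> \<iota> ` carrier G \<lhd> E}"

definition G_isomorphism_rel ::
    "('a, 'b) monoid_scheme \<Rightarrow> (('u monoid \<times> ('a \<Rightarrow> 'u)) \<times> ('u monoid \<times> ('a \<Rightarrow> 'u))) set" where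
  "G_isomorphism_rel G = {((E1, \<iota>1), (E2, \<iota>2)).
     (E1, \<iota>1) \<in> extensions G \<and> (E2, \<iota>2) \<in> extensions G \<and>
     (\<exists>h \<in> iso E1 E2. h ` (\<iota>1 ` carrier G) = \<iota>2 ` carrier G)}"


section \<open>Extensions of the centre with outer action\<close>

text \<open>The condition \<open>z\<^sup>s = z\<^bsup>\<phi>(s)\<^esup>\<close> is imposed for every representative \<open>\<alpha>\<close> of the coset
  \<open>\<phi>(s)\<close>; all of them agree on the centre.\<close>

definition Zphi_extensions ::
    "('a, 'b) monoid_scheme \<Rightarrow> ('u monoid \<times> ('a \<Rightarrow> 'u) \<times> ('u \<Rightarrow> ('a \<Rightarrow> 'a) set)) set" where
  "Zphi_extensions G = {(S, \<kappa>, \<phi>).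
     group S \<and> \<kappa> \<in> hom (G\<lparr>carrier := centre G\<rparr>) S \<and> inj_on \<kappa> (centre G) \<and> \<kappa> ` centre G \<lhd> S \<and>
     \<phi> \<in> hom S (Out G) \<and> \<kappa> ` centre G \<subseteq> kernel S (Out G) \<phi> \<and>
     (\<forall>s \<in> carrier S. \<forall>z \<in> centre G. \<forall>\<alpha> \<in> \<phi> s. inv\<^bsub>S\<^esub> s \<otimes>\<^bsub>S\<^esub> \<kappa> z \<otimes>\<^bsub>S\<^esub> s = \<kappa> (\<alpha> z))}"

definition Zphi_equivalence_rel ::
    "('a, 'b) monoid_scheme \<Rightarrow>
     (('u monoid \<times> ('a \<Rightarrow> 'u) \<times> ('u \<Rightarrow> ('a \<Rightarrow> 'a) set)) \<times>
      ('u monoid \<times> ('a \<Rightarrow> 'u) \<times> ('u \<Rightarrow> ('a \<Rightarrow> 'a) set))) set" where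
  "Zphi_equivalence_rel G = {((S1, \<kappa>1, \<phi>1), (S2, \<kappa>2, \<phi>2)).
     (S1, \<kappa>1, \<phi>1) \<in> Zphi_extensions G \<and> (S2, \<kappa>2, \<phi>2) \<in> Zphi_extensions G \<and>
     (\<exists>j \<in> iso S1 S2. \<exists>\<pi> \<in> carrier (Aut G).
        (\<forall>z \<in> centre G. j (\<kappa>1 z) = \<kappa>2 (\<pi> z)) \<and>
        (\<forall>s \<in> carrier S1. \<phi>2 (j s) =
           inv\<^bsub>Out G\<^esub> (outer_class G \<pi>) \<otimes>\<^bsub>Out G\<^esub> \<phi>1 s \<otimes>\<^bsub>Out G\<^esub> outer_class G \<pi>))}"

text \<open>An extension and a \<open>Z\<phi>\<close>-extension have the same coupling if their quotients are isomorphic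
  over \<open>Out(G)\<close>. As \<open>\<phi>(s)\<close> is a coset of \<open>Inn(G)\<close>, the last clause says that \<open>\<phi>(s)\<close> is the outer
  automorphism of \<open>G\<close> induced by conjugation with \<open>e\<close>. A bijection between classes that ignores
  couplings carries little information: over an infinite carrier type it can be found by merely
  counting classes.\<close>

fun same_coupling ::
    "('a, 'b) monoid_scheme \<Rightarrow> 'u monoid \<times> ('a \<Rightarrow> 'u) \<times> ('u \<Rightarrow> ('a \<Rightarrow> 'a) set) \<Rightarrow>
     'u monoid \<times> ('a \<Rightarrow> 'u) \<Rightarrow> bool" where
  "same_coupling G (S, \<kappa>, \<phi>) (E, \<iota>) \<longleftrightarrow>
     (\<exists>\<theta> \<in> iso (S Mod \<kappa> ` centre G) (E Mod \<iota> ` carrier G).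
        \<forall>s \<in> carrier S. \<forall>e \<in> \<theta> (\<kappa> ` centre G #>\<^bsub>S\<^esub> s). \<exists>\<alpha> \<in> \<phi> s. \<forall>g \<in> carrier G.
          inv\<^bsub>E\<^esub> e \<otimes>\<^bsub>E\<^esub> \<iota> g \<otimes>\<^bsub>E\<^esub> e = \<iota> (\<alpha> g))"

end

theory Submission
  imports Defs
begin

text \<open>The coprimality hypothesis yields an extension \<open>U\<close> of \<open>G\<close> by \<open>Out G\<close> whose coupling is the
  identity (the obstruction in \<open>H\<^sup>3(Out G, Z)\<close> is killed by both orders); it is built by a
  transfer construction instead of cocycles. Given \<open>U\<close>, a \<open>Z\<phi>\<close>-extension \<open>S\<close> is sent to
  \<open>E = (S \<times>\<^bsub>Out G\<^esub> U) / {(z, z\<^sup>-\<^sup>1) | z \<in> Z}\<close>, and an extension \<open>E\<close> of \<open>G\<close> is sent to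
  \<open>S = (E \<times>\<^bsub>Aut G\<^esub> U) / {(g, g) | g \<in> G}\<close>. Both numerators are the same group, so the two
  assignments are inverse to each other. They respect the equivalences because every automorphism of
  \<open>G\<close> extends to \<open>U\<close> as conjugation by an element of \<open>U\<close> lying above it.\<close>

section \<open>Groups, relations and quotients\<close>

text \<open>For a fixed coupling of a quotient with \<open>Out G\<close>, the extensions of G form,
  if there are any, a torsor under the second cohomology of the quotient with values in the centre,
  whereas the Z\<phi>-extensions have a natural zero. A correspondence therefore needs a base point
  for every coupling, and these must be compatible with twisting by automorphisms of G; independent
  choices would not be. Pulling back one U over all of \<open>Out G\<close> supplies them
  simultaneously. The obstruction to U disappears for every G once the centre is enlarged to the
  functions from \<open>Out G\<close> to the centre, a coinduced module; this yields the group
  \<open>induced_lift\<close>. Coprimality serves to cut the kernel down to the centre again. The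
  quotients have no canonical carrier inside the type \<open>'u\<close>. The correspondence is
  therefore a relation, witnessed by a set K of triples, and becomes a function only on
  classes.\<close>

lemma (in group) mult_inv_cancel:
  assumes "x \<in> carrier G" "y \<in> carrier G"
  shows "x \<otimes> (inv x \<otimes> y) = y" "inv x \<otimes> (x \<otimes> y) = y"
  using assms by (simp_all add: m_assoc[symmetric])

text \<open>Actions are on the right, so conjugation relations below come in the shape
  \<open>n x = x n'\<close>, as in \<open>\<gamma>_commute\<close>; this criterion takes them
  directly. Used at \<open>inv x\<close>, the relation gives closure under conjugation.\<close>

lemma (in group) normal_of_commute:
  assumes "subgroup N G" and "\<And>x n. x \<in> carrier G \<Longrightarrow> n \<in> N \<Longrightarrow> \<exists>n' \<in> N. n \<otimes> x = x \<otimes> n'"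
  shows "N \<lhd> G"
proof -
  have "x \<otimes> n \<otimes> inv x \<in> N" if x: "x \<in> carrier G" and n: "n \<in> N" for x n
  proof -
    obtain n' where "n' \<in> N" "n \<otimes> inv x = inv x \<otimes> n'"
      using assms(2) x n by blast
    moreover from this have "n \<in> carrier G" "n' \<in> carrier G"
      using n subgroup.mem_carrier[OF assms(1)] by auto
    ultimately show ?thesis using x by (simp add: m_assoc mult_inv_cancel)
  qed
  then show ?thesis using assms(1) by (simp add: normal_inv_iff)
qed

text \<open>Goursat's lemma in its extreme case: a subgroup of A x B that projects onto both factors
  and meets each of them trivially is the graph of an isomorphism. The isomorphisms between linked
  groups and between their quotients are found in this way, without choosing preimages and checking
  independence of the choice.\<close>

lemma iso_of_subgroup_relation:
  assumes "group A" "group B" and L: "L \<subseteq> carrier A \<times> carrier B"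
    and mult: "\<And>a b a' b'. (a, b) \<in> L \<Longrightarrow> (a', b') \<in> L \<Longrightarrow> (a \<otimes>\<^bsub>A\<^esub> a', b \<otimes>\<^bsub>B\<^esub> b') \<in> L"
    and inv: "\<And>a b. (a, b) \<in> L \<Longrightarrow> (inv\<^bsub>A\<^esub> a, inv\<^bsub>B\<^esub> b) \<in> L"
    and total: "\<And>a. a \<in> carrier A \<Longrightarrow> \<exists>b. (a, b) \<in> L"
    and onto: "\<And>b. b \<in> carrier B \<Longrightarrow> \<exists>a. (a, b) \<in> L"
    and inj: "\<And>a. (a, \<one>\<^bsub>B\<^esub>) \<in> L \<Longrightarrow> a = \<one>\<^bsub>A\<^esub>"
    and single: "\<And>b. (\<one>\<^bsub>A\<^esub>, b) \<in> L \<Longrightarrow> b = \<one>\<^bsub>B\<^esub>"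
  shows "\<exists>h \<in> iso A B. \<forall>a b. (a, b) \<in> L \<longrightarrow> h a = b"
proof -
  interpret A: group A by fact
  interpret B: group B by fact
  have fun': "b = b'" if "(a, b) \<in> L" "(a, b') \<in> L" for a b b'
  proof -
    have "(a \<otimes>\<^bsub>A\<^esub> inv\<^bsub>A\<^esub> a, b \<otimes>\<^bsub>B\<^esub> inv\<^bsub>B\<^esub> b') \<in> L"
      using that inv mult by blast
    moreover have "a \<in> carrier A" "b \<in> carrier B" "b' \<in> carrier B"
      using that L by auto
    moreover from calculation have "b \<otimes>\<^bsub>B\<^esub> inv\<^bsub>B\<^esub> b' = \<one>\<^bsub>B\<^esub>"
      using single by simp
    ultimately show ?thesis
      by (simp add: B.inv_solve_right')
  qed
  have inj': "a = a'" if "(a, b) \<in> L" "(a', b) \<in> L" for a a' b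
  proof -
    have "(a \<otimes>\<^bsub>A\<^esub> inv\<^bsub>A\<^esub> a', b \<otimes>\<^bsub>B\<^esub> inv\<^bsub>B\<^esub> b) \<in> L"
      using that inv mult by blast
    moreover have "a \<in> carrier A" "a' \<in> carrier A" "b \<in> carrier B"
      using that L by auto
    moreover from calculation have "a \<otimes>\<^bsub>A\<^esub> inv\<^bsub>A\<^esub> a' = \<one>\<^bsub>A\<^esub>"
      using inj by simp
    ultimately show ?thesis
      by (simp add: A.inv_solve_right')
  qed
  define h where "h a = (THE b. (a, b) \<in> L)" for a
  have h: "h a = b" if "(a, b) \<in> L" for a b
    unfolding h_def using that fun' by blast
  have hL: "(a, h a) \<in> L" if "a \<in> carrier A" for a
    using total[OF that] h by blast
  have "h \<in> hom A B"
    using hL L by (intro homI) (blast intro: h mult)+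
  moreover have "bij_betw h (carrier A) (carrier B)"
  proof (rule bij_betw_imageI)
    show "inj_on h (carrier A)"
      by (rule inj_onI) (metis hL inj')
    show "h ` carrier A = carrier B"
    proof
      show "h ` carrier A \<subseteq> carrier B"
        using hL L by blast
      show "carrier B \<subseteq> h ` carrier A"
      proof
        fix b assume "b \<in> carrier B"
        then obtain a where "(a, b) \<in> L" using onto by blast
        then show "b \<in> h ` carrier A" using L h[of a b] by force
      qed
    qed
  qed
  ultimately have "h \<in> iso A B"
    by (rule isoI)
  with h show ?thesis
    by blast
qed

text \<open>\<open>P Mod N\<close> is a group of sets over another type, while the classes to be
  compared consist of groups over \<open>'u\<close>. There are no more cosets than elements of P, so
  an injection of the cosets into \<open>'u\<close> transports the group structure.\<close>

lemma quotient_on_type: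
  assumes "N \<lhd> P" and D: "carrier P \<lesssim> (UNIV :: 'u set)"
  obtains E :: "'u monoid" and \<Phi> where "group E" "\<Phi> \<in> hom P E" "\<Phi> ` carrier P = carrier E"
    "\<And>x. x \<in> carrier P \<Longrightarrow> \<Phi> x = \<one>\<^bsub>E\<^esub> \<longleftrightarrow> x \<in> N"
proof -
  interpret normal N P by fact
  have "carrier (P Mod N) \<lesssim> carrier P"
    unfolding carrier_FactGroup by (rule image_lepoll)
  then obtain f :: "'a set \<Rightarrow> 'u" where f: "inj_on f (carrier (P Mod N))"
    using lepoll_trans[OF _ D] unfolding lepoll_def by metis
  interpret Q: group "P Mod N" by (rule factorgroup_is_group)
  define E where "E = image_group f (P Mod N)"
  have iso: "f \<in> iso (P Mod N) E"
    unfolding E_def by (rule inj_imp_image_group_iso[OF f])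
  have E: "group E"
    unfolding E_def by (rule Q.inj_imp_image_group_is_group[OF f])
  define \<Phi> where "\<Phi> = f \<circ> (\<lambda>x. N #>\<^bsub>P\<^esub> x)"
  have "\<Phi> \<in> hom P E"
    unfolding \<Phi>_def using iso unfolding iso_def by (blast intro: Group.hom_compose[OF r_coset_hom_Mod])
  moreover have "\<Phi> ` carrier P = carrier E"
    using iso by (simp add: \<Phi>_def image_image[symmetric] iso_def bij_betw_def carrier_FactGroup)
  moreover have "\<Phi> x = \<one>\<^bsub>E\<^esub> \<longleftrightarrow> x \<in> N" if "x \<in> carrier P" for x
  proof -
    have "\<one>\<^bsub>E\<^esub> = f N" by (simp add: E_def image_group_def)
    moreover have "N \<in> carrier (P Mod N)" using Q.one_closed by simp
    moreover have "N #>\<^bsub>P\<^esub> x \<in> carrier (P Mod N)"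
      using that by (simp add: carrier_FactGroup)
    ultimately have "\<Phi> x = \<one>\<^bsub>E\<^esub> \<longleftrightarrow> N #>\<^bsub>P\<^esub> x = N"
      using f by (auto simp: \<Phi>_def inj_on_def)
    also have "\<dots> \<longleftrightarrow> x \<in> N"
      using that coset_join1[OF _ that subgroup_axioms] coset_join2[OF that subgroup_axioms]
      by blast
    finally show ?thesis .
  qed
  ultimately show thesis using that E by blast
qed

text \<open>A correspondence that is total on both sides and matches r with q descends to the
  classes. Through \<open>iff\<close>, r inherits from q the properties of an equivalence relation,
  so they are checked on one side only.\<close>

lemma bij_betw_quotients:
  assumes "equiv B q" and r: "r \<subseteq> A \<times> A" and R: "\<And>x y. R x y \<Longrightarrow> x \<in> A \<and> y \<in> B"
    and left: "\<And>x. x \<in> A \<Longrightarrow> \<exists>y. R x y" and right: "\<And>y. y \<in> B \<Longrightarrow> \<exists>x. R x y"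
    and iff: "\<And>x y x' y'. R x y \<Longrightarrow> R x' y' \<Longrightarrow> (x, x') \<in> r \<longleftrightarrow> (y, y') \<in> q"
  shows "\<exists>F. bij_betw F (A // r) (B // q) \<and> (\<forall>c \<in> A // r. \<forall>x \<in> c. \<exists>y \<in> F c. R x y)"
proof -
  have q: "q \<subseteq> B \<times> B" using \<open>equiv B q\<close> by (rule equiv_type)
  have q_refl: "(y, y) \<in> q" if "y \<in> B" for y
    using that \<open>equiv B q\<close> by (meson equivE refl_onD)
  have sym: "sym q" and trans: "trans q"
    using \<open>equiv B q\<close> by (auto elim: equivE)
  define F where "F c = q `` {y. \<exists>x \<in> c. R x y}" for c
  have F: "F (r `` {x}) = q `` {y}" if "R x y" for x y
  proof -
    have "(y, y') \<in> q" if "(x, x') \<in> r" "R x' y'" for x' y'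
      using that iff \<open>R x y\<close> by blast
    moreover have "(x, x) \<in> r"
      using that iff q_refl R by blast
    ultimately have "q `` {y. \<exists>a \<in> r `` {x}. R a y} = q `` {y}"
      using that trans by (auto dest: transD)
    then show ?thesis by (simp add: F_def)
  qed
  have "inj_on F (A // r)"
  proof (rule inj_onI)
    fix c d assume "c \<in> A // r" "d \<in> A // r" and eq: "F c = F d"
    then obtain x x' where c: "x \<in> A" "c = r `` {x}" "x' \<in> A" "d = r `` {x'}"
      by (auto elim!: quotientE)
    obtain y y' where y: "R x y" "R x' y'" using c left by meson
    have yy: "(y, y') \<in> q"
      using eq c F[OF y(1)] F[OF y(2)] q_refl R[OF y(2)] by auto
    \<comment> \<open>Membership in r is translated to q at a partner b of a; there, symmetry and
      transitivity of q apply.\<close>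
    have "(x, a) \<in> r \<longleftrightarrow> (x', a) \<in> r" for a
    proof (cases "a \<in> A")
      case True
      then obtain b where b: "R a b" using left by blast
      show ?thesis
        using iff[OF y(1) b] iff[OF y(2) b] yy sym trans by (meson symD transD)
    qed (use r in blast)
    then show "c = d" using c by auto
  qed
  moreover have "F ` (A // r) = B // q"
  proof
    show "F ` (A // r) \<subseteq> B // q"
      using left F R by (auto elim!: quotientE) (metis quotientI)
    show "B // q \<subseteq> F ` (A // r)"
      using right F R by (auto elim!: quotientE) (metis image_eqI quotientI)
  qed
  moreover have "\<exists>y \<in> F c. R x y" if "c \<in> A // r" "x \<in> c" for c x
  proof -
    have "x \<in> A" using that r by (auto elim!: quotientE)
    then obtain y where "R x y" using left by blast
    then show ?thesis using that q_refl R unfolding F_def by blast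
  qed
  ultimately show ?thesis by (auto simp: bij_betw_def)
qed

section \<open>Automorphisms and the centre\<close>

lemma carrier_Aut: "carrier (Aut G) = auto G"
  by (simp add: Aut_def AutoGroup_def)

lemma mult_Aut: "\<alpha> \<in> carrier (Aut G) \<Longrightarrow> \<beta> \<in> carrier (Aut G) \<Longrightarrow>
    \<alpha> \<otimes>\<^bsub>Aut G\<^esub> \<beta> = compose (carrier G) \<beta> \<alpha>"
  by (simp add: Aut_def AutoGroup_def BijGroup_def auto_def)

lemma one_Aut: "\<one>\<^bsub>Aut G\<^esub> = (\<lambda>x \<in> carrier G. x)"
  by (simp add: Aut_def AutoGroup_def BijGroup_def)

lemma AutI:
  assumes "group G" "\<alpha> \<in> hom G G" "bij_betw \<alpha> (carrier G) (carrier G)"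
  shows "restrict \<alpha> (carrier G) \<in> carrier (Aut G)"
proof -
  have "restrict \<alpha> (carrier G) \<in> hom G G"
    using assms(2) group.subgroup_self[OF assms(1)]
    by (auto simp: hom_def subgroup.m_closed)
  then show ?thesis
    using assms(3) by (simp add: carrier_Aut auto_def Bij_def cong: bij_betw_cong)
qed

text \<open>Two embeddings of G with the same image differ by the automorphism obtained from m
  followed by the inverse of i. With m a conjugate of i this is the action of an element of E on G;
  with m the composite of i and an isomorphism of extensions it is the induced automorphism of
  G.\<close>

lemma Aut_of_embeddings:
  assumes "group G" and i: "i \<in> hom G E" "inj_on i (carrier G)"
    and m: "m \<in> hom G E" "inj_on m (carrier G)" and img: "m ` carrier G = i ` carrier G"
  shows "\<exists>\<pi> \<in> carrier (Aut G). \<forall>g \<in> carrier G. i (\<pi> g) = m g"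
proof -
  interpret group G by fact
  define p where "p g = inv_into (carrier G) i (m g)" for g
  have p: "p g \<in> carrier G" "i (p g) = m g" if "g \<in> carrier G" for g
  proof -
    have "m g \<in> i ` carrier G" using img that by blast
    then show "p g \<in> carrier G" "i (p g) = m g"
      unfolding p_def by (auto intro: inv_into_into f_inv_into_f)
  qed
  have "p \<in> hom G G"
  proof (rule homI)
    fix a b assume ab: "a \<in> carrier G" "b \<in> carrier G"
    show "p (a \<otimes>\<^bsub>G\<^esub> b) = p a \<otimes>\<^bsub>G\<^esub> p b"
      by (rule inj_onD[OF i(2)]) (use ab p in \<open>simp_all add: hom_mult[OF i(1)] hom_mult[OF m(1)]\<close>)
  qed (rule p)
  moreover have "bij_betw p (carrier G) (carrier G)"
    unfolding p_def
    by (rule bij_betw_trans[of m _ "i ` carrier G", unfolded comp_def])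
      (simp_all add: bij_betw_def inj_on_inv_into m img i inv_into_image_cancel)
  ultimately have "restrict p (carrier G) \<in> carrier (Aut G)"
    by (rule AutI[OF \<open>group G\<close>])
  then show ?thesis
    using p(2) by (intro bexI[of _ "restrict p (carrier G)"]) simp_all
qed

context
  fixes G :: "('a, 'b) monoid_scheme" (structure)
  assumes G: "group G"
begin

interpretation group G by (rule G)

lemma group_Aut: "group (Aut G)"
proof -
  interpret A: group "AutoGroup G" by (rule AutoGroup)
  show ?thesis
    by (rule groupI) (auto simp: Aut_def A.m_assoc intro: A.r_inv_ex)
qed

interpretation Aut: group "Aut G" by (rule group_Aut)

lemma Aut_hom: "\<alpha> \<in> carrier (Aut G) \<Longrightarrow> \<alpha> \<in> hom G G"
  by (simp add: carrier_Aut auto_def)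

lemma Aut_closed [simp]: "\<alpha> \<in> carrier (Aut G) \<Longrightarrow> x \<in> carrier G \<Longrightarrow> \<alpha> x \<in> carrier G"
  using Aut_hom hom_in_carrier by metis

lemma Aut_mult [simp]: "\<alpha> \<in> carrier (Aut G) \<Longrightarrow> x \<in> carrier G \<Longrightarrow> y \<in> carrier G \<Longrightarrow>
    \<alpha> (x \<otimes> y) = \<alpha> x \<otimes> \<alpha> y"
  using Aut_hom hom_mult by metis

lemma Aut_inv [simp]: "\<alpha> \<in> carrier (Aut G) \<Longrightarrow> x \<in> carrier G \<Longrightarrow> \<alpha> (inv x) = inv (\<alpha> x)"
  using Aut_hom group_hom.hom_inv[of G G \<alpha> x] by (simp add: group_hom_def group_hom_axioms_def)

lemma Aut_one [simp]: "\<alpha> \<in> carrier (Aut G) \<Longrightarrow> \<alpha> \<one> = \<one>"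
  using Aut_hom hom_one by blast

lemma Aut_inj: "\<alpha> \<in> carrier (Aut G) \<Longrightarrow> x \<in> carrier G \<Longrightarrow> y \<in> carrier G \<Longrightarrow>
    \<alpha> x = \<alpha> y \<longleftrightarrow> x = y"
  unfolding carrier_Aut auto_def Bij_def bij_betw_def by (blast dest: inj_onD)

lemma mult_Aut_apply [simp]: "\<alpha> \<in> carrier (Aut G) \<Longrightarrow> \<beta> \<in> carrier (Aut G) \<Longrightarrow> x \<in> carrier G \<Longrightarrow>
    (\<alpha> \<otimes>\<^bsub>Aut G\<^esub> \<beta>) x = \<beta> (\<alpha> x)"
  by (simp add: mult_Aut compose_def)

lemma one_Aut_apply [simp]: "x \<in> carrier G \<Longrightarrow> \<one>\<^bsub>Aut G\<^esub> x = x"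
  by (simp add: one_Aut)

lemma Aut_inv_apply [simp]:
  assumes "\<alpha> \<in> carrier (Aut G)" "x \<in> carrier G"
  shows "(inv\<^bsub>Aut G\<^esub> \<alpha>) (\<alpha> x) = x" "\<alpha> ((inv\<^bsub>Aut G\<^esub> \<alpha>) x) = x"
  using assms by (metis Aut.inv_closed Aut.r_inv Aut.l_inv mult_Aut_apply one_Aut_apply)+

lemma Aut_eqI:
  assumes "\<alpha> \<in> carrier (Aut G)" "\<beta> \<in> carrier (Aut G)" "\<And>x. x \<in> carrier G \<Longrightarrow> \<alpha> x = \<beta> x"
  shows "\<alpha> = \<beta>"
  using assms by (auto simp: carrier_Aut auto_def Bij_def intro: extensionalityI)

lemma centre_closed [simp]: "z \<in> centre G \<Longrightarrow> z \<in> carrier G"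
  by (simp add: centre_def)

lemma centre_commute: "z \<in> centre G \<Longrightarrow> x \<in> carrier G \<Longrightarrow> z \<otimes> x = x \<otimes> z"
  unfolding centre_def by blast

lemma centreI: "z \<in> carrier G \<Longrightarrow> (\<And>x. x \<in> carrier G \<Longrightarrow> z \<otimes> x = x \<otimes> z) \<Longrightarrow> z \<in> centre G"
  unfolding centre_def by blast

lemma conj_aut_apply: "x \<in> carrier G \<Longrightarrow> conj_aut G t x = inv t \<otimes> x \<otimes> t"
  by (simp add: conj_aut_def)

lemma conj_aut_closed [simp]: 
  assumes "t \<in> carrier G" shows "conj_aut G t \<in> carrier (Aut G)"
proof -
  have "(\<lambda>x. inv t \<otimes> x \<otimes> t) \<in> hom G G"
    using assms by (intro homI) (simp_all add: m_assoc mult_inv_cancel)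
  moreover have "bij_betw (\<lambda>x. inv t \<otimes> x \<otimes> t) (carrier G) (carrier G)"
    using assms by (intro bij_betwI[where g = "\<lambda>x. t \<otimes> x \<otimes> inv t"])
      (simp_all add: m_assoc mult_inv_cancel)
  ultimately show ?thesis
    using AutI[OF G, of "\<lambda>x. inv t \<otimes> x \<otimes> t"] by (simp add: conj_aut_def)
qed

text \<open>The reversed multiplication of \<open>Aut G\<close> is what makes t \<mapsto> (g
  \<mapsto> t^-1 g t) a homomorphism instead of an anti-homomorphism.\<close>

lemma conj_aut_hom: "conj_aut G \<in> hom G (Aut G)"
  by (intro homI) (auto intro!: Aut_eqI simp: conj_aut_apply inv_mult_group m_assoc mult_inv_cancel)

text \<open>The rule \<alpha>^-1 conj_t \<alpha> = conj_(\<alpha> t) for the right action. It gives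
  normality of \<open>Inn G\<close> and moves inner factors past coset representatives.\<close>

lemma conj_aut_Aut:
  assumes "\<alpha> \<in> carrier (Aut G)" "t \<in> carrier G"
  shows "conj_aut G t \<otimes>\<^bsub>Aut G\<^esub> \<alpha> = \<alpha> \<otimes>\<^bsub>Aut G\<^esub> conj_aut G (\<alpha> t)"
  using assms by (auto intro!: Aut_eqI simp: conj_aut_apply)

lemma conj_aut_eq_one_iff:
  assumes t: "t \<in> carrier G"
  shows "conj_aut G t = \<one>\<^bsub>Aut G\<^esub> \<longleftrightarrow> t \<in> centre G"
proof -
  have "conj_aut G t = \<one>\<^bsub>Aut G\<^esub> \<longleftrightarrow> (\<forall>x \<in> carrier G. conj_aut G t x = x)"
    using t one_Aut_apply Aut_eqI[OF conj_aut_closed[OF t] Aut.one_closed] by metis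
  also have "\<dots> \<longleftrightarrow> (\<forall>x \<in> carrier G. t \<otimes> x = x \<otimes> t)"
    using t by (auto simp: conj_aut_apply m_assoc inv_solve_left')
  also have "\<dots> \<longleftrightarrow> t \<in> centre G"
    using t unfolding centre_def by blast
  finally show ?thesis .
qed

lemma Inn_normal: "Inn G \<lhd> Aut G"
proof -
  interpret c: group_hom G "Aut G" "conj_aut G"
    by (simp add: G group_Aut conj_aut_hom group_hom_def group_hom_axioms_def)
  have "subgroup (Inn G) (Aut G)"
    unfolding Inn_def by (rule c.img_is_subgroup)
  moreover have "\<exists>n' \<in> Inn G. n \<otimes>\<^bsub>Aut G\<^esub> \<alpha> = \<alpha> \<otimes>\<^bsub>Aut G\<^esub> n'"
    if "\<alpha> \<in> carrier (Aut G)" and "n \<in> Inn G" for \<alpha> n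
    using that conj_aut_Aut[OF that(1)] by (auto simp: Inn_def)
  ultimately show ?thesis
    by (rule Aut.normal_of_commute)
qed

interpretation Inn: normal "Inn G" "Aut G" by (rule Inn_normal)

lemma group_Out: "group (Out G)"
  unfolding Out_def by (rule Inn.factorgroup_is_group)

lemma carrier_Out: "carrier (Out G) = outer_class G ` carrier (Aut G)"
  by (simp add: Out_def carrier_FactGroup)

lemma outer_class_hom: "outer_class G \<in> hom (Aut G) (Out G)"
  unfolding Out_def by (rule Inn.r_coset_hom_Mod)

lemma mem_outer_class_iff:
  assumes "\<alpha> \<in> carrier (Aut G)"
  shows "\<beta> \<in> outer_class G \<alpha> \<longleftrightarrow> (\<exists>t \<in> carrier G. \<beta> = conj_aut G t \<otimes>\<^bsub>Aut G\<^esub> \<alpha>)"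
  by (auto simp: r_coset_def Inn_def)

lemma outer_class_eq_iff:
  assumes "\<alpha> \<in> carrier (Aut G)" "\<beta> \<in> carrier (Aut G)"
  shows "outer_class G \<beta> = outer_class G \<alpha> \<longleftrightarrow> (\<exists>t \<in> carrier G. \<beta> = conj_aut G t \<otimes>\<^bsub>Aut G\<^esub> \<alpha>)"
  unfolding mem_outer_class_iff[OF assms(1), symmetric]
  using assms Aut.repr_independence[OF _ assms(1)] Aut.rcos_self[OF assms(2)] Inn.subgroup_axioms
  by metis

lemma Aut_centre [simp]:
  assumes "\<alpha> \<in> carrier (Aut G)" "z \<in> centre G"
  shows "\<alpha> z \<in> centre G"
proof -
  have "\<alpha> z \<otimes> x = x \<otimes> \<alpha> z" if x: "x \<in> carrier G" for x
  proof -
    have "z \<otimes> (inv\<^bsub>Aut G\<^esub> \<alpha>) x = (inv\<^bsub>Aut G\<^esub> \<alpha>) x \<otimes> z"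
      using assms x by (intro centre_commute) simp_all
    then have "\<alpha> (z \<otimes> (inv\<^bsub>Aut G\<^esub> \<alpha>) x) = \<alpha> ((inv\<^bsub>Aut G\<^esub> \<alpha>) x \<otimes> z)"
      by simp
    then show ?thesis using assms x by simp
  qed
  then show ?thesis using assms by (intro centreI) simp_all
qed

lemma subgroup_centre: "subgroup (centre G) G"
proof (rule subgroupI)
  show "inv z \<in> centre G" if "z \<in> centre G" for z
  proof -
    have "inv z \<otimes> x = x \<otimes> inv z" if x: "x \<in> carrier G" for x
    proof -
      have "z \<otimes> inv x = inv x \<otimes> z" using \<open>z \<in> centre G\<close> x by (intro centre_commute) simp_all
      then have "inv (z \<otimes> inv x) = inv (inv x \<otimes> z)" by simp
      then show ?thesis
        using \<open>z \<in> centre G\<close> x centre_closed by (simp add: inv_mult_group)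
    qed
    then show ?thesis using that centre_closed by (intro centreI) simp_all
  qed
  show "z \<otimes> y \<in> centre G" if "z \<in> centre G" "y \<in> centre G" for z y
  proof -
    have "z \<otimes> y \<otimes> x = x \<otimes> (z \<otimes> y)" if "x \<in> carrier G" for x
      using that \<open>z \<in> centre G\<close> \<open>y \<in> centre G\<close>
      by (metis centre_commute centre_closed m_assoc)
    then show ?thesis using that centre_closed by (intro centreI) simp_all
  qed
  have "\<one> \<in> centre G" by (rule centreI) simp_all
  then show "centre G \<noteq> {}" by blast
qed auto

lemma comm_group_centre: "comm_group (G\<lparr>carrier := centre G\<rparr>)"
  using subgroup.subgroup_is_group[OF subgroup_centre G]
  by (rule group.group_comm_groupI) (use centre_commute centre_closed in auto)

end

section \<open>Lifting the outer automorphism group\<close>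

text \<open>By Bezout there is m with n m congruent to 1 modulo the order of the group, so the m-th
  power inverts the n-th power.\<close>

lemma (in group) coprime_pow:
  assumes "finite (carrier G)" "coprime n (order G)" "n \<noteq> 0"
  obtains m :: nat where "\<And>x. x \<in> carrier G \<Longrightarrow> (x [^] n) [^] m = x"
proof -
  obtain k m where "n * m = order G * k + gcd n (order G)"
    using bezout_nat[OF \<open>n \<noteq> 0\<close>, of "order G"] by blast
  then have "n * m = order G * k + 1" using assms by simp
  then have "(x [^] n) [^] m = x" if "x \<in> carrier G" for x
    using that by (simp add: nat_pow_pow nat_pow_mult[symmetric] pow_order_eq_1 nat_pow_pow[symmetric])
  then show thesis by (rule that)
qed

lemma hom_finprod:
  assumes "comm_monoid A" "comm_monoid B" "h \<in> hom A B" "h \<one>\<^bsub>A\<^esub> = \<one>\<^bsub>B\<^esub>" "f \<in> I \<rightarrow> carrier A"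
  shows "h (finprod A f I) = finprod B (\<lambda>i. h (f i)) I"
proof (cases "finite I")
  case True
  then show ?thesis
    using assms(5)
  proof (induction I)
    case empty
    then show ?case using assms by (simp add: comm_monoid.finprod_empty)
  next
    case (insert i I)
    then have f: "f i \<in> carrier A" "f \<in> I \<rightarrow> carrier A" by auto
    moreover have "(\<lambda>i. h (f i)) \<in> I \<rightarrow> carrier B" "h (f i) \<in> carrier B"
      using f assms(3) by (auto simp: hom_def)
    ultimately show ?case
      using insert assms(3) comm_monoid.finprod_closed[OF assms(1) f(2)]
      by (simp add: comm_monoid.finprod_insert assms(1,2) hom_mult)
  qed
next
  case False
  then show ?thesis using assms by (simp add: comm_monoid.finprod_infinite)
qed

text \<open>\<open>U\<close> is an extension of \<open>G\<close> by \<open>Out G\<close> with the tautological coupling; equivalently, an extension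
  of \<open>Aut G\<close> by the centre that restricts over \<open>Inn G\<close> to \<open>G\<close>.\<close>

locale outer_lift =
  fixes G :: "('a, 'b) monoid_scheme" and U :: "'w monoid"
    and \<psi> :: "'w \<Rightarrow> 'a \<Rightarrow> 'a" and \<gamma> :: "'a \<Rightarrow> 'w"
  assumes group_G: "group G" and group_U: "group U"
    and \<psi>_hom: "\<psi> \<in> hom U (Aut G)" and \<psi>_onto: "\<psi> ` carrier U = carrier (Aut G)"
    and \<gamma>_hom: "\<gamma> \<in> hom G U" and \<gamma>_inj: "inj_on \<gamma> (carrier G)"
    and \<gamma>_commute: "\<And>u g. u \<in> carrier U \<Longrightarrow> g \<in> carrier G \<Longrightarrow> \<gamma> g \<otimes>\<^bsub>U\<^esub> u = u \<otimes>\<^bsub>U\<^esub> \<gamma> (\<psi> u g)"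
    and \<psi>_kernel: "\<And>u. u \<in> carrier U \<Longrightarrow> \<psi> u = \<one>\<^bsub>Aut G\<^esub> \<Longrightarrow> \<exists>z \<in> centre G. u = \<gamma> z"

definition Out_rep :: "('a \<Rightarrow> 'a) set \<Rightarrow> 'a \<Rightarrow> 'a" where
  "Out_rep q = (SOME \<alpha>. \<alpha> \<in> q)"

text \<open>For representatives \<open>t\<^sub>q\<close> of the cosets \<open>q\<close> in \<open>Out G\<close>, the automorphism
  \<open>t\<^sub>q \<alpha> t\<^sub>q\<^sub>\<alpha>\<^sup>-\<^sup>1\<close> is inner; the second component \<open>f\<close> chooses an element \<open>f q\<close> inducing it. As
  \<open>Out G\<close> permutes the coordinates, this is a group of wreath product type, and an extension
  of \<open>Aut G\<close> by the functions from \<open>Out G\<close> to the centre.\<close>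

definition induced_lift ::
    "('a, 'b) monoid_scheme \<Rightarrow> (('a \<Rightarrow> 'a) \<times> (('a \<Rightarrow> 'a) set \<Rightarrow> 'a)) monoid" where
  "induced_lift G = \<lparr>
     carrier = {(\<alpha>, f). \<alpha> \<in> carrier (Aut G) \<and> f \<in> carrier (Out G) \<rightarrow>\<^sub>E carrier G \<and>
       (\<forall>q \<in> carrier (Out G). conj_aut G (f q) \<otimes>\<^bsub>Aut G\<^esub> Out_rep (q #>\<^bsub>Aut G\<^esub> \<alpha>) =
          Out_rep q \<otimes>\<^bsub>Aut G\<^esub> \<alpha>)},
     monoid.mult = (\<lambda>(\<alpha>, f) (\<beta>, h). (\<alpha> \<otimes>\<^bsub>Aut G\<^esub> \<beta>,
       \<lambda>q \<in> carrier (Out G). f q \<otimes>\<^bsub>G\<^esub> h (q #>\<^bsub>Aut G\<^esub> \<alpha>))),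
     one = (\<one>\<^bsub>Aut G\<^esub>, \<lambda>q \<in> carrier (Out G). \<one>\<^bsub>G\<^esub>)\<rparr>"

text \<open>Twisting by the representatives makes the norm equivariant under \<open>Aut G\<close>; it is the transfer
  (corestriction) from \<open>Inn G\<close> to \<open>Aut G\<close>.\<close>

definition centre_norm :: "('a, 'b) monoid_scheme \<Rightarrow> (('a \<Rightarrow> 'a) set \<Rightarrow> 'a) \<Rightarrow> 'a" where
  "centre_norm G f =
     finprod (G\<lparr>carrier := centre G\<rparr>) (\<lambda>q. Out_rep q (f q)) (carrier (Out G))"

text \<open>Over the identity of \<open>Aut G\<close> the second components in
  \<open>induced_lift G\<close> are exactly the central functions, on which the norm is
  defined.\<close>

definition norm_kernel ::
    "('a, 'b) monoid_scheme \<Rightarrow> (('a \<Rightarrow> 'a) \<times> (('a \<Rightarrow> 'a) set \<Rightarrow> 'a)) set" where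
  "norm_kernel G =
     {\<one>\<^bsub>Aut G\<^esub>} \<times> {f \<in> carrier (Out G) \<rightarrow>\<^sub>E centre G. centre_norm G f = \<one>\<^bsub>G\<^esub>}"

text \<open>Conjugation by x fixes every coset q, so the compatibility condition asks for f q with
  conj_(f q) t_q = t_q conj_x. This determines f q up to the centre; the choice t_q^-1 x is
  multiplicative in x.\<close>

definition diag_lift ::
    "('a, 'b) monoid_scheme \<Rightarrow> 'a \<Rightarrow> ('a \<Rightarrow> 'a) \<times> (('a \<Rightarrow> 'a) set \<Rightarrow> 'a)" where
  "diag_lift G x =
     (conj_aut G x, \<lambda>q \<in> carrier (Out G). (inv\<^bsub>Aut G\<^esub> (Out_rep q)) x)"

context
  fixes G :: "('a, 'b) monoid_scheme" (structure)
  assumes G: "group G"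
begin

interpretation group G by (rule G)
interpretation Aut: group "Aut G" by (rule group_Aut[OF G])
interpretation Inn: normal "Inn G" "Aut G" by (rule Inn_normal[OF G])
interpretation Zc: comm_group "G\<lparr>carrier := centre G\<rparr>" by (rule comm_group_centre[OF G])

lemmas Aut_rules [simp] =
  Aut_closed[OF G] Aut_mult[OF G] Aut_inv[OF G] Aut_one[OF G] mult_Aut_apply[OF G]
  one_Aut_apply[OF G] Aut_inv_apply[OF G] conj_aut_closed[OF G] Aut_centre[OF G]

declare centre_closed[OF G, simp]

lemma Out_rep:
  assumes "q \<in> carrier (Out G)"
  shows Out_rep_closed [simp]: "Out_rep q \<in> carrier (Aut G)"
    and outer_class_Out_rep [simp]: "outer_class G (Out_rep q) = q"
proof -
  obtain \<alpha> where \<alpha>: "\<alpha> \<in> carrier (Aut G)" "q = outer_class G \<alpha>"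
    using assms by (auto simp: carrier_Out[OF G])
  then have "\<alpha> \<in> q" using Aut.rcos_self Inn.subgroup_axioms by blast
  then have "Out_rep q \<in> q" unfolding Out_rep_def by (rule someI[of "\<lambda>\<alpha>. \<alpha> \<in> q"])
  moreover from this show "Out_rep q \<in> carrier (Aut G)"
    using \<alpha> Aut.r_coset_subset_G Inn.subset by blast
  ultimately show "outer_class G (Out_rep q) = q"
    using \<alpha> Aut.repr_independence[OF _ \<alpha>(1) Inn.subgroup_axioms] by metis
qed

section \<open>The action of \<open>Aut G\<close> on \<open>Out G\<close> by right
  multiplication\<close>

lemma Out_act:
  assumes "q \<in> carrier (Out G)" "\<alpha> \<in> carrier (Aut G)"
  shows "q #>\<^bsub>Aut G\<^esub> \<alpha> = outer_class G (Out_rep q \<otimes>\<^bsub>Aut G\<^esub> \<alpha>)"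
  using assms Aut.coset_mult_assoc[OF Inn.subset, of "Out_rep q" \<alpha>] by simp

lemma Out_act_closed [simp]:
  "q \<in> carrier (Out G) \<Longrightarrow> \<alpha> \<in> carrier (Aut G) \<Longrightarrow> q #>\<^bsub>Aut G\<^esub> \<alpha> \<in> carrier (Out G)"
  by (simp add: Out_act) (simp add: carrier_Out[OF G])

lemma Out_subset: "q \<in> carrier (Out G) \<Longrightarrow> q \<subseteq> carrier (Aut G)"
  using Aut.r_coset_subset_G[OF Inn.subset] by (auto simp: carrier_Out[OF G])

lemma Out_act_mult [simp]:
  assumes "q \<in> carrier (Out G)" "\<alpha> \<in> carrier (Aut G)" "\<beta> \<in> carrier (Aut G)"
  shows "q #>\<^bsub>Aut G\<^esub> (\<alpha> \<otimes>\<^bsub>Aut G\<^esub> \<beta>) = (q #>\<^bsub>Aut G\<^esub> \<alpha>) #>\<^bsub>Aut G\<^esub> \<beta>"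
  using assms Aut.coset_mult_assoc[OF Out_subset] by simp

lemma Out_act_one [simp]: "q \<in> carrier (Out G) \<Longrightarrow> q #>\<^bsub>Aut G\<^esub> \<one>\<^bsub>Aut G\<^esub> = q"
  using Aut.coset_mult_one[OF Out_subset] by simp

lemma Out_act_inv [simp]:
  assumes "q \<in> carrier (Out G)" "\<alpha> \<in> carrier (Aut G)"
  shows "(q #>\<^bsub>Aut G\<^esub> inv\<^bsub>Aut G\<^esub> \<alpha>) #>\<^bsub>Aut G\<^esub> \<alpha> = q"
    "(q #>\<^bsub>Aut G\<^esub> \<alpha>) #>\<^bsub>Aut G\<^esub> inv\<^bsub>Aut G\<^esub> \<alpha> = q"
  using assms Out_act_mult[of q "inv\<^bsub>Aut G\<^esub> \<alpha>" \<alpha>] Out_act_mult[of q \<alpha> "inv\<^bsub>Aut G\<^esub> \<alpha>"] by simp_all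

text \<open>Since \<open>Inn G\<close> is normal, an inner factor on the right of t_q moves to the
  left of it, where the coset absorbs it. The element y = t_q^-1 x induces the moved factor.\<close>

lemma Out_act_conj [simp]:
  assumes "q \<in> carrier (Out G)" "x \<in> carrier G"
  shows "q #>\<^bsub>Aut G\<^esub> conj_aut G x = q"
proof -
  define y where "y = (inv\<^bsub>Aut G\<^esub> (Out_rep q)) x"
  have "y \<in> carrier G" using assms by (simp add: y_def)
  moreover have "Out_rep q \<otimes>\<^bsub>Aut G\<^esub> conj_aut G x = conj_aut G y \<otimes>\<^bsub>Aut G\<^esub> Out_rep q"
    using assms conj_aut_Aut[OF G, of "Out_rep q" y] by (simp add: y_def)
  ultimately have "outer_class G (Out_rep q \<otimes>\<^bsub>Aut G\<^esub> conj_aut G x) = outer_class G (Out_rep q)"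
    using assms by (subst outer_class_eq_iff[OF G]) auto
  then show ?thesis using assms by (simp add: Out_act)
qed

section \<open>The extension of \<open>Aut G\<close> by central functions on
  \<open>Out G\<close>\<close>

lemma induced_liftE:
  assumes "x \<in> carrier (induced_lift G)"
  obtains \<alpha> f where "x = (\<alpha>, f)" "\<alpha> \<in> carrier (Aut G)" "f \<in> extensional (carrier (Out G))"
    "\<And>q. q \<in> carrier (Out G) \<Longrightarrow> f q \<in> carrier G"
    "\<And>q. q \<in> carrier (Out G) \<Longrightarrow>
      conj_aut G (f q) \<otimes>\<^bsub>Aut G\<^esub> Out_rep (q #>\<^bsub>Aut G\<^esub> \<alpha>) = Out_rep q \<otimes>\<^bsub>Aut G\<^esub> \<alpha>"
  using assms that by (fastforce simp: induced_lift_def PiE_def)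

lemma group_induced_lift: "group (induced_lift G)"
proof (rule groupI)
  fix x y assume "x \<in> carrier (induced_lift G)" "y \<in> carrier (induced_lift G)"
  then obtain \<alpha> f \<beta> h where xy: "x = (\<alpha>, f)" "y = (\<beta>, h)"
    and [simp]: "\<alpha> \<in> carrier (Aut G)" "\<beta> \<in> carrier (Aut G)"
      "\<And>q. q \<in> carrier (Out G) \<Longrightarrow> f q \<in> carrier G" "\<And>q. q \<in> carrier (Out G) \<Longrightarrow> h q \<in> carrier G"
    and feq: "\<And>q. q \<in> carrier (Out G) \<Longrightarrow>
      conj_aut G (f q) \<otimes>\<^bsub>Aut G\<^esub> Out_rep (q #>\<^bsub>Aut G\<^esub> \<alpha>) = Out_rep q \<otimes>\<^bsub>Aut G\<^esub> \<alpha>"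
    and heq: "\<And>q. q \<in> carrier (Out G) \<Longrightarrow>
      conj_aut G (h q) \<otimes>\<^bsub>Aut G\<^esub> Out_rep (q #>\<^bsub>Aut G\<^esub> \<beta>) = Out_rep q \<otimes>\<^bsub>Aut G\<^esub> \<beta>"
    by (elim induced_liftE) blast
  \<comment> \<open>\<open>f q\<close> accounts for the passage from the representative of q to that
    of q\<alpha>, and \<open>h\<close> continues from q\<alpha>; this is why the product evaluates
    \<open>h\<close> at the shifted coset.\<close>
  have "conj_aut G (f q \<otimes> h (q #>\<^bsub>Aut G\<^esub> \<alpha>)) \<otimes>\<^bsub>Aut G\<^esub> Out_rep ((q #>\<^bsub>Aut G\<^esub> \<alpha>) #>\<^bsub>Aut G\<^esub> \<beta>) =
      Out_rep q \<otimes>\<^bsub>Aut G\<^esub> (\<alpha> \<otimes>\<^bsub>Aut G\<^esub> \<beta>)" if q: "q \<in> carrier (Out G)" for q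
  proof -
    have "conj_aut G (f q \<otimes> h (q #>\<^bsub>Aut G\<^esub> \<alpha>)) \<otimes>\<^bsub>Aut G\<^esub> Out_rep ((q #>\<^bsub>Aut G\<^esub> \<alpha>) #>\<^bsub>Aut G\<^esub> \<beta>) =
      conj_aut G (f q) \<otimes>\<^bsub>Aut G\<^esub> (conj_aut G (h (q #>\<^bsub>Aut G\<^esub> \<alpha>)) \<otimes>\<^bsub>Aut G\<^esub> Out_rep ((q #>\<^bsub>Aut G\<^esub> \<alpha>) #>\<^bsub>Aut G\<^esub> \<beta>))"
      using q by (simp add: hom_mult[OF conj_aut_hom[OF G]] Aut.m_assoc)
    also have "\<dots> = conj_aut G (f q) \<otimes>\<^bsub>Aut G\<^esub> Out_rep (q #>\<^bsub>Aut G\<^esub> \<alpha>) \<otimes>\<^bsub>Aut G\<^esub> \<beta>"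
      using q by (simp add: heq Aut.m_assoc)
    also have "\<dots> = Out_rep q \<otimes>\<^bsub>Aut G\<^esub> (\<alpha> \<otimes>\<^bsub>Aut G\<^esub> \<beta>)"
      using q by (simp add: feq Aut.m_assoc)
    finally show ?thesis .
  qed
  then show "x \<otimes>\<^bsub>induced_lift G\<^esub> y \<in> carrier (induced_lift G)"
    by (auto simp: xy induced_lift_def)
next
  show "\<one>\<^bsub>induced_lift G\<^esub> \<in> carrier (induced_lift G)"
    by (auto simp: induced_lift_def hom_one[OF conj_aut_hom[OF G] G group_Aut[OF G]])
next
  fix x y z
  assume "x \<in> carrier (induced_lift G)" "y \<in> carrier (induced_lift G)" "z \<in> carrier (induced_lift G)"
  then show "x \<otimes>\<^bsub>induced_lift G\<^esub> y \<otimes>\<^bsub>induced_lift G\<^esub> z = x \<otimes>\<^bsub>induced_lift G\<^esub> (y \<otimes>\<^bsub>induced_lift G\<^esub> z)"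
    by (elim induced_liftE) (auto simp: induced_lift_def Aut.m_assoc m_assoc intro!: restrict_ext)
next
  fix x assume "x \<in> carrier (induced_lift G)"
  then show "\<one>\<^bsub>induced_lift G\<^esub> \<otimes>\<^bsub>induced_lift G\<^esub> x = x"
    by (elim induced_liftE)
      (auto simp: induced_lift_def intro!: extensionalityI[of _ "carrier (Out G)"])
next
  fix x assume "x \<in> carrier (induced_lift G)"
  then obtain \<alpha> f where x: "x = (\<alpha>, f)" and [simp]: "\<alpha> \<in> carrier (Aut G)"
      "\<And>q. q \<in> carrier (Out G) \<Longrightarrow> f q \<in> carrier G"
    and feq: "\<And>q. q \<in> carrier (Out G) \<Longrightarrow>
      conj_aut G (f q) \<otimes>\<^bsub>Aut G\<^esub> Out_rep (q #>\<^bsub>Aut G\<^esub> \<alpha>) = Out_rep q \<otimes>\<^bsub>Aut G\<^esub> \<alpha>"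
    by (elim induced_liftE) blast
  \<comment> \<open>The coordinate of y x at q is the coordinate of y at q times f at q\<alpha>^-1,
    which dictates the inverse. Its compatibility is that of f at the coset q\<alpha>^-1.\<close>
  define y where "y = (inv\<^bsub>Aut G\<^esub> \<alpha>, \<lambda>q \<in> carrier (Out G). inv (f (q #>\<^bsub>Aut G\<^esub> inv\<^bsub>Aut G\<^esub> \<alpha>)))"
  interpret c: group_hom G "Aut G" "conj_aut G"
    by (simp add: G group_Aut conj_aut_hom group_hom_def group_hom_axioms_def)
  have "conj_aut G (inv (f (q #>\<^bsub>Aut G\<^esub> inv\<^bsub>Aut G\<^esub> \<alpha>))) \<otimes>\<^bsub>Aut G\<^esub> Out_rep (q #>\<^bsub>Aut G\<^esub> inv\<^bsub>Aut G\<^esub> \<alpha>) =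
      Out_rep q \<otimes>\<^bsub>Aut G\<^esub> inv\<^bsub>Aut G\<^esub> \<alpha>" if q: "q \<in> carrier (Out G)" for q
    using q feq[of "q #>\<^bsub>Aut G\<^esub> inv\<^bsub>Aut G\<^esub> \<alpha>", symmetric]
    by (simp add: Aut.inv_solve_right Aut.m_assoc Aut.mult_inv_cancel)
  then have "y \<in> carrier (induced_lift G)"
    by (auto simp: y_def induced_lift_def)
  moreover have "y \<otimes>\<^bsub>induced_lift G\<^esub> x = \<one>\<^bsub>induced_lift G\<^esub>"
    by (auto simp: x y_def induced_lift_def intro!: restrict_ext)
  ultimately show "\<exists>y \<in> carrier (induced_lift G). y \<otimes>\<^bsub>induced_lift G\<^esub> x = \<one>\<^bsub>induced_lift G\<^esub>"
    by blast
qed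

interpretation W: group "induced_lift G" by (rule group_induced_lift)

lemma fst_hom: "fst \<in> hom (induced_lift G) (Aut G)"
  by (rule homI) (auto elim: induced_liftE, simp add: induced_lift_def split: prod.splits)

lemma central_mem_induced_lift:
  assumes "f \<in> carrier (Out G) \<rightarrow>\<^sub>E centre G"
  shows "(\<one>\<^bsub>Aut G\<^esub>, f) \<in> carrier (induced_lift G)"
proof -
  have "f \<in> carrier (Out G) \<rightarrow>\<^sub>E carrier G"
    by (rule subsetD[OF PiE_mono assms]) auto
  moreover have "conj_aut G (f q) = \<one>\<^bsub>Aut G\<^esub>" if "q \<in> carrier (Out G)" for q
    using PiE_mem[OF assms that] conj_aut_eq_one_iff[OF G] by simp
  ultimately show ?thesis by (simp add: induced_lift_def)
qed

lemma induced_lift_central: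
  assumes "(\<one>\<^bsub>Aut G\<^esub>, f) \<in> carrier (induced_lift G)"
  shows "f \<in> carrier (Out G) \<rightarrow>\<^sub>E centre G"
proof (rule PiE_I)
  fix q assume q: "q \<in> carrier (Out G)"
  have f: "f q \<in> carrier G" "conj_aut G (f q) \<otimes>\<^bsub>Aut G\<^esub> Out_rep q = Out_rep q"
    using assms q by (auto elim!: induced_liftE)
  then have "conj_aut G (f q) = \<one>\<^bsub>Aut G\<^esub>"
    using Aut.r_cancel_one[of "Out_rep q" "conj_aut G (f q)"] q by simp
  then show "f q \<in> centre G" using f conj_aut_eq_one_iff[OF G] by simp
qed (use assms in \<open>auto simp: induced_lift_def\<close>)

lemma diag_lift_hom: "diag_lift G \<in> hom G (induced_lift G)"
proof (rule homI)
  show "diag_lift G x \<in> carrier (induced_lift G)" if x: "x \<in> carrier G" for x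
    using x conj_aut_Aut[OF G Out_rep_closed, of _ "(inv\<^bsub>Aut G\<^esub> (Out_rep _)) x"]
    by (simp add: diag_lift_def induced_lift_def)
  show "diag_lift G (x \<otimes> y) = diag_lift G x \<otimes>\<^bsub>induced_lift G\<^esub> diag_lift G y"
    if "x \<in> carrier G" "y \<in> carrier G" for x y
    using that hom_mult[OF conj_aut_hom[OF G]]
    by (auto simp: diag_lift_def induced_lift_def intro!: restrict_ext)
qed

text \<open>The compatibility condition evaluated at a point. For central x the conjugation
  disappears, and t_q followed by \<alpha> agrees with t_(q\<alpha>) on the centre.\<close>

lemma induced_lift_rep:
  assumes "(\<alpha>, f) \<in> carrier (induced_lift G)" "q \<in> carrier (Out G)" "x \<in> carrier G"
  shows "Out_rep (q #>\<^bsub>Aut G\<^esub> \<alpha>) (conj_aut G (f q) x) = \<alpha> (Out_rep q x)"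
proof -
  have "\<alpha> \<in> carrier (Aut G)" "f q \<in> carrier G"
    and "conj_aut G (f q) \<otimes>\<^bsub>Aut G\<^esub> Out_rep (q #>\<^bsub>Aut G\<^esub> \<alpha>) = Out_rep q \<otimes>\<^bsub>Aut G\<^esub> \<alpha>"
    using assms by (auto elim!: induced_liftE)
  then show ?thesis
    using assms mult_Aut_apply[OF G, of "conj_aut G (f q)" "Out_rep (q #>\<^bsub>Aut G\<^esub> \<alpha>)" x] by simp
qed

text \<open>In coordinate q the element x appears as t_q^-1 x, and conjugation by f q turns it into
  t_(q\<alpha>)^-1 (\<alpha> x). Thus w acts on the diagonal copy of G through \<alpha> =
  \<open>fst w\<close>; in the quotient this becomes \<open>\<gamma>_commute\<close>.\<close>

lemma diag_lift_conj:
  assumes w: "w \<in> carrier (induced_lift G)" and x: "x \<in> carrier G"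
  shows "diag_lift G x \<otimes>\<^bsub>induced_lift G\<^esub> w = w \<otimes>\<^bsub>induced_lift G\<^esub> diag_lift G (fst w x)"
proof -
  obtain \<alpha> f where w': "w = (\<alpha>, f)" by fastforce
  have \<alpha> [simp]: "\<alpha> \<in> carrier (Aut G)" and f [simp]: "\<And>q. q \<in> carrier (Out G) \<Longrightarrow> f q \<in> carrier G"
    using w by (auto simp: w' elim!: induced_liftE)
  have "(inv\<^bsub>Aut G\<^esub> (Out_rep q)) x \<otimes> f q =
      f q \<otimes> (inv\<^bsub>Aut G\<^esub> (Out_rep (q #>\<^bsub>Aut G\<^esub> \<alpha>))) (\<alpha> x)" if q: "q \<in> carrier (Out G)" for q
  proof -
    define y where "y = (inv\<^bsub>Aut G\<^esub> (Out_rep q)) x"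
    have y: "y \<in> carrier G" using x q by (simp add: y_def)
    have "Out_rep (q #>\<^bsub>Aut G\<^esub> \<alpha>) (conj_aut G (f q) y) = \<alpha> x"
      using induced_lift_rep[OF w[unfolded w'] q y] x q by (simp add: y_def)
    then have "(inv\<^bsub>Aut G\<^esub> (Out_rep (q #>\<^bsub>Aut G\<^esub> \<alpha>))) (\<alpha> x) = conj_aut G (f q) y"
      using q y Aut_inv_apply(1)[OF G Out_rep_closed, of "q #>\<^bsub>Aut G\<^esub> \<alpha>" "conj_aut G (f q) y"] by simp
    then show ?thesis
      using q y f by (simp add: y_def[symmetric] conj_aut_apply[OF G] m_assoc mult_inv_cancel)
  qed
  moreover have "conj_aut G x \<otimes>\<^bsub>Aut G\<^esub> \<alpha> = \<alpha> \<otimes>\<^bsub>Aut G\<^esub> conj_aut G (\<alpha> x)"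
    by (rule conj_aut_Aut[OF G \<alpha> x])
  ultimately show ?thesis
    using x by (auto simp: w' diag_lift_def induced_lift_def intro!: restrict_ext)
qed

section \<open>The norm on central functions and its kernel\<close>

lemma centre_norm_closed [simp]: "centre_norm G f \<in> centre G"
  if "f \<in> carrier (Out G) \<rightarrow>\<^sub>E centre G"
  unfolding centre_norm_def
  using Zc.finprod_closed[of "\<lambda>q. Out_rep q (f q)" "carrier (Out G)"] PiE_mem[OF that] by simp

lemma centre_norm_mult:
  assumes "f \<in> carrier (Out G) \<rightarrow>\<^sub>E centre G" "h \<in> carrier (Out G) \<rightarrow>\<^sub>E centre G"
  shows "centre_norm G (\<lambda>q \<in> carrier (Out G). f q \<otimes> h q) = centre_norm G f \<otimes> centre_norm G h"
proof -
  have [simp]: "f q \<in> centre G" "h q \<in> centre G" if "q \<in> carrier (Out G)" for q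
    using PiE_mem[OF assms(1) that] PiE_mem[OF assms(2) that] by simp_all
  have "centre_norm G (\<lambda>q \<in> carrier (Out G). f q \<otimes> h q) =
      finprod (G\<lparr>carrier := centre G\<rparr>) (\<lambda>q. Out_rep q (f q) \<otimes> Out_rep q (h q)) (carrier (Out G))"
    unfolding centre_norm_def
    by (rule Zc.finprod_cong') (auto simp: subgroup.m_closed[OF subgroup_centre[OF G]])
  also have "\<dots> = centre_norm G f \<otimes> centre_norm G h"
    unfolding centre_norm_def
    using Zc.finprod_multf[of "\<lambda>q. Out_rep q (f q)" "carrier (Out G)" "\<lambda>q. Out_rep q (h q)"] by auto
  finally show ?thesis .
qed

text \<open>On the centre, t_q followed by \<alpha> equals t_(q\<alpha>), because the two differ by
  an inner automorphism. Applying \<alpha> to the norm of the shifted function thus only permutes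
  the factors by q \<mapsto> q\<alpha>.\<close>

lemma centre_norm_act:
  assumes w: "(\<alpha>, g) \<in> carrier (induced_lift G)" and f: "f \<in> carrier (Out G) \<rightarrow>\<^sub>E centre G"
  shows "\<alpha> (centre_norm G (\<lambda>q \<in> carrier (Out G). f (q #>\<^bsub>Aut G\<^esub> \<alpha>))) = centre_norm G f"
proof -
  have [simp]: "f q \<in> centre G" if "q \<in> carrier (Out G)" for q
    using PiE_mem[OF f that] .
  have \<alpha> [simp]: "\<alpha> \<in> carrier (Aut G)" and g [simp]: "\<And>q. q \<in> carrier (Out G) \<Longrightarrow> g q \<in> carrier G"
    using w by (auto elim!: induced_liftE)
  have conj: "conj_aut G t z = z" if "t \<in> carrier G" "z \<in> centre G" for t z
    using that centre_commute[OF G that(2,1)] by (simp add: conj_aut_apply[OF G] m_assoc mult_inv_cancel)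
  have rep: "\<alpha> (Out_rep q z) = Out_rep (q #>\<^bsub>Aut G\<^esub> \<alpha>) z" if "q \<in> carrier (Out G)" "z \<in> centre G" for q z
    using induced_lift_rep[OF w that(1), of z] that conj by simp
  have hom: "\<alpha> \<in> hom (G\<lparr>carrier := centre G\<rparr>) (G\<lparr>carrier := centre G\<rparr>)"
    by (rule homI) auto
  have "\<alpha> (centre_norm G (\<lambda>q \<in> carrier (Out G). f (q #>\<^bsub>Aut G\<^esub> \<alpha>))) =
      finprod (G\<lparr>carrier := centre G\<rparr>)
        (\<lambda>q. \<alpha> (Out_rep q ((\<lambda>q \<in> carrier (Out G). f (q #>\<^bsub>Aut G\<^esub> \<alpha>)) q))) (carrier (Out G))"
    unfolding centre_norm_def
    by (rule hom_finprod[OF Zc.comm_monoid_axioms Zc.comm_monoid_axioms hom]) auto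
  also have "\<dots> = finprod (G\<lparr>carrier := centre G\<rparr>)
      (\<lambda>q. Out_rep (q #>\<^bsub>Aut G\<^esub> \<alpha>) (f (q #>\<^bsub>Aut G\<^esub> \<alpha>))) (carrier (Out G))"
    by (rule Zc.finprod_cong') (auto simp: rep)
  also have "\<dots> = finprod (G\<lparr>carrier := centre G\<rparr>) (\<lambda>q. Out_rep q (f q))
      ((\<lambda>q. q #>\<^bsub>Aut G\<^esub> \<alpha>) ` carrier (Out G))"
    by (rule Zc.finprod_reindex[symmetric]) (auto intro!: inj_onI dest: arg_cong[of _ _ "\<lambda>q. q #>\<^bsub>Aut G\<^esub> inv\<^bsub>Aut G\<^esub> \<alpha>"])
  also have "(\<lambda>q. q #>\<^bsub>Aut G\<^esub> \<alpha>) ` carrier (Out G) = carrier (Out G)"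
  proof
    show "carrier (Out G) \<subseteq> (\<lambda>q. q #>\<^bsub>Aut G\<^esub> \<alpha>) ` carrier (Out G)"
    proof
      show "q \<in> (\<lambda>q. q #>\<^bsub>Aut G\<^esub> \<alpha>) ` carrier (Out G)" if "q \<in> carrier (Out G)" for q
        using that by (intro image_eqI[of _ _ "q #>\<^bsub>Aut G\<^esub> inv\<^bsub>Aut G\<^esub> \<alpha>"]) simp_all
    qed
  qed auto
  finally show ?thesis by (simp add: centre_norm_def)
qed

text \<open>The norm is a homomorphism only on the kernel V of the projection to
  \<open>Aut G\<close>; \<open>norm_kernel G\<close> is its kernel inside V.\<close>

lemma subgroup_norm_kernel: "subgroup (norm_kernel G) (induced_lift G)"
proof -
  interpret p: group_hom "induced_lift G" "Aut G" fst
    by (simp add: group_induced_lift group_Aut[OF G] fst_hom group_hom_def group_hom_axioms_def)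
  define V where "V = kernel (induced_lift G) (Aut G) fst"
  have V: "subgroup V (induced_lift G)" unfolding V_def by (rule p.subgroup_kernel)
  have VD: "x = (\<one>\<^bsub>Aut G\<^esub>, snd x)" "snd x \<in> carrier (Out G) \<rightarrow>\<^sub>E centre G" if "x \<in> V" for x
    using that induced_lift_central by (cases x; auto simp: V_def kernel_def)+
  have "(\<lambda>x. centre_norm G (snd x)) \<in> hom ((induced_lift G)\<lparr>carrier := V\<rparr>) (G\<lparr>carrier := centre G\<rparr>)"
  proof (rule homI)
    fix x y assume "x \<in> carrier ((induced_lift G)\<lparr>carrier := V\<rparr>)" "y \<in> carrier ((induced_lift G)\<lparr>carrier := V\<rparr>)"
    then have xy: "x \<in> V" "y \<in> V" by auto
    have "snd (x \<otimes>\<^bsub>induced_lift G\<^esub> y) = (\<lambda>q \<in> carrier (Out G). snd x q \<otimes> snd y q)"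
      using VD(1)[OF xy(1)] VD(1)[OF xy(2)]
      by (cases x; cases y) (auto simp: induced_lift_def intro!: restrict_ext)
    then show "centre_norm G (snd (x \<otimes>\<^bsub>(induced_lift G)\<lparr>carrier := V\<rparr>\<^esub> y)) =
        centre_norm G (snd x) \<otimes>\<^bsub>G\<lparr>carrier := centre G\<rparr>\<^esub> centre_norm G (snd y)"
      using centre_norm_mult VD(2) xy by simp
  qed (auto simp: VD)
  then interpret n: group_hom "(induced_lift G)\<lparr>carrier := V\<rparr>" "G\<lparr>carrier := centre G\<rparr>" "\<lambda>x. centre_norm G (snd x)"
    by (simp add: W.subgroup_imp_group[OF V] Zc.is_group group_hom_def group_hom_axioms_def)
  have "norm_kernel G = kernel ((induced_lift G)\<lparr>carrier := V\<rparr>) (G\<lparr>carrier := centre G\<rparr>) (\<lambda>x. centre_norm G (snd x))"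
    using central_mem_induced_lift induced_lift_central
    by (simp add: norm_kernel_def kernel_def V_def set_eq_iff) blast
  then show ?thesis
    using W.incl_subgroup[OF V] n.subgroup_kernel by simp
qed

text \<open>Conjugation by w shifts the coordinates of a central function by \<alpha>, and
  equivariance of the norm keeps its value trivial.\<close>

lemma norm_kernel_normal: "norm_kernel G \<lhd> induced_lift G"
proof -
  have "w \<otimes>\<^bsub>induced_lift G\<^esub> n \<otimes>\<^bsub>induced_lift G\<^esub> inv\<^bsub>induced_lift G\<^esub> w \<in> norm_kernel G"
    if w: "w \<in> carrier (induced_lift G)" and n: "n \<in> norm_kernel G" for w n
  proof -
    obtain \<alpha> g where w': "w = (\<alpha>, g)" by fastforce
    have \<alpha> [simp]: "\<alpha> \<in> carrier (Aut G)" and g [simp]: "\<And>q. q \<in> carrier (Out G) \<Longrightarrow> g q \<in> carrier G"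
      using w by (auto simp: w' elim!: induced_liftE)
    obtain f where n': "n = (\<one>\<^bsub>Aut G\<^esub>, f)" and f: "f \<in> carrier (Out G) \<rightarrow>\<^sub>E centre G" "centre_norm G f = \<one>"
      using n by (auto simp: norm_kernel_def)
    define f' where "f' = (\<lambda>q \<in> carrier (Out G). f (q #>\<^bsub>Aut G\<^esub> \<alpha>))"
    have f': "f' \<in> carrier (Out G) \<rightarrow>\<^sub>E centre G"
      using PiE_mem[OF f(1)] by (auto simp: f'_def)
    have "\<alpha> (centre_norm G f') = \<alpha> \<one>"
      using centre_norm_act[OF w[unfolded w'] f(1)] f(2) by (simp add: f'_def)
    then have "centre_norm G f' = \<one>"
      using Aut_inj[OF G \<alpha>, of "centre_norm G f'" \<one>] f' by simp
    then have k: "(\<one>\<^bsub>Aut G\<^esub>, f') \<in> norm_kernel G"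
      using f' by (simp add: norm_kernel_def)
    \<comment> \<open>At q the left side has g q times f at q\<alpha>, the right side the same
      factors in the other order; f has central values.\<close>
    have "w \<otimes>\<^bsub>induced_lift G\<^esub> n = (\<one>\<^bsub>Aut G\<^esub>, f') \<otimes>\<^bsub>induced_lift G\<^esub> w"
      by (auto simp: w' n' f'_def induced_lift_def
          intro!: restrict_ext centre_commute[OF G, symmetric] PiE_mem[OF f(1)])
    then have "w \<otimes>\<^bsub>induced_lift G\<^esub> n \<otimes>\<^bsub>induced_lift G\<^esub> inv\<^bsub>induced_lift G\<^esub> w = (\<one>\<^bsub>Aut G\<^esub>, f')"
      using w central_mem_induced_lift[OF f'] by (simp add: W.m_assoc)
    then show ?thesis using k by simp
  qed
  then show ?thesis
    using subgroup_norm_kernel by (simp add: W.normal_inv_iff)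
qed

text \<open>The twist by t_q in the norm cancels the t_q^-1 in the diagonal, so every factor is
  z.\<close>

lemma centre_norm_diag:
  assumes "z \<in> centre G"
  shows "centre_norm G (snd (diag_lift G z)) = z [^]\<^bsub>G\<lparr>carrier := centre G\<rparr>\<^esub> card (carrier (Out G))"
proof -
  have "centre_norm G (snd (diag_lift G z)) = finprod (G\<lparr>carrier := centre G\<rparr>) (\<lambda>q. z) (carrier (Out G))"
    unfolding centre_norm_def by (rule Zc.finprod_cong') (use assms in \<open>auto simp: diag_lift_def\<close>)
  then show ?thesis using assms by (simp add: Zc.finprod_const)
qed

text \<open>On the diagonal copy of the centre the norm is the power map \<open>z \<mapsto> z\<^sup>n\<close> with \<open>n = |Out G|\<close>, a bijection
  by coprimality. Hence the kernel of the norm is a complement of that copy among the central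
  functions, and dividing by it leaves exactly the centre as the kernel of the map to \<open>Aut G\<close>.\<close>

theorem outer_lift_exists:
  assumes fin: "finite (centre G)" "finite (carrier (Out G))"
    and coprime: "coprime (card (centre G)) (card (carrier (Out G)))"
  obtains U :: "(('a \<Rightarrow> 'a) \<times> (('a \<Rightarrow> 'a) set \<Rightarrow> 'a)) set monoid" and \<psi> \<gamma>
  where "outer_lift G U \<psi> \<gamma>"
proof -
  let ?W = "induced_lift G" and ?N = "norm_kernel G" and ?Z = "G\<lparr>carrier := centre G\<rparr>"
  let ?n = "card (carrier (Out G))"
  interpret N: normal ?N ?W by (rule norm_kernel_normal)
  interpret U: group "?W Mod ?N" by (rule N.factorgroup_is_group)
  interpret p: group_hom ?W "Aut G" fst
    by (simp add: group_induced_lift group_Aut[OF G] fst_hom group_hom_def group_hom_axioms_def)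
  interpret d: group_hom G ?W "diag_lift G"
    by (simp add: G group_induced_lift diag_lift_hom group_hom_def group_hom_axioms_def)
  have N_fst: "fst x = \<one>\<^bsub>Aut G\<^esub>" if "x \<in> ?N" for x
    using that by (auto simp: norm_kernel_def)
  have "?N \<subseteq> kernel ?W (Aut G) fst"
    using N_fst N.subset by (auto simp: kernel_def)
  then obtain \<psi> where \<psi>: "\<psi> \<in> hom (?W Mod ?N) (Aut G)"
      "\<And>x. x \<in> carrier ?W \<Longrightarrow> \<psi> (?N #>\<^bsub>?W\<^esub> x) = fst x"
    using p.FactGroup_universal_kernel[OF norm_kernel_normal] by blast
  define \<gamma> where "\<gamma> x = ?N #>\<^bsub>?W\<^esub> diag_lift G x" for x
  have \<gamma>: "\<gamma> \<in> hom G (?W Mod ?N)"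
    using Group.hom_compose[OF diag_lift_hom N.r_coset_hom_Mod] by (simp add: \<gamma>_def[abs_def] comp_def)
  have n: "?n \<noteq> 0"
    using fin by (auto simp: carrier_Out[OF G])
  obtain m :: nat where m: "\<And>z. z \<in> centre G \<Longrightarrow> (z [^]\<^bsub>?Z\<^esub> ?n) [^]\<^bsub>?Z\<^esub> m = z"
    using Zc.coprime_pow[of ?n] fin(1) coprime n by (auto simp: order_def coprime_commute)
  have "inj_on \<gamma> (carrier G)"
  proof -
    \<comment> \<open>Lying over the identity makes x central, trivial norm gives x^n = 1, and
      raising to the power m recovers x.\<close>
    have "x = \<one>" if x: "x \<in> carrier G" and "\<gamma> x = \<one>\<^bsub>?W Mod ?N\<^esub>" for x
    proof -
      have k: "diag_lift G x \<in> ?N"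
        using that W.coset_join1[OF _ _ N.subgroup_axioms] by (simp add: \<gamma>_def)
      then have "x \<in> centre G"
        using N_fst[OF k] conj_aut_eq_one_iff[OF G x] by (simp add: diag_lift_def)
      moreover from this have "x [^]\<^bsub>?Z\<^esub> ?n = \<one>"
        using k centre_norm_diag[of x, symmetric] by (auto simp: norm_kernel_def)
      ultimately show ?thesis using m[of x] Zc.nat_pow_one by simp
    qed
    moreover have "group_hom G (?W Mod ?N) \<gamma>"
      by (simp add: G U.is_group \<gamma> group_hom_def group_hom_axioms_def)
    ultimately show ?thesis
      by (simp add: group_hom.inj_on_one_iff)
  qed
  moreover have "\<psi> ` carrier (?W Mod ?N) = carrier (Aut G)"
  proof
    show "\<psi> ` carrier (?W Mod ?N) \<subseteq> carrier (Aut G)"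
      using hom_in_carrier[OF \<psi>(1)] by blast
    show "carrier (Aut G) \<subseteq> \<psi> ` carrier (?W Mod ?N)"
    proof
      fix \<alpha> assume \<alpha>: "\<alpha> \<in> carrier (Aut G)"
      \<comment> \<open>t_q \<alpha> and t_(q\<alpha>) represent the same coset of
        \<open>Inn G\<close>. Elements inducing their differences form the second component of a
        lift of \<alpha>.\<close>
      have "\<exists>g \<in> carrier G. Out_rep q \<otimes>\<^bsub>Aut G\<^esub> \<alpha> = conj_aut G g \<otimes>\<^bsub>Aut G\<^esub> Out_rep (q #>\<^bsub>Aut G\<^esub> \<alpha>)"
        if q: "q \<in> carrier (Out G)" for q
        using q \<alpha> outer_class_eq_iff[OF G, of "Out_rep (q #>\<^bsub>Aut G\<^esub> \<alpha>)" "Out_rep q \<otimes>\<^bsub>Aut G\<^esub> \<alpha>"]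
        by (simp add: Out_act[symmetric])
      then obtain g where g: "\<And>q. q \<in> carrier (Out G) \<Longrightarrow> g q \<in> carrier G \<and>
          Out_rep q \<otimes>\<^bsub>Aut G\<^esub> \<alpha> = conj_aut G (g q) \<otimes>\<^bsub>Aut G\<^esub> Out_rep (q #>\<^bsub>Aut G\<^esub> \<alpha>)"
        by metis
      then have "(\<alpha>, restrict g (carrier (Out G))) \<in> carrier ?W"
        using \<alpha> by (simp add: induced_lift_def)
      then show "\<alpha> \<in> \<psi> ` carrier (?W Mod ?N)"
        using \<psi>(2) by (force simp: carrier_FactGroup)
    qed
  qed
  moreover have "\<gamma> g \<otimes>\<^bsub>?W Mod ?N\<^esub> u = u \<otimes>\<^bsub>?W Mod ?N\<^esub> \<gamma> (\<psi> u g)"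
    if u: "u \<in> carrier (?W Mod ?N)" and g: "g \<in> carrier G" for u g
  proof -
    obtain w where w: "w \<in> carrier ?W" "u = ?N #>\<^bsub>?W\<^esub> w"
      using u by (auto simp: carrier_FactGroup)
    have "fst w g \<in> carrier G"
      using hom_in_carrier[OF fst_hom w(1)] g by simp
    then show ?thesis
      using w g diag_lift_conj[OF w(1) g] by (simp add: \<gamma>_def \<psi>(2) N.rcos_sum)
  qed
  moreover have "\<exists>z \<in> centre G. u = \<gamma> z"
    if u: "u \<in> carrier (?W Mod ?N)" and u1: "\<psi> u = \<one>\<^bsub>Aut G\<^esub>" for u
  proof -
    obtain w where w: "w \<in> carrier ?W" "u = ?N #>\<^bsub>?W\<^esub> w"
      using u by (auto simp: carrier_FactGroup)
    then obtain f where f: "w = (\<one>\<^bsub>Aut G\<^esub>, f)"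
      using \<psi>(2)[OF w(1)] u1 by (cases w) auto
    have fZ: "f \<in> carrier (Out G) \<rightarrow>\<^sub>E centre G"
      using induced_lift_central w f by blast
    define z where "z = centre_norm G f [^]\<^bsub>?Z\<^esub> m"
    have z: "z \<in> centre G"
      using Zc.nat_pow_closed[of "centre_norm G f" m] fZ by (simp add: z_def)
    have zi: "inv z \<in> centre G"
      using z subgroup.m_inv_closed[OF subgroup_centre[OF G]] by blast
    have "z [^]\<^bsub>?Z\<^esub> ?n = centre_norm G f"
      using m[of "centre_norm G f"] fZ Zc.nat_pow_pow[of "centre_norm G f"]
      by (simp add: z_def mult.commute)
    moreover have "(inv z) [^]\<^bsub>?Z\<^esub> ?n = inv (z [^]\<^bsub>?Z\<^esub> ?n)"
      using z Zc.nat_pow_inv[of z ?n] Zc.nat_pow_closed[of z ?n]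
      by (simp add: m_inv_consistent[OF subgroup_centre[OF G]])
    ultimately have "centre_norm G (snd (diag_lift G (inv z))) = inv (centre_norm G f)"
      using centre_norm_diag[OF zi] by simp
    moreover have dz: "diag_lift G (inv z) = (\<one>\<^bsub>Aut G\<^esub>, snd (diag_lift G (inv z)))"
      using zi conj_aut_eq_one_iff[OF G, of "inv z"] by (simp add: diag_lift_def)
    have dzZ: "snd (diag_lift G (inv z)) \<in> carrier (Out G) \<rightarrow>\<^sub>E centre G"
      using zi by (auto simp: diag_lift_def)
    have "diag_lift G (inv z) \<otimes>\<^bsub>?W\<^esub> w =
        (\<one>\<^bsub>Aut G\<^esub>, \<lambda>q \<in> carrier (Out G). snd (diag_lift G (inv z)) q \<otimes> f q)"
      by (subst dz) (auto simp: f induced_lift_def intro!: restrict_ext)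
    moreover have "(\<lambda>q \<in> carrier (Out G). snd (diag_lift G (inv z)) q \<otimes> f q) \<in> carrier (Out G) \<rightarrow>\<^sub>E centre G"
      using PiE_mem[OF dzZ] PiE_mem[OF fZ] subgroup.m_closed[OF subgroup_centre[OF G]] by auto
    ultimately have "diag_lift G (inv z) \<otimes>\<^bsub>?W\<^esub> w \<in> ?N"
      using centre_norm_mult[OF dzZ fZ] fZ by (simp add: norm_kernel_def)
    moreover have "diag_lift G (inv z) = inv\<^bsub>?W\<^esub> (diag_lift G z)"
      using z by (intro d.hom_inv) simp
    ultimately have "inv\<^bsub>?W\<^esub> (diag_lift G z) \<otimes>\<^bsub>?W\<^esub> w \<in> ?N" by simp
    \<comment> \<open>Conjugation moves the inverse from the left of w to its right, the form in
      which equality of right cosets is tested.\<close>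
    then have "diag_lift G z \<otimes>\<^bsub>?W\<^esub> (inv\<^bsub>?W\<^esub> (diag_lift G z) \<otimes>\<^bsub>?W\<^esub> w) \<otimes>\<^bsub>?W\<^esub> inv\<^bsub>?W\<^esub> (diag_lift G z) \<in> ?N"
      using N.inv_op_closed2[OF d.hom_closed] z by simp
    then have "w \<otimes>\<^bsub>?W\<^esub> inv\<^bsub>?W\<^esub> (diag_lift G z) \<in> ?N"
      using z w by (simp add: W.mult_inv_cancel d.hom_closed)
    then have "u = \<gamma> z"
      using W.repr_independence[OF _ _ N.subgroup_axioms] N.rcos_module z w W.group_axioms d.hom_closed
      unfolding \<gamma>_def by (metis centre_closed[OF G])
    then show ?thesis using z by blast
  qed
  ultimately have "outer_lift G (?W Mod ?N) \<psi> \<gamma>"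
    unfolding outer_lift_def using G U.is_group \<psi>(1) \<gamma> by blast
  then show thesis by (rule that)
qed

end

section \<open>Linked extensions\<close>

text \<open>Infinity of \<open>'u\<close> enters through C x C being equipollent to C; it gives the
  fibre products below room in \<open>'u\<close>.\<close>

lemma times_lepoll_infinite:
  fixes A :: "'a set" and B :: "'b set" and C :: "'c set"
  assumes "infinite C" "A \<lesssim> C" "B \<lesssim> C"
  shows "A \<times> B \<lesssim> C"
proof -
  have "C \<times> C \<approx> C"
    using card_of_Times_same_infinite[OF assms(1)] by (simp add: eqpoll_iff_card_of_ordIso)
  then show ?thesis
    using times_lepoll_mono[OF assms(2,3)] by (meson eqpoll_imp_lepoll lepoll_trans)
qed

section \<open>Fibres of U over \<open>Aut G\<close> and over \<open>Out G\<close>\<close>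

context outer_lift
begin

interpretation G: group G by (rule group_G)
interpretation U: group U by (rule group_U)
interpretation Aut: group "Aut G" by (rule group_Aut[OF group_G])
interpretation \<psi>: group_hom U "Aut G" \<psi>
  by (simp add: group_U group_Aut[OF group_G] \<psi>_hom group_hom_def group_hom_axioms_def)
interpretation \<gamma>: group_hom G U \<gamma>
  by (simp add: group_G group_U \<gamma>_hom group_hom_def group_hom_axioms_def)

lemmas [simp] =
  Aut_closed[OF group_G] mult_Aut_apply[OF group_G] one_Aut_apply[OF group_G]
  Aut_inv_apply[OF group_G] conj_aut_closed[OF group_G] Aut_centre[OF group_G]
  centre_closed[OF group_G]

lemma \<gamma>_eq_iff: "g \<in> carrier G \<Longrightarrow> h \<in> carrier G \<Longrightarrow> \<gamma> g = \<gamma> h \<longleftrightarrow> g = h"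
  using \<gamma>_inj by (auto dest: inj_onD)

text \<open>\<open>\<gamma>_commute\<close> at an element of the image of \<gamma> is an identity
  within that image, and \<gamma> can be cancelled by injectivity.\<close>

lemma \<psi>_\<gamma>:
  assumes "g \<in> carrier G" shows "\<psi> (\<gamma> g) = conj_aut G g"
proof (rule Aut_eqI[OF group_G])
  fix x assume x: "x \<in> carrier G"
  have "\<gamma> (x \<otimes>\<^bsub>G\<^esub> g) = \<gamma> (g \<otimes>\<^bsub>G\<^esub> \<psi> (\<gamma> g) x)"
    using \<gamma>_commute[of "\<gamma> g" x] assms x by simp
  then have "x \<otimes>\<^bsub>G\<^esub> g = g \<otimes>\<^bsub>G\<^esub> \<psi> (\<gamma> g) x"
    using \<gamma>_eq_iff[of "x \<otimes>\<^bsub>G\<^esub> g" "g \<otimes>\<^bsub>G\<^esub> \<psi> (\<gamma> g) x"] assms x by simp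
  then show "\<psi> (\<gamma> g) x = conj_aut G g x"
    using assms x by (simp add: conj_aut_apply[OF group_G] G.m_assoc G.mult_inv_cancel)
qed (use assms in auto)

text \<open>The fibres of U over \<open>Aut G\<close> are cosets of the central copy, by
  \<open>\<psi>_kernel\<close> applied to a quotient of two elements.\<close>

lemma same_\<psi>:
  assumes u: "u \<in> carrier U" "v \<in> carrier U" and "\<psi> u = \<psi> v"
  obtains z where "z \<in> centre G" "u = v \<otimes>\<^bsub>U\<^esub> \<gamma> z"
proof -
  have "\<psi> (inv\<^bsub>U\<^esub> v \<otimes>\<^bsub>U\<^esub> u) = \<one>\<^bsub>Aut G\<^esub>"
    using assms by simp
  then obtain z where "z \<in> centre G" "inv\<^bsub>U\<^esub> v \<otimes>\<^bsub>U\<^esub> u = \<gamma> z"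
    using \<psi>_kernel[of "inv\<^bsub>U\<^esub> v \<otimes>\<^bsub>U\<^esub> u"] u by auto
  moreover from this(2) have "u = v \<otimes>\<^bsub>U\<^esub> \<gamma> z"
    using u U.mult_inv_cancel(1)[of v u] by simp
  ultimately show thesis using that by blast
qed

text \<open>The fibres of U over \<open>Out G\<close> are cosets of the copy of G: the inner
  difference is realised by \<gamma> t, a central factor remains by \<open>same_\<psi>\<close>, and
  \<gamma> t is then moved past v.\<close>

lemma same_outer_class:
  assumes u: "u \<in> carrier U" "v \<in> carrier U" and "outer_class G (\<psi> u) = outer_class G (\<psi> v)"
  obtains g where "g \<in> carrier G" "u = v \<otimes>\<^bsub>U\<^esub> \<gamma> g"
proof -
  obtain t where t: "t \<in> carrier G" "\<psi> u = conj_aut G t \<otimes>\<^bsub>Aut G\<^esub> \<psi> v"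
    using assms outer_class_eq_iff[OF group_G, of "\<psi> v" "\<psi> u"] by auto
  then have "\<psi> u = \<psi> (\<gamma> t \<otimes>\<^bsub>U\<^esub> v)"
    using u by (simp add: \<psi>_\<gamma>)
  then obtain z where z: "z \<in> centre G" "u = \<gamma> t \<otimes>\<^bsub>U\<^esub> v \<otimes>\<^bsub>U\<^esub> \<gamma> z"
    using same_\<psi>[OF u(1), of "\<gamma> t \<otimes>\<^bsub>U\<^esub> v"] u t by auto
  moreover have "\<gamma> t \<otimes>\<^bsub>U\<^esub> v \<otimes>\<^bsub>U\<^esub> \<gamma> z = v \<otimes>\<^bsub>U\<^esub> \<gamma> (\<psi> v t \<otimes>\<^bsub>G\<^esub> z)"
    using \<gamma>_commute[OF u(2) t(1)] u t z by (simp add: U.m_assoc)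
  ultimately show thesis using that[of "\<psi> v t \<otimes>\<^bsub>G\<^esub> z"] t u by simp
qed

lemma outer_class_\<psi>_\<gamma>:
  assumes "u \<in> carrier U" "g \<in> carrier G"
  shows "outer_class G (\<psi> (u \<otimes>\<^bsub>U\<^esub> \<gamma> g)) = outer_class G (\<psi> u)"
proof -
  define h where "h = (inv\<^bsub>Aut G\<^esub> (\<psi> u)) g"
  have "h \<in> carrier G" using assms by (simp add: h_def)
  moreover have "\<psi> (u \<otimes>\<^bsub>U\<^esub> \<gamma> g) = conj_aut G h \<otimes>\<^bsub>Aut G\<^esub> \<psi> u"
    using assms conj_aut_Aut[OF group_G, of "\<psi> u" h] by (simp add: h_def \<psi>_\<gamma>)
  ultimately show ?thesis
    using assms by (subst outer_class_eq_iff[OF group_G]) auto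
qed

end

text \<open>The set \<open>K\<close> identifies the fibre product of \<open>S\<close> and \<open>U\<close> over \<open>Out G\<close> with the fibre product of \<open>E\<close> and
  \<open>U\<close> over \<open>Aut G\<close>: a triple \<open>(s, u, e)\<close> in \<open>K\<close> is determined by \<open>(s, u)\<close> and also by \<open>(e, u)\<close>.\<close>

locale linking = outer_lift G U \<psi> \<gamma>
  for G :: "('a, 'b) monoid_scheme" and U :: "'w monoid" and \<psi> \<gamma> +
  fixes S :: "'u monoid" and \<kappa> \<phi> and E :: "'u monoid" and \<iota> and K :: "('u \<times> 'w \<times> 'u) set"
  assumes S_ext: "(S, \<kappa>, \<phi>) \<in> Zphi_extensions G" and E_ext: "(E, \<iota>) \<in> extensions G"
    and K_subset: "K \<subseteq> carrier S \<times> carrier U \<times> carrier E"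
    and K_mult: "\<And>s u e s' u' e'. (s, u, e) \<in> K \<Longrightarrow> (s', u', e') \<in> K \<Longrightarrow>
      (s \<otimes>\<^bsub>S\<^esub> s', u \<otimes>\<^bsub>U\<^esub> u', e \<otimes>\<^bsub>E\<^esub> e') \<in> K"
    and K_inv: "\<And>s u e. (s, u, e) \<in> K \<Longrightarrow> (inv\<^bsub>S\<^esub> s, inv\<^bsub>U\<^esub> u, inv\<^bsub>E\<^esub> e) \<in> K"
    and K_onto_S: "\<And>s. s \<in> carrier S \<Longrightarrow> \<exists>u e. (s, u, e) \<in> K"
    and K_onto_E: "\<And>e. e \<in> carrier E \<Longrightarrow> \<exists>s u. (s, u, e) \<in> K"
    and K_S: "\<And>s. (s, \<one>\<^bsub>U\<^esub>, \<one>\<^bsub>E\<^esub>) \<in> K \<Longrightarrow> s = \<one>\<^bsub>S\<^esub>"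
    and K_E: "\<And>e. (\<one>\<^bsub>S\<^esub>, \<one>\<^bsub>U\<^esub>, e) \<in> K \<Longrightarrow> e = \<one>\<^bsub>E\<^esub>"
    and K_\<kappa>: "\<And>z. z \<in> centre G \<Longrightarrow> (\<kappa> z, \<one>\<^bsub>U\<^esub>, \<iota> z) \<in> K"
    and K_\<gamma>: "\<And>g. g \<in> carrier G \<Longrightarrow> (\<one>\<^bsub>S\<^esub>, \<gamma> g, \<iota> g) \<in> K"
    and K_\<phi>: "\<And>s u e. (s, u, e) \<in> K \<Longrightarrow> \<phi> s = outer_class G (\<psi> u)"
    and K_commute: "\<And>s u e g. (s, u, e) \<in> K \<Longrightarrow> g \<in> carrier G \<Longrightarrow>
      \<iota> g \<otimes>\<^bsub>E\<^esub> e = e \<otimes>\<^bsub>E\<^esub> \<iota> (\<psi> u g)"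
begin

sublocale G: group G by (rule group_G)
sublocale U: group U by (rule group_U)
sublocale Aut: group "Aut G" by (rule group_Aut[OF group_G])
sublocale \<psi>: group_hom U "Aut G" \<psi>
  by (simp add: group_U group_Aut[OF group_G] \<psi>_hom group_hom_def group_hom_axioms_def)
sublocale \<gamma>: group_hom G U \<gamma>
  by (simp add: group_G group_U \<gamma>_hom group_hom_def group_hom_axioms_def)
sublocale S: group S
  using S_ext by (simp add: Zphi_extensions_def)
sublocale E: group E
  using E_ext by (simp add: extensions_def)
sublocale \<iota>: group_hom G E \<iota>
  using E_ext by (simp add: extensions_def group_hom_def group_hom_axioms_def)

lemma \<iota>_eq_iff: "g \<in> carrier G \<Longrightarrow> h \<in> carrier G \<Longrightarrow> \<iota> g = \<iota> h \<longleftrightarrow> g = h"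
  using E_ext by (auto simp: extensions_def dest: inj_onD)

lemma \<kappa>_closed [simp]: "z \<in> centre G \<Longrightarrow> \<kappa> z \<in> carrier S"
  using S_ext hom_in_carrier by (fastforce simp: Zphi_extensions_def)

lemma K_closed:
  assumes "(s, u, e) \<in> K" shows "s \<in> carrier S" "u \<in> carrier U" "e \<in> carrier E"
  using assms K_subset by auto

text \<open>The quotient of the two triples has trivial first and second components, which is the
  case covered by \<open>K_E\<close>.\<close>

lemma K_unique_E:
  assumes "(s, u, e) \<in> K" "(s, u, e') \<in> K" shows "e = e'"
proof -
  have "(s \<otimes>\<^bsub>S\<^esub> inv\<^bsub>S\<^esub> s, u \<otimes>\<^bsub>U\<^esub> inv\<^bsub>U\<^esub> u, e \<otimes>\<^bsub>E\<^esub> inv\<^bsub>E\<^esub> e') \<in> K"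
    using assms by (intro K_mult K_inv)
  then have "e \<otimes>\<^bsub>E\<^esub> inv\<^bsub>E\<^esub> e' = \<one>\<^bsub>E\<^esub>"
    using K_closed[OF assms(1)] K_E by simp
  then show ?thesis
    using K_closed(3)[OF assms(1)] K_closed(3)[OF assms(2)] by (simp add: E.inv_solve_right')
qed

lemma K_unique_S:
  assumes "(s, u, e) \<in> K" "(s', u, e) \<in> K" shows "s = s'"
proof -
  have "(s \<otimes>\<^bsub>S\<^esub> inv\<^bsub>S\<^esub> s', u \<otimes>\<^bsub>U\<^esub> inv\<^bsub>U\<^esub> u, e \<otimes>\<^bsub>E\<^esub> inv\<^bsub>E\<^esub> e) \<in> K"
    using assms by (intro K_mult K_inv)
  then have "s \<otimes>\<^bsub>S\<^esub> inv\<^bsub>S\<^esub> s' = \<one>\<^bsub>S\<^esub>"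
    using K_closed[OF assms(1)] K_S by simp
  then show ?thesis
    using K_closed(1)[OF assms(1)] K_closed(1)[OF assms(2)] by (simp add: S.inv_solve_right')
qed

text \<open>Dividing the triple of \<gamma> z by that of \<kappa> z cancels the component in E.
  These triples form the kernel of K over E, as \<open>K_kernel_E\<close> confirms.\<close>

lemma K_central:
  assumes z: "z \<in> centre G" shows "(inv\<^bsub>S\<^esub> (\<kappa> z), \<gamma> z, \<one>\<^bsub>E\<^esub>) \<in> K"
proof -
  have "(inv\<^bsub>S\<^esub> (\<kappa> z) \<otimes>\<^bsub>S\<^esub> \<one>\<^bsub>S\<^esub>, inv\<^bsub>U\<^esub> \<one>\<^bsub>U\<^esub> \<otimes>\<^bsub>U\<^esub> \<gamma> z, inv\<^bsub>E\<^esub> (\<iota> z) \<otimes>\<^bsub>E\<^esub> \<iota> z) \<in> K"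
    using z centre_closed[OF group_G] by (intro K_mult K_inv K_\<kappa> K_\<gamma>)
  then show ?thesis using z centre_closed[OF group_G z] by simp
qed

text \<open>With \<open>K_\<phi>\<close> this says that K projects onto the full fibre product of S
  and U over \<open>Out G\<close>: some triple lies over s, its second component differs from u by
  some \<gamma> g, and \<open>K_\<gamma>\<close> corrects it.\<close>

lemma K_ex_E:
  assumes "s \<in> carrier S" "u \<in> carrier U" "\<phi> s = outer_class G (\<psi> u)"
  shows "\<exists>e. (s, u, e) \<in> K"
proof -
  obtain u' e where k: "(s, u', e) \<in> K" using K_onto_S assms by blast
  note c = K_closed[OF k]
  obtain g where g: "g \<in> carrier G" "u = u' \<otimes>\<^bsub>U\<^esub> \<gamma> g"
    using same_outer_class[OF assms(2) c(2)] K_\<phi>[OF k] assms(3) by metis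
  have "(s \<otimes>\<^bsub>S\<^esub> \<one>\<^bsub>S\<^esub>, u' \<otimes>\<^bsub>U\<^esub> \<gamma> g, e \<otimes>\<^bsub>E\<^esub> \<iota> g) \<in> K"
    using k g by (intro K_mult K_\<gamma>)
  then show ?thesis using g c by auto
qed

text \<open>The action of e on the embedded copy of G determines \<psi> u, since e and \<iota> can
  both be cancelled.\<close>

lemma K_same_\<psi>:
  assumes "(s, u, e) \<in> K" and \<alpha>: "\<alpha> \<in> carrier (Aut G)"
    and "\<And>g. g \<in> carrier G \<Longrightarrow> \<iota> g \<otimes>\<^bsub>E\<^esub> e = e \<otimes>\<^bsub>E\<^esub> \<iota> (\<alpha> g)"
  shows "\<psi> u = \<alpha>"
proof (rule Aut_eqI[OF group_G])
  fix g assume g: "g \<in> carrier G"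
  have c: "e \<in> carrier E" "\<psi> u g \<in> carrier G" "\<alpha> g \<in> carrier G"
    using K_closed[OF assms(1)] g \<alpha> Aut_closed[OF group_G] by auto
  have "e \<otimes>\<^bsub>E\<^esub> \<iota> (\<psi> u g) = e \<otimes>\<^bsub>E\<^esub> \<iota> (\<alpha> g)"
    using K_commute[OF assms(1) g] assms(3)[OF g] by simp
  then show "\<psi> u g = \<alpha> g"
    using c by (simp add: \<iota>_eq_iff)
qed (use K_closed[OF assms(1)] \<alpha> in auto)

text \<open>The mirror image of \<open>K_ex_E\<close> for the fibre product of E and U over
  \<open>Aut G\<close>. Here the second components differ only by a central element, and
  \<open>K_central\<close> corrects this without changing e.\<close>

lemma K_ex_S:
  assumes "e \<in> carrier E" "u \<in> carrier U"
    and "\<And>g. g \<in> carrier G \<Longrightarrow> \<iota> g \<otimes>\<^bsub>E\<^esub> e = e \<otimes>\<^bsub>E\<^esub> \<iota> (\<psi> u g)"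
  shows "\<exists>s. (s, u, e) \<in> K"
proof -
  obtain s u' where k: "(s, u', e) \<in> K" using K_onto_E assms by blast
  note c = K_closed[OF k]
  have "\<psi> u = \<psi> u'"
    using K_same_\<psi>[OF k \<psi>.hom_closed[OF assms(2)] assms(3)] by simp
  then obtain z where z: "z \<in> centre G" "u = u' \<otimes>\<^bsub>U\<^esub> \<gamma> z"
    using same_\<psi>[OF assms(2) c(2)] by metis
  have "(s \<otimes>\<^bsub>S\<^esub> inv\<^bsub>S\<^esub> (\<kappa> z), u' \<otimes>\<^bsub>U\<^esub> \<gamma> z, e \<otimes>\<^bsub>E\<^esub> \<one>\<^bsub>E\<^esub>) \<in> K"
    using k z by (intro K_mult K_central)
  then show ?thesis using z c by auto
qed

text \<open>The kernel of K over S is the diagonal copy of G: trivial outer class puts u into the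
  image of \<gamma>, and uniqueness determines e.\<close>

lemma K_kernel_S:
  assumes k: "(\<one>\<^bsub>S\<^esub>, u, e) \<in> K"
  obtains g where "g \<in> carrier G" "u = \<gamma> g" "e = \<iota> g"
proof -
  note c = K_closed[OF k]
  have "\<phi> \<one>\<^bsub>S\<^esub> = outer_class G (\<psi> \<one>\<^bsub>U\<^esub>)"
    using K_\<phi>[OF K_\<gamma>[of "\<one>\<^bsub>G\<^esub>"]] by simp
  then obtain g where g: "g \<in> carrier G" "u = \<gamma> g"
    using same_outer_class[OF c(2) U.one_closed] K_\<phi>[OF k] by (metis U.l_one \<gamma>.hom_closed)
  moreover have "e = \<iota> g"
    using K_unique_E[OF k] K_\<gamma>[OF g(1)] g by simp
  ultimately show thesis by (rule that)
qed

text \<open>The kernel of K over E is an antidiagonal copy of the centre: an element over the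
  identity of E acts trivially on G, so \<open>\<psi>_kernel\<close> applies.\<close>

lemma K_kernel_E:
  assumes k: "(s, u, \<one>\<^bsub>E\<^esub>) \<in> K"
  obtains z where "z \<in> centre G" "u = \<gamma> z" "s = inv\<^bsub>S\<^esub> (\<kappa> z)"
proof -
  note c = K_closed[OF k]
  have "\<psi> u = \<one>\<^bsub>Aut G\<^esub>"
    by (rule K_same_\<psi>[OF k]) (auto simp: one_Aut_apply[OF group_G])
  then obtain z where z: "z \<in> centre G" "u = \<gamma> z"
    using \<psi>_kernel[OF c(2)] by blast
  moreover have "s = inv\<^bsub>S\<^esub> (\<kappa> z)"
    using K_unique_S[OF k] K_central[OF z(1)] z by simp
  ultimately show thesis by (rule that)
qed

end

section \<open>Transport of equivalences between linked pairs\<close>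

lemma (in outer_lift) conj_lift:
  assumes \<pi>: "\<pi> \<in> carrier (Aut G)"
  obtains c where "c \<in> hom U U" "bij_betw c (carrier U) (carrier U)"
    "\<And>g. g \<in> carrier G \<Longrightarrow> c (\<gamma> g) = \<gamma> (\<pi> g)"
    "\<And>u g. u \<in> carrier U \<Longrightarrow> g \<in> carrier G \<Longrightarrow> \<psi> (c u) (\<pi> g) = \<pi> (\<psi> u g)"
    "\<And>u. u \<in> carrier U \<Longrightarrow> outer_class G (\<psi> (c u)) =
      inv\<^bsub>Out G\<^esub> (outer_class G \<pi>) \<otimes>\<^bsub>Out G\<^esub> outer_class G (\<psi> u) \<otimes>\<^bsub>Out G\<^esub> outer_class G \<pi>"
proof -
  interpret U: group U by (rule group_U)
  interpret Aut: group "Aut G" by (rule group_Aut[OF group_G])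
  interpret \<psi>: group_hom U "Aut G" \<psi>
    by (simp add: group_U group_Aut[OF group_G] \<psi>_hom group_hom_def group_hom_axioms_def)
  interpret o: group_hom "Aut G" "Out G" "outer_class G"
    by (simp add: group_Aut group_Out outer_class_hom group_G group_hom_def group_hom_axioms_def)
  \<comment> \<open>Surjectivity of \<psi> onto all of \<open>Aut G\<close> is decisive: any \<pi>
    can occur in an equivalence, whatever the coupling. Conjugation by x multiplies \<psi> u by
    \<pi>^-1 and \<pi> exactly as the equivalence twists \<phi>.\<close>
  obtain x where x: "x \<in> carrier U" "\<psi> x = \<pi>"
    using \<pi> \<psi>_onto by (metis imageE)
  define c where "c u = inv\<^bsub>U\<^esub> x \<otimes>\<^bsub>U\<^esub> u \<otimes>\<^bsub>U\<^esub> x" for u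
  have \<psi>c: "\<psi> (c u) = inv\<^bsub>Aut G\<^esub> \<pi> \<otimes>\<^bsub>Aut G\<^esub> \<psi> u \<otimes>\<^bsub>Aut G\<^esub> \<pi>" if "u \<in> carrier U" for u
    using x that by (simp add: c_def)
  show thesis
  proof (rule that[of c])
    show "c \<in> hom U U"
      using x by (intro homI) (simp_all add: c_def U.m_assoc U.mult_inv_cancel)
    show "bij_betw c (carrier U) (carrier U)"
      using x by (intro bij_betwI[where g = "\<lambda>u. x \<otimes>\<^bsub>U\<^esub> u \<otimes>\<^bsub>U\<^esub> inv\<^bsub>U\<^esub> x"])
        (simp_all add: c_def U.m_assoc U.mult_inv_cancel)
    show "c (\<gamma> g) = \<gamma> (\<pi> g)" if "g \<in> carrier G" for g
      using \<gamma>_commute[OF x(1) that] x that hom_in_carrier[OF \<gamma>_hom] Aut_closed[OF group_G \<pi>]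
      by (simp add: c_def U.m_assoc U.mult_inv_cancel)
    show "\<psi> (c u) (\<pi> g) = \<pi> (\<psi> u g)" if "u \<in> carrier U" "g \<in> carrier G" for u g
      using that \<pi> Aut_closed[OF group_G] by (simp add: \<psi>c mult_Aut_apply Aut_inv_apply group_G)
    show "outer_class G (\<psi> (c u)) =
      inv\<^bsub>Out G\<^esub> (outer_class G \<pi>) \<otimes>\<^bsub>Out G\<^esub> outer_class G (\<psi> u) \<otimes>\<^bsub>Out G\<^esub> outer_class G \<pi>"
      if "u \<in> carrier U" for u
      using that \<pi> by (simp add: \<psi>c o.hom_mult o.hom_inv)
  qed
qed

text \<open>With c the lift of \<pi> to U, the pair (j, c) maps the fibre product of S and U to that
  of S' and U', because both couplings are twisted by \<pi>. It sends the antidiagonal element of z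
  to that of \<pi> z, so it descends to the quotients E and E'.\<close>

lemma linking_equivalence_imp_isomorphism:
  assumes A: "linking G U \<psi> \<gamma> S \<kappa> \<phi> E \<iota> K" and B: "linking G U \<psi> \<gamma> S' \<kappa>' \<phi>' E' \<iota>' K'"
    and eq: "((S, \<kappa>, \<phi>), (S', \<kappa>', \<phi>')) \<in> Zphi_equivalence_rel G"
  shows "((E, \<iota>), (E', \<iota>')) \<in> G_isomorphism_rel G"
proof -
  interpret A: linking G U \<psi> \<gamma> S \<kappa> \<phi> E \<iota> K by (rule A)
  interpret B: linking G U \<psi> \<gamma> S' \<kappa>' \<phi>' E' \<iota>' K' by (rule B)
  note [simp] = centre_closed[OF A.group_G] Aut_centre[OF A.group_G] Aut_closed[OF A.group_G]
    Aut_inv_apply[OF A.group_G]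
  obtain j \<pi> where j: "j \<in> iso S S'" and \<pi>: "\<pi> \<in> carrier (Aut G)"
    and j\<kappa>: "\<And>z. z \<in> centre G \<Longrightarrow> j (\<kappa> z) = \<kappa>' (\<pi> z)"
    and j\<phi>: "\<And>s. s \<in> carrier S \<Longrightarrow> \<phi>' (j s) =
      inv\<^bsub>Out G\<^esub> (outer_class G \<pi>) \<otimes>\<^bsub>Out G\<^esub> \<phi> s \<otimes>\<^bsub>Out G\<^esub> outer_class G \<pi>"
    using eq by (auto simp: Zphi_equivalence_rel_def)
  interpret j: group_hom S S' j
    using j by (simp add: iso_def A.S.is_group B.S.is_group group_hom_def group_hom_axioms_def)
  have j_bij: "bij_betw j (carrier S) (carrier S')" using j by (simp add: iso_def)
  obtain c where c: "c \<in> hom U U" "bij_betw c (carrier U) (carrier U)"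
    and c\<gamma>: "\<And>g. g \<in> carrier G \<Longrightarrow> c (\<gamma> g) = \<gamma> (\<pi> g)"
    and c\<phi>: "\<And>u. u \<in> carrier U \<Longrightarrow> outer_class G (\<psi> (c u)) =
      inv\<^bsub>Out G\<^esub> (outer_class G \<pi>) \<otimes>\<^bsub>Out G\<^esub> outer_class G (\<psi> u) \<otimes>\<^bsub>Out G\<^esub> outer_class G \<pi>"
    using A.conj_lift[OF \<pi>] by metis
  interpret c: group_hom U U c
    using c by (simp add: A.group_U group_hom_def group_hom_axioms_def)
  have c_eq_iff: "c u = c v \<longleftrightarrow> u = v" if "u \<in> carrier U" "v \<in> carrier U" for u v
    using inj_on_eq_iff[OF bij_betw_imp_inj_on[OF c(2)]] that by blast
  \<comment> \<open>The graph of the induced map: e and e' are related if they lie under (s, u) and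
    under its image (j s, c u).\<close>
  define L where "L = {(e, e'). \<exists>s u. (s, u, e) \<in> K \<and> (j s, c u, e') \<in> K'}"
  have "L \<subseteq> carrier E \<times> carrier E'"
    using A.K_closed B.K_closed by (auto simp: L_def)
  moreover have "(e \<otimes>\<^bsub>E\<^esub> f, e' \<otimes>\<^bsub>E'\<^esub> f') \<in> L" if "(e, e') \<in> L" "(f, f') \<in> L" for e e' f f'
  proof -
    obtain s u t v where k: "(s, u, e) \<in> K" "(j s, c u, e') \<in> K'" "(t, v, f) \<in> K" "(j t, c v, f') \<in> K'"
      using \<open>(e, e') \<in> L\<close> \<open>(f, f') \<in> L\<close> by (auto simp: L_def)
    then show ?thesis
      using A.K_mult[OF k(1,3)] B.K_mult[OF k(2,4)] A.K_closed[OF k(1)] A.K_closed[OF k(3)]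
      by (auto simp: L_def j.hom_mult[symmetric] c.hom_mult[symmetric] simp del: j.hom_mult c.hom_mult)
  qed
  moreover have "(inv\<^bsub>E\<^esub> e, inv\<^bsub>E'\<^esub> e') \<in> L" if "(e, e') \<in> L" for e e'
  proof -
    obtain s u where k: "(s, u, e) \<in> K" "(j s, c u, e') \<in> K'"
      using \<open>(e, e') \<in> L\<close> by (auto simp: L_def)
    then show ?thesis
      using A.K_inv[OF k(1)] B.K_inv[OF k(2)] A.K_closed[OF k(1)]
      by (auto simp: L_def j.hom_inv[symmetric] c.hom_inv[symmetric] simp del: j.hom_inv c.hom_inv)
  qed
  moreover have "\<exists>e'. (e, e') \<in> L" if "e \<in> carrier E" for e
  proof -
    obtain s u where k: "(s, u, e) \<in> K" using A.K_onto_E \<open>e \<in> carrier E\<close> by blast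
    note A.K_closed[OF k]
    then have "\<exists>e'. (j s, c u, e') \<in> K'"
      by (intro B.K_ex_E) (simp_all add: j\<phi> c\<phi> A.K_\<phi>[OF k])
    then show ?thesis using k by (auto simp: L_def)
  qed
  moreover have "\<exists>e. (e, e') \<in> L" if "e' \<in> carrier E'" for e'
  proof -
    obtain s' u' where k: "(s', u', e') \<in> K'" using B.K_onto_E \<open>e' \<in> carrier E'\<close> by blast
    note k' = B.K_closed[OF k]
    obtain s u where su: "s \<in> carrier S" "j s = s'" "u \<in> carrier U" "c u = u'"
      using j_bij c(2) k' unfolding bij_betw_def by (metis imageE)
    \<comment> \<open>Instead of untwisting the coupling of s', u is compared with a known partner
      u0 of s after applying c. The difference \<gamma> g is the image under c of \<gamma> h with h
      = \<pi>^-1 g.\<close>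
    obtain u0 e0 where k0: "(s, u0, e0) \<in> K" using A.K_onto_S[OF su(1)] by blast
    have oc: "outer_class G (\<psi> (c u)) = outer_class G (\<psi> (c u0))"
      using B.K_\<phi>[OF k] su j\<phi>[OF su(1)] A.K_\<phi>[OF k0] c\<phi> A.K_closed[OF k0] by simp
    obtain g where g: "g \<in> carrier G" "c u = c u0 \<otimes>\<^bsub>U\<^esub> \<gamma> g"
      using A.same_outer_class[OF c.hom_closed[OF su(3)] c.hom_closed[OF A.K_closed(2)[OF k0]] oc]
      by blast
    define h where "h = (inv\<^bsub>Aut G\<^esub> \<pi>) g"
    have h: "h \<in> carrier G" "\<pi> h = g" using g \<pi> by (simp_all add: h_def)
    have "c u = c (u0 \<otimes>\<^bsub>U\<^esub> \<gamma> h)"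
      using g h A.K_closed[OF k0] by (simp add: c\<gamma>)
    then have "u = u0 \<otimes>\<^bsub>U\<^esub> \<gamma> h"
      using c_eq_iff[OF su(3) A.U.m_closed[OF A.K_closed(2)[OF k0] A.\<gamma>.hom_closed[OF h(1)]]] by blast
    then have "(s \<otimes>\<^bsub>S\<^esub> \<one>\<^bsub>S\<^esub>, u, e0 \<otimes>\<^bsub>E\<^esub> \<iota> h) \<in> K"
      using A.K_mult[OF k0 A.K_\<gamma>[OF h(1)]] by simp
    then show ?thesis using k su by (auto simp: L_def)
  qed
  moreover have "e = \<one>\<^bsub>E\<^esub>" if "(e, \<one>\<^bsub>E'\<^esub>) \<in> L" for e
  proof -
    obtain s u where k: "(s, u, e) \<in> K" "(j s, c u, \<one>\<^bsub>E'\<^esub>) \<in> K'"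
      using \<open>(e, \<one>\<^bsub>E'\<^esub>) \<in> L\<close> by (auto simp: L_def)
    note k' = A.K_closed[OF k(1)]
    obtain y where y: "y \<in> centre G" "c u = \<gamma> y" "j s = inv\<^bsub>S'\<^esub> (\<kappa>' y)"
      using B.K_kernel_E[OF k(2)] by blast
    \<comment> \<open>The antidiagonal element of y in K' comes from that of z in K, since c and j
      act on the copies of the centre through \<pi>.\<close>
    define z where "z = (inv\<^bsub>Aut G\<^esub> \<pi>) y"
    have z: "z \<in> centre G" "\<pi> z = y" using y \<pi> by (simp_all add: z_def)
    have "c u = c (\<gamma> z)" using y z by (simp add: c\<gamma>)
    then have u: "u = \<gamma> z"
      using c_eq_iff k' z by simp
    have "j s = j (inv\<^bsub>S\<^esub> (\<kappa> z))" using y z by (simp add: j\<kappa>)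
    then have "s = inv\<^bsub>S\<^esub> (\<kappa> z)"
      using inj_onD[OF bij_betw_imp_inj_on[OF j_bij]] k' z by simp
    then show ?thesis
      using A.K_unique_E k(1) A.K_central[OF z(1)] u by blast
  qed
  moreover have "e' = \<one>\<^bsub>E'\<^esub>" if "(\<one>\<^bsub>E\<^esub>, e') \<in> L" for e'
  proof -
    obtain s u where k: "(s, u, \<one>\<^bsub>E\<^esub>) \<in> K" "(j s, c u, e') \<in> K'"
      using \<open>(\<one>\<^bsub>E\<^esub>, e') \<in> L\<close> by (auto simp: L_def)
    obtain z where z: "z \<in> centre G" "u = \<gamma> z" "s = inv\<^bsub>S\<^esub> (\<kappa> z)"
      using A.K_kernel_E[OF k(1)] by blast
    then show ?thesis
      using k(2) B.K_unique_E[OF _ B.K_central[of "\<pi> z"]] \<pi> by (simp add: c\<gamma> j\<kappa>)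
  qed
  ultimately have "\<exists>h \<in> iso E E'. \<forall>e e'. (e, e') \<in> L \<longrightarrow> h e = e'"
    by (rule iso_of_subgroup_relation[OF A.E.is_group B.E.is_group])
  then obtain h where h: "h \<in> iso E E'" "\<And>e e'. (e, e') \<in> L \<Longrightarrow> h e = e'"
    by blast
  \<comment> \<open>As c extends \<pi> along \<gamma>, the isomorphism restricts to \<pi> on G; its
    image of G is then the embedded G again.\<close>
  have "(\<iota> g, \<iota>' (\<pi> g)) \<in> L" if "g \<in> carrier G" for g
    using A.K_\<gamma>[OF that] B.K_\<gamma>[of "\<pi> g"] that \<pi> c\<gamma>[OF that] unfolding L_def
    by (metis (mono_tags, lifting) Aut_closed[OF A.group_G] case_prodI j.hom_one mem_Collect_eq)
  then have h\<iota>: "h (\<iota> g) = \<iota>' (\<pi> g)" if "g \<in> carrier G" for g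
    using h(2) that by blast
  have "h ` \<iota> ` carrier G = \<iota>' ` \<pi> ` carrier G"
    using h\<iota> by (force simp: image_image)
  also have "\<pi> ` carrier G = carrier G"
    using \<pi> by (simp add: carrier_Aut auto_def Bij_def bij_betw_def)
  finally show ?thesis
    using h(1) A.E_ext B.E_ext by (auto simp: G_isomorphism_rel_def)
qed

text \<open>An isomorphism h of extensions restricts to an automorphism \<pi> of G. With its lift c,
  the pair (h, c) respects the fibre products over \<open>Aut G\<close> and sends the diagonal
  element of g to that of \<pi> g, so it descends to S and S'.\<close>

lemma linking_isomorphism_imp_equivalence:
  assumes A: "linking G U \<psi> \<gamma> S \<kappa> \<phi> E \<iota> K" and B: "linking G U \<psi> \<gamma> S' \<kappa>' \<phi>' E' \<iota>' K'"
    and eq: "((E, \<iota>), (E', \<iota>')) \<in> G_isomorphism_rel G"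
  shows "((S, \<kappa>, \<phi>), (S', \<kappa>', \<phi>')) \<in> Zphi_equivalence_rel G"
proof -
  interpret A: linking G U \<psi> \<gamma> S \<kappa> \<phi> E \<iota> K by (rule A)
  interpret B: linking G U \<psi> \<gamma> S' \<kappa>' \<phi>' E' \<iota>' K' by (rule B)
  note [simp] = centre_closed[OF A.group_G] Aut_centre[OF A.group_G] Aut_closed[OF A.group_G]
    Aut_inv_apply[OF A.group_G]
  obtain h where h: "h \<in> iso E E'" and h\<iota>: "h ` (\<iota> ` carrier G) = \<iota>' ` carrier G"
    using eq by (auto simp: G_isomorphism_rel_def)
  interpret h: group_hom E E' h
    using h by (simp add: iso_def A.E.is_group B.E.is_group group_hom_def group_hom_axioms_def)
  have h_bij: "bij_betw h (carrier E) (carrier E')" using h by (simp add: iso_def)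
  have h_eq_iff: "h e = h f \<longleftrightarrow> e = f" if "e \<in> carrier E" "f \<in> carrier E" for e f
    using inj_on_eq_iff[OF bij_betw_imp_inj_on[OF h_bij]] that by blast
  have "inj_on \<iota>' (carrier G)"
    by (rule inj_onI) (simp add: B.\<iota>_eq_iff)
  moreover have "h \<circ> \<iota> \<in> hom G E'"
    by (rule Group.hom_compose[OF A.\<iota>.homh h.homh])
  moreover have "inj_on (h \<circ> \<iota>) (carrier G)"
    by (rule inj_onI) (simp add: h_eq_iff A.\<iota>_eq_iff)
  moreover have "(h \<circ> \<iota>) ` carrier G = \<iota>' ` carrier G"
    unfolding h\<iota>[symmetric] by (rule image_comp[symmetric])
  ultimately have "\<exists>\<pi> \<in> carrier (Aut G). \<forall>g \<in> carrier G. \<iota>' (\<pi> g) = (h \<circ> \<iota>) g"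
    by (rule Aut_of_embeddings[OF A.group_G B.\<iota>.homh])
  then obtain \<pi> where \<pi>: "\<pi> \<in> carrier (Aut G)"
    and \<pi>h: "\<And>g. g \<in> carrier G \<Longrightarrow> \<iota>' (\<pi> g) = h (\<iota> g)"
    by auto
  obtain c where c: "c \<in> hom U U" "bij_betw c (carrier U) (carrier U)"
    and c\<gamma>: "\<And>g. g \<in> carrier G \<Longrightarrow> c (\<gamma> g) = \<gamma> (\<pi> g)"
    and c\<psi>: "\<And>u g. u \<in> carrier U \<Longrightarrow> g \<in> carrier G \<Longrightarrow> \<psi> (c u) (\<pi> g) = \<pi> (\<psi> u g)"
    and c\<phi>: "\<And>u. u \<in> carrier U \<Longrightarrow> outer_class G (\<psi> (c u)) =
      inv\<^bsub>Out G\<^esub> (outer_class G \<pi>) \<otimes>\<^bsub>Out G\<^esub> outer_class G (\<psi> u) \<otimes>\<^bsub>Out G\<^esub> outer_class G \<pi>"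
    using A.conj_lift[OF \<pi>] by metis
  interpret c: group_hom U U c
    using c by (simp add: A.group_U group_hom_def group_hom_axioms_def)
  have c_eq_iff: "c u = c v \<longleftrightarrow> u = v" if "u \<in> carrier U" "v \<in> carrier U" for u v
    using inj_on_eq_iff[OF bij_betw_imp_inj_on[OF c(2)]] that by blast
  \<comment> \<open>Membership of (e, u) in the fibre product over \<open>Aut G\<close> is preserved
    and reflected by (h, c), on replacing g by \<pi> g. One direction makes the relation below
    total, the other makes it onto.\<close>
  have commute_iff: "(\<forall>g \<in> carrier G. \<iota> g \<otimes>\<^bsub>E\<^esub> e = e \<otimes>\<^bsub>E\<^esub> \<iota> (\<psi> u g)) \<longleftrightarrow>
      (\<forall>g \<in> carrier G. \<iota>' g \<otimes>\<^bsub>E'\<^esub> h e = h e \<otimes>\<^bsub>E'\<^esub> \<iota>' (\<psi> (c u) g))"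
    if "e \<in> carrier E" "u \<in> carrier U" for e u
  proof -
    have "\<pi> ` carrier G = carrier G"
      using \<pi> by (simp add: carrier_Aut auto_def Bij_def bij_betw_def)
    then have "(\<forall>g \<in> carrier G. \<iota>' g \<otimes>\<^bsub>E'\<^esub> h e = h e \<otimes>\<^bsub>E'\<^esub> \<iota>' (\<psi> (c u) g)) \<longleftrightarrow>
        (\<forall>g \<in> \<pi> ` carrier G. \<iota>' g \<otimes>\<^bsub>E'\<^esub> h e = h e \<otimes>\<^bsub>E'\<^esub> \<iota>' (\<psi> (c u) g))"
      by simp
    also have "\<dots> \<longleftrightarrow>
        (\<forall>g \<in> carrier G. \<iota>' (\<pi> g) \<otimes>\<^bsub>E'\<^esub> h e = h e \<otimes>\<^bsub>E'\<^esub> \<iota>' (\<psi> (c u) (\<pi> g)))"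
      by blast
    also have "\<dots> \<longleftrightarrow> (\<forall>g \<in> carrier G. h (\<iota> g \<otimes>\<^bsub>E\<^esub> e) = h (e \<otimes>\<^bsub>E\<^esub> \<iota> (\<psi> u g)))"
      using that by (intro ball_cong) (simp_all add: c\<psi> \<pi>h)
    also have "\<dots> \<longleftrightarrow> (\<forall>g \<in> carrier G. \<iota> g \<otimes>\<^bsub>E\<^esub> e = e \<otimes>\<^bsub>E\<^esub> \<iota> (\<psi> u g))"
      using that by (intro ball_cong refl h_eq_iff) simp_all
    finally show ?thesis by blast
  qed
  define L where "L = {(s, s'). \<exists>u e. (s, u, e) \<in> K \<and> (s', c u, h e) \<in> K'}"
  have "L \<subseteq> carrier S \<times> carrier S'"
    using A.K_closed B.K_closed by (auto simp: L_def)
  moreover have "(s \<otimes>\<^bsub>S\<^esub> t, s' \<otimes>\<^bsub>S'\<^esub> t') \<in> L" if "(s, s') \<in> L" "(t, t') \<in> L" for s s' t t'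
  proof -
    obtain u e v f where k: "(s, u, e) \<in> K" "(s', c u, h e) \<in> K'" "(t, v, f) \<in> K" "(t', c v, h f) \<in> K'"
      using \<open>(s, s') \<in> L\<close> \<open>(t, t') \<in> L\<close> by (auto simp: L_def)
    then show ?thesis
      using A.K_mult[OF k(1,3)] B.K_mult[OF k(2,4)] A.K_closed[OF k(1)] A.K_closed[OF k(3)]
      by (auto simp: L_def h.hom_mult[symmetric] c.hom_mult[symmetric] simp del: h.hom_mult c.hom_mult)
  qed
  moreover have "(inv\<^bsub>S\<^esub> s, inv\<^bsub>S'\<^esub> s') \<in> L" if "(s, s') \<in> L" for s s'
  proof -
    obtain u e where k: "(s, u, e) \<in> K" "(s', c u, h e) \<in> K'"
      using \<open>(s, s') \<in> L\<close> by (auto simp: L_def)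
    then show ?thesis
      using A.K_inv[OF k(1)] B.K_inv[OF k(2)] A.K_closed[OF k(1)]
      by (auto simp: L_def h.hom_inv[symmetric] c.hom_inv[symmetric] simp del: h.hom_inv c.hom_inv)
  qed
  moreover have "\<exists>s'. (s, s') \<in> L" if "s \<in> carrier S" for s
  proof -
    obtain u e where k: "(s, u, e) \<in> K" using A.K_onto_S \<open>s \<in> carrier S\<close> by blast
    have "\<exists>s'. (s', c u, h e) \<in> K'"
      using A.K_closed[OF k] A.K_commute[OF k] commute_iff[of e u] by (intro B.K_ex_S) auto
    then show ?thesis using k by (auto simp: L_def)
  qed
  moreover have "\<exists>s. (s, s') \<in> L" if "s' \<in> carrier S'" for s'
  proof -
    obtain u' e' where k: "(s', u', e') \<in> K'" using B.K_onto_S \<open>s' \<in> carrier S'\<close> by blast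
    obtain u e where ue: "u \<in> carrier U" "c u = u'" "e \<in> carrier E" "h e = e'"
      using B.K_closed[OF k] c(2) h_bij unfolding bij_betw_def by (metis imageE)
    then have "\<exists>s. (s, u, e) \<in> K"
      using B.K_commute[OF k] commute_iff[of e u] by (intro A.K_ex_S) auto
    then show ?thesis using k ue by (auto simp: L_def)
  qed
  moreover have "s = \<one>\<^bsub>S\<^esub>" if "(s, \<one>\<^bsub>S'\<^esub>) \<in> L" for s
  proof -
    obtain u e where k: "(s, u, e) \<in> K" "(\<one>\<^bsub>S'\<^esub>, c u, h e) \<in> K'"
      using \<open>(s, \<one>\<^bsub>S'\<^esub>) \<in> L\<close> by (auto simp: L_def)
    note k' = A.K_closed[OF k(1)]
    obtain g' where g': "g' \<in> carrier G" "c u = \<gamma> g'" "h e = \<iota>' g'"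
      using B.K_kernel_S[OF k(2)] by blast
    define g where "g = (inv\<^bsub>Aut G\<^esub> \<pi>) g'"
    have g: "g \<in> carrier G" "\<pi> g = g'" using g' \<pi> by (simp_all add: g_def)
    have "c u = c (\<gamma> g)" "h e = h (\<iota> g)"
      using g g' by (simp_all add: c\<gamma> \<pi>h[symmetric])
    then have "u = \<gamma> g" "e = \<iota> g"
      using c_eq_iff h_eq_iff k' g by simp_all
    then show ?thesis
      using A.K_unique_S k(1) A.K_\<gamma>[OF g(1)] by blast
  qed
  moreover have "s' = \<one>\<^bsub>S'\<^esub>" if "(\<one>\<^bsub>S\<^esub>, s') \<in> L" for s'
  proof -
    obtain u e where k: "(\<one>\<^bsub>S\<^esub>, u, e) \<in> K" "(s', c u, h e) \<in> K'"
      using \<open>(\<one>\<^bsub>S\<^esub>, s') \<in> L\<close> by (auto simp: L_def)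
    obtain g where g: "g \<in> carrier G" "u = \<gamma> g" "e = \<iota> g"
      using A.K_kernel_S[OF k(1)] by blast
    then show ?thesis
      using k(2) B.K_unique_S[OF _ B.K_\<gamma>[of "\<pi> g"]] \<pi> by (simp add: c\<gamma> \<pi>h)
  qed
  ultimately have "\<exists>j \<in> iso S S'. \<forall>s s'. (s, s') \<in> L \<longrightarrow> j s = s'"
    by (rule iso_of_subgroup_relation[OF A.S.is_group B.S.is_group])
  then obtain j where j: "j \<in> iso S S'" "\<And>s s'. (s, s') \<in> L \<Longrightarrow> j s = s'"
    by blast
  \<comment> \<open>\<kappa> z and \<iota> z are partners over the identity of U, which c fixes, so
    j on the centre is read off from h.\<close>
  have "j (\<kappa> z) = \<kappa>' (\<pi> z)" if z: "z \<in> centre G" for z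
  proof -
    have "(\<kappa>' (\<pi> z), c \<one>\<^bsub>U\<^esub>, h (\<iota> z)) \<in> K'"
      using B.K_\<kappa>[of "\<pi> z"] z \<pi> by (simp add: \<pi>h)
    then show ?thesis using A.K_\<kappa>[OF z] by (intro j(2)) (unfold L_def, blast)
  qed
  moreover have "\<phi>' (j s) =
      inv\<^bsub>Out G\<^esub> (outer_class G \<pi>) \<otimes>\<^bsub>Out G\<^esub> \<phi> s \<otimes>\<^bsub>Out G\<^esub> outer_class G \<pi>"
    if s: "s \<in> carrier S" for s
  proof -
    obtain s' where "(s, s') \<in> L" using \<open>\<And>s. s \<in> carrier S \<Longrightarrow> \<exists>s'. (s, s') \<in> L\<close> s by blast
    then obtain u e where k: "(s, u, e) \<in> K" "(j s, c u, h e) \<in> K'"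
      using j(2) by (auto simp: L_def)
    then show ?thesis
      using c\<phi>[of u] A.K_\<phi>[OF k(1)] B.K_\<phi>[OF k(2)] A.K_closed[OF k(1)] by simp
  qed
  ultimately show ?thesis
    using j(1) \<pi> A.S_ext B.S_ext by (simp add: Zphi_equivalence_rel_def) blast
qed

text \<open>K maps onto both quotients, and the two maps have the same kernel: over S it is
  described by \<open>K_kernel_S\<close>, over E by \<open>K_kernel_E\<close>, each up to the
  embedded subgroup divided out. Both groups act on G through the second component.\<close>

lemma (in linking) same_coupling: "same_coupling G (S, \<kappa>, \<phi>) (E, \<iota>)"
proof -
  note [simp] = centre_closed[OF group_G]
  define Z where "Z = \<kappa> ` centre G"
  define N where "N = \<iota> ` carrier G"
  interpret Z: normal Z S using S_ext by (simp add: Zphi_extensions_def Z_def)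
  interpret N: normal N E using E_ext by (simp add: extensions_def N_def)
  define L where "L = {(Z #>\<^bsub>S\<^esub> s, N #>\<^bsub>E\<^esub> e) | s u e. (s, u, e) \<in> K}"
  have L: "(Z #>\<^bsub>S\<^esub> s, N #>\<^bsub>E\<^esub> e) \<in> L" if "(s, u, e) \<in> K" for s u e
    using that by (auto simp: L_def)
  have LE: "\<exists>s u e. A = Z #>\<^bsub>S\<^esub> s \<and> B = N #>\<^bsub>E\<^esub> e \<and> (s, u, e) \<in> K" if "(A, B) \<in> L" for A B
    using that by (auto simp: L_def)
  have "L \<subseteq> carrier (S Mod Z) \<times> carrier (E Mod N)"
    using K_closed by (auto simp: L_def carrier_FactGroup)
  moreover have "(A \<otimes>\<^bsub>S Mod Z\<^esub> A', B \<otimes>\<^bsub>E Mod N\<^esub> B') \<in> L"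
    if AB: "(A, B) \<in> L" "(A', B') \<in> L" for A B A' B'
  proof -
    obtain s u e where k: "A = Z #>\<^bsub>S\<^esub> s" "B = N #>\<^bsub>E\<^esub> e" "(s, u, e) \<in> K"
      using LE[OF AB(1)] by blast
    obtain s' u' e' where k': "A' = Z #>\<^bsub>S\<^esub> s'" "B' = N #>\<^bsub>E\<^esub> e'" "(s', u', e') \<in> K"
      using LE[OF AB(2)] by blast
    show ?thesis
      using L[OF K_mult[OF k(3) k'(3)]] K_closed[OF k(3)] K_closed[OF k'(3)]
      by (simp add: k k' Z.rcos_sum N.rcos_sum)
  qed
  moreover have "(inv\<^bsub>S Mod Z\<^esub> A, inv\<^bsub>E Mod N\<^esub> B) \<in> L" if AB: "(A, B) \<in> L" for A B
  proof -
    obtain s u e where k: "A = Z #>\<^bsub>S\<^esub> s" "B = N #>\<^bsub>E\<^esub> e" "(s, u, e) \<in> K"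
      using LE[OF AB] by blast
    note k' = K_closed[OF k(3)]
    have "A \<in> carrier (S Mod Z)" "B \<in> carrier (E Mod N)"
      using k k' by (auto simp: carrier_FactGroup)
    then show ?thesis
      using L[OF K_inv[OF k(3)]] k'
      by (simp add: Z.inv_FactGroup N.inv_FactGroup) (simp add: k Z.rcos_inv N.rcos_inv)
  qed
  moreover have "\<exists>B. (A, B) \<in> L" if "A \<in> carrier (S Mod Z)" for A
    using that K_onto_S L by (fastforce simp: carrier_FactGroup)
  moreover have "\<exists>A. (A, B) \<in> L" if "B \<in> carrier (E Mod N)" for B
    using that K_onto_E L by (fastforce simp: carrier_FactGroup)
  moreover have "A = \<one>\<^bsub>S Mod Z\<^esub>" if AB: "(A, \<one>\<^bsub>E Mod N\<^esub>) \<in> L" for A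
  proof -
    obtain s u e where k: "A = Z #>\<^bsub>S\<^esub> s" "N = N #>\<^bsub>E\<^esub> e" "(s, u, e) \<in> K"
      using LE[OF AB] by (simp only: one_FactGroup) blast
    note k' = K_closed[OF k(3)]
    have "e \<in> N" using k k' E.coset_join1[OF _ k'(3) N.subgroup_axioms] by simp
    then obtain g where g: "g \<in> carrier G" "e = \<iota> g" by (auto simp: N_def)
    \<comment> \<open>Dividing by the diagonal triple of g makes the component in E trivial without
      changing s, and \<open>K_kernel_E\<close> applies.\<close>
    have "(s \<otimes>\<^bsub>S\<^esub> inv\<^bsub>S\<^esub> \<one>\<^bsub>S\<^esub>, u \<otimes>\<^bsub>U\<^esub> inv\<^bsub>U\<^esub> (\<gamma> g), e \<otimes>\<^bsub>E\<^esub> inv\<^bsub>E\<^esub> (\<iota> g)) \<in> K"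
      using k g by (intro K_mult K_inv K_\<gamma>)
    then have "(s, u \<otimes>\<^bsub>U\<^esub> inv\<^bsub>U\<^esub> (\<gamma> g), \<one>\<^bsub>E\<^esub>) \<in> K" using k' g by simp
    then obtain z where "z \<in> centre G" "s = inv\<^bsub>S\<^esub> (\<kappa> z)" by (rule K_kernel_E)
    then have "s \<in> Z" by (auto simp: Z_def intro!: Z.m_inv_closed[unfolded Z_def])
    then show ?thesis using k k' S.coset_join2[OF k'(1) Z.subgroup_axioms] by simp
  qed
  moreover have "B = \<one>\<^bsub>E Mod N\<^esub>" if AB: "(\<one>\<^bsub>S Mod Z\<^esub>, B) \<in> L" for B
  proof -
    obtain s u e where k: "Z = Z #>\<^bsub>S\<^esub> s" "B = N #>\<^bsub>E\<^esub> e" "(s, u, e) \<in> K"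
      using LE[OF AB] by (simp only: one_FactGroup) blast
    note k' = K_closed[OF k(3)]
    have "s \<in> Z" using k k' S.coset_join1[OF _ k'(1) Z.subgroup_axioms] by simp
    then obtain z where z: "z \<in> centre G" "s = \<kappa> z" by (auto simp: Z_def)
    have "(s \<otimes>\<^bsub>S\<^esub> inv\<^bsub>S\<^esub> (\<kappa> z), u \<otimes>\<^bsub>U\<^esub> \<gamma> z, e \<otimes>\<^bsub>E\<^esub> \<one>\<^bsub>E\<^esub>) \<in> K"
      using k z by (intro K_mult K_central)
    then have "(\<one>\<^bsub>S\<^esub>, u \<otimes>\<^bsub>U\<^esub> \<gamma> z, e) \<in> K" using k' z by simp
    then obtain g where "g \<in> carrier G" "e = \<iota> g" by (rule K_kernel_S)
    then have "e \<in> N" by (auto simp: N_def)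
    then show ?thesis using k k' E.coset_join2[OF k'(3) N.subgroup_axioms] by simp
  qed
  ultimately have "\<exists>\<theta> \<in> iso (S Mod Z) (E Mod N). \<forall>A B. (A, B) \<in> L \<longrightarrow> \<theta> A = B"
    by (rule iso_of_subgroup_relation[OF Z.factorgroup_is_group N.factorgroup_is_group])
  then obtain \<theta> where \<theta>: "\<theta> \<in> iso (S Mod Z) (E Mod N)" "\<And>A B. (A, B) \<in> L \<Longrightarrow> \<theta> A = B"
    by blast
  have "\<exists>\<alpha> \<in> \<phi> s. \<forall>g \<in> carrier G. inv\<^bsub>E\<^esub> e \<otimes>\<^bsub>E\<^esub> \<iota> g \<otimes>\<^bsub>E\<^esub> e = \<iota> (\<alpha> g)"
    if s: "s \<in> carrier S" and e: "e \<in> \<theta> (Z #>\<^bsub>S\<^esub> s)" for s e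
  proof -
    obtain u f where k: "(s, u, f) \<in> K" using K_onto_S[OF s] by blast
    have "e \<in> N #>\<^bsub>E\<^esub> f" using e \<theta>(2)[OF L[OF k]] by simp
    then obtain h where h: "h \<in> carrier G" "e = \<iota> h \<otimes>\<^bsub>E\<^esub> f"
      by (auto simp: N_def r_coset_def)
    \<comment> \<open>Each element e of the coset needs its own representative of \<phi> s: the
      factor \<iota> h is matched by \<gamma> h in U, so e acts on G as \<psi> v.\<close>
    define v where "v = \<gamma> h \<otimes>\<^bsub>U\<^esub> u"
    have k': "(s, v, e) \<in> K"
      using K_mult[OF K_\<gamma>[OF h(1)] k] h s by (simp add: v_def)
    note c = K_closed[OF k']
    have "\<psi> v \<in> \<phi> s"
      unfolding K_\<phi>[OF k']
      using Aut.rcos_self[OF \<psi>.hom_closed[OF c(2)] normal_imp_subgroup[OF Inn_normal[OF group_G]]] .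
    moreover have "inv\<^bsub>E\<^esub> e \<otimes>\<^bsub>E\<^esub> \<iota> g \<otimes>\<^bsub>E\<^esub> e = \<iota> (\<psi> v g)" if g: "g \<in> carrier G" for g
    proof -
      have "\<iota> (\<psi> v g) \<in> carrier E"
        using g c Aut_closed[OF group_G] by simp
      moreover have "inv\<^bsub>E\<^esub> e \<otimes>\<^bsub>E\<^esub> \<iota> g \<otimes>\<^bsub>E\<^esub> e = inv\<^bsub>E\<^esub> e \<otimes>\<^bsub>E\<^esub> (e \<otimes>\<^bsub>E\<^esub> \<iota> (\<psi> v g))"
        using g c K_commute[OF k' g] by (simp add: E.m_assoc)
      ultimately show ?thesis using c by (simp add: E.mult_inv_cancel)
    qed
    ultimately show ?thesis by blast
  qed
  then show ?thesis using \<theta>(1) by (auto simp: Z_def N_def)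
qed

section \<open>Existence of linked extensions\<close>

lemma carrier_DirProd: "carrier (A \<times>\<times> B) = carrier A \<times> carrier B"
  by (simp add: DirProd_def)

text \<open>K is the graph of the quotient map from the fibre product P onto E; the uniqueness
  axioms hold because the antidiagonal centre meets both factors trivially.\<close>

lemma (in outer_lift) ex_linking_of_Zphi_extension:
  fixes S :: "'u monoid"
  assumes S_ext: "(S, \<kappa>, \<phi>) \<in> Zphi_extensions G"
    and "infinite (UNIV :: 'u set)" "carrier G \<lesssim> (UNIV :: 'u set)"
  shows "\<exists>(E :: 'u monoid) \<iota> K. linking G U \<psi> \<gamma> S \<kappa> \<phi> E \<iota> K"
proof -
  interpret G: group G by (rule group_G)
  interpret U: group U by (rule group_U)
  interpret S: group S using S_ext by (simp add: Zphi_extensions_def)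
  interpret Zc: comm_group "G\<lparr>carrier := centre G\<rparr>" by (rule comm_group_centre[OF group_G])
  interpret Aut: group "Aut G" by (rule group_Aut[OF group_G])
  interpret Out: group "Out G" by (rule group_Out[OF group_G])
  interpret \<psi>: group_hom U "Aut G" \<psi>
    by (simp add: group_U group_Aut[OF group_G] \<psi>_hom group_hom_def group_hom_axioms_def)
  interpret \<gamma>: group_hom G U \<gamma>
    by (simp add: group_G group_U \<gamma>_hom group_hom_def group_hom_axioms_def)
  interpret \<phi>: group_hom S "Out G" \<phi>
    using S_ext by (simp add: Zphi_extensions_def S.is_group Out.is_group group_hom_def group_hom_axioms_def)
  interpret \<kappa>: group_hom "G\<lparr>carrier := centre G\<rparr>" S \<kappa>
    using S_ext by (simp add: Zphi_extensions_def S.is_group Zc.is_group group_hom_def group_hom_axioms_def)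
  interpret o: group_hom U "Out G" "\<lambda>u. outer_class G (\<psi> u)"
    using Group.hom_compose[OF \<psi>_hom outer_class_hom[OF group_G]]
    by (simp add: comp_def U.is_group Out.is_group group_hom_def group_hom_axioms_def)
  interpret Z: subgroup "centre G" G by (rule subgroup_centre[OF group_G])
  have \<kappa>_closed [simp]: "\<kappa> z \<in> carrier S" if "z \<in> centre G" for z
    using \<kappa>.hom_closed that by simp
  have \<kappa>_inj: "z = \<one>\<^bsub>G\<^esub>" if "z \<in> centre G" "\<kappa> z = \<one>\<^bsub>S\<^esub>" for z
    using S_ext that \<kappa>.inj_on_one_iff by (simp add: Zphi_extensions_def)
  have \<phi>\<kappa> [simp]: "\<phi> (\<kappa> z) = \<one>\<^bsub>Out G\<^esub>" if "z \<in> centre G" for z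
    using S_ext that by (auto simp: Zphi_extensions_def kernel_def)
  have o\<gamma> [simp]: "outer_class G (\<psi> (\<gamma> g)) = \<one>\<^bsub>Out G\<^esub>" if "g \<in> carrier G" for g
    using outer_class_\<psi>_\<gamma>[OF U.one_closed that] that o.hom_one by simp
  note [simp] = Z.mem_carrier Aut_closed[OF group_G] Aut_centre[OF group_G] Aut_inv[OF group_G]
  define P where "P = {(s, u). s \<in> carrier S \<and> u \<in> carrier U \<and> \<phi> s = outer_class G (\<psi> u)}"
  interpret SU: group "S \<times>\<times> U" by (rule DirProd_group[OF S.is_group U.is_group])
  have P: "subgroup P (S \<times>\<times> U)"
  proof (rule SU.subgroupI)
    have "(\<one>\<^bsub>S\<^esub>, \<one>\<^bsub>U\<^esub>) \<in> P" using o.hom_one \<phi>.hom_one by (simp add: P_def del: \<psi>.hom_one)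
    then show "P \<noteq> {}" by blast
  qed (use o.hom_inv o.hom_mult in \<open>auto simp: P_def carrier_DirProd
      S.is_group U.is_group simp del: \<psi>.hom_mult \<psi>.hom_inv\<close>)
  define PG where "PG = (S \<times>\<times> U)\<lparr>carrier := P\<rparr>"
  interpret PG: group PG
    unfolding PG_def by (rule SU.subgroup_imp_group[OF P])
  have PG: "carrier PG = P" "\<one>\<^bsub>PG\<^esub> = (\<one>\<^bsub>S\<^esub>, \<one>\<^bsub>U\<^esub>)"
      "(s, u) \<otimes>\<^bsub>PG\<^esub> (s', u') = (s \<otimes>\<^bsub>S\<^esub> s', u \<otimes>\<^bsub>U\<^esub> u')" for s u s' u'
    by (simp_all add: PG_def)
  \<comment> \<open>The inverse in the second component makes (\<kappa> z, 1) and (1, \<gamma> z)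
    equal in the quotient, so both copies of the centre become one.\<close>
  define a where "a z = (\<kappa> z, \<gamma> (inv\<^bsub>G\<^esub> z))" for z
  have a_commute: "a z \<otimes>\<^bsub>PG\<^esub> (s, u) = (s, u) \<otimes>\<^bsub>PG\<^esub> a (\<psi> u z)"
    if P': "(s, u) \<in> P" and z: "z \<in> centre G" for s u z
  proof -
    have su: "s \<in> carrier S" "u \<in> carrier U" "\<phi> s = outer_class G (\<psi> u)"
      using P' by (auto simp: P_def)
    have "\<psi> u \<in> \<phi> s"
      unfolding su(3)
      using Aut.rcos_self[OF \<psi>.hom_closed[OF su(2)] normal_imp_subgroup[OF Inn_normal[OF group_G]]] .
    then have "inv\<^bsub>S\<^esub> s \<otimes>\<^bsub>S\<^esub> \<kappa> z \<otimes>\<^bsub>S\<^esub> s = \<kappa> (\<psi> u z)"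
      using S_ext su(1) z by (auto simp: Zphi_extensions_def)
    then have "\<kappa> z \<otimes>\<^bsub>S\<^esub> s = s \<otimes>\<^bsub>S\<^esub> \<kappa> (\<psi> u z)"
      using su z S.mult_inv_cancel(1)[of s "\<kappa> z \<otimes>\<^bsub>S\<^esub> s"] by (simp add: S.m_assoc)
    moreover have "\<gamma> (inv\<^bsub>G\<^esub> z) \<otimes>\<^bsub>U\<^esub> u = u \<otimes>\<^bsub>U\<^esub> \<gamma> (inv\<^bsub>G\<^esub> (\<psi> u z))"
      using \<gamma>_commute[OF su(2), of "inv\<^bsub>G\<^esub> z"] z su by (simp del: \<gamma>.hom_inv)
    ultimately show ?thesis by (simp add: a_def PG)
  qed
  have "a \<in> hom (G\<lparr>carrier := centre G\<rparr>) PG"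
  proof (rule homI)
    show "a z \<in> carrier PG" if "z \<in> carrier (G\<lparr>carrier := centre G\<rparr>)" for z
      using that o\<gamma>[of "inv\<^bsub>G\<^esub> z"] by (simp add: PG a_def P_def del: \<gamma>.hom_inv \<psi>.hom_inv)
    show "a (y \<otimes>\<^bsub>G\<lparr>carrier := centre G\<rparr>\<^esub> z) = a y \<otimes>\<^bsub>PG\<^esub> a z"
      if "y \<in> carrier (G\<lparr>carrier := centre G\<rparr>)" "z \<in> carrier (G\<lparr>carrier := centre G\<rparr>)" for y z
      using that \<kappa>.hom_mult[of y z] centre_commute[OF group_G, of y z]
      by (simp add: PG a_def G.inv_mult_group)
  qed
  then interpret a: group_hom "G\<lparr>carrier := centre G\<rparr>" PG a
    by (simp add: PG.is_group Zc.is_group group_hom_def group_hom_axioms_def)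
  define N where "N = a ` centre G"
  have N: "N \<lhd> PG"
  proof (rule PG.normal_of_commute)
    show "subgroup N PG" using a.img_is_subgroup by (simp add: N_def)
    show "\<exists>n' \<in> N. n \<otimes>\<^bsub>PG\<^esub> x = x \<otimes>\<^bsub>PG\<^esub> n'" if x: "x \<in> carrier PG" and n: "n \<in> N" for x n
    proof -
      obtain z where z: "z \<in> centre G" "n = a z" using n by (auto simp: N_def)
      have "\<psi> (snd x) z \<in> centre G" using x z by (auto simp: PG P_def)
      then show ?thesis
        using a_commute[of "fst x" "snd x" z] x z by (auto simp: PG N_def)
    qed
  qed
  have "\<exists>u. (s, u) \<in> P" if s: "s \<in> carrier S" for s
  proof -
    have "\<phi> s \<in> outer_class G ` \<psi> ` carrier U"
      using \<phi>.hom_closed[OF s] by (simp add: carrier_Out[OF group_G] \<psi>_onto)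
    then show ?thesis using s by (auto simp: P_def)
  qed
  then obtain v where v: "\<And>s. s \<in> carrier S \<Longrightarrow> (s, v s) \<in> P" by metis
  \<comment> \<open>The type of U is unrelated to \<open>'u\<close>, so P is bounded differently:
    its fibres over S are cosets of the copy of G.\<close>
  have "P \<subseteq> (\<lambda>(s, g). (s, v s \<otimes>\<^bsub>U\<^esub> \<gamma> g)) ` (carrier S \<times> carrier G)"
  proof
    fix x assume "x \<in> P"
    then obtain s u where x: "x = (s, u)" "s \<in> carrier S" "u \<in> carrier U" "\<phi> s = outer_class G (\<psi> u)"
      by (auto simp: P_def)
    have "v s \<in> carrier U" "outer_class G (\<psi> u) = outer_class G (\<psi> (v s))"
      using v[OF x(2)] x(4) by (auto simp: P_def)
    then obtain g where "g \<in> carrier G" "u = v s \<otimes>\<^bsub>U\<^esub> \<gamma> g"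
      using same_outer_class[OF x(3)] by blast
    then show "x \<in> (\<lambda>(s, g). (s, v s \<otimes>\<^bsub>U\<^esub> \<gamma> g)) ` (carrier S \<times> carrier G)"
      using x by force
  qed
  then have "P \<lesssim> carrier S \<times> carrier G"
    by (meson image_lepoll lepoll_trans subset_imp_lepoll)
  moreover have "carrier S \<times> carrier G \<lesssim> (UNIV :: 'u set)"
    using assms(2,3) by (intro times_lepoll_infinite) (simp_all add: subset_imp_lepoll)
  ultimately have "carrier PG \<lesssim> (UNIV :: 'u set)"
    using lepoll_trans by (simp add: PG) blast
  then obtain E :: "'u monoid" and \<Phi> where E: "group E" and \<Phi>: "\<Phi> \<in> hom PG E" "\<Phi> ` carrier PG = carrier E"
    and \<Phi>_one: "\<And>x. x \<in> carrier PG \<Longrightarrow> \<Phi> x = \<one>\<^bsub>E\<^esub> \<longleftrightarrow> x \<in> N"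
    using quotient_on_type[OF N] by blast
  interpret E: group E by (rule E)
  interpret \<Phi>: group_hom PG E \<Phi>
    by (simp add: PG.is_group E \<Phi>(1) group_hom_def group_hom_axioms_def)
  define \<iota> where "\<iota> g = \<Phi> (\<one>\<^bsub>S\<^esub>, \<gamma> g)" for g
  have \<gamma>P: "(\<one>\<^bsub>S\<^esub>, \<gamma> g) \<in> P" if "g \<in> carrier G" for g
    using that o\<gamma>[OF that] by (simp add: P_def)
  have P_mult: "(s \<otimes>\<^bsub>S\<^esub> s', u \<otimes>\<^bsub>U\<^esub> u') \<in> P" if "(s, u) \<in> P" "(s', u') \<in> P" for s u s' u'
    using PG.m_closed[of "(s, u)" "(s', u')"] that by (simp add: PG)
  have \<Phi>_mult: "\<Phi> (s \<otimes>\<^bsub>S\<^esub> s', u \<otimes>\<^bsub>U\<^esub> u') = \<Phi> (s, u) \<otimes>\<^bsub>E\<^esub> \<Phi> (s', u')"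
    if "(s, u) \<in> P" "(s', u') \<in> P" for s u s' u'
    using \<Phi>.hom_mult[of "(s, u)" "(s', u')"] that by (simp add: PG)
  have P_closed: "s \<in> carrier S" "u \<in> carrier U" "\<phi> s = outer_class G (\<psi> u)" if "(s, u) \<in> P" for s u
    using that by (auto simp: P_def)
  have \<iota>_commute: "\<iota> g \<otimes>\<^bsub>E\<^esub> \<Phi> (s, u) = \<Phi> (s, u) \<otimes>\<^bsub>E\<^esub> \<iota> (\<psi> u g)"
    if "(s, u) \<in> P" "g \<in> carrier G" for s u g
    using that P_closed[OF that(1)] \<Phi>_mult[OF \<gamma>P that(1), of g] \<Phi>_mult[OF that(1) \<gamma>P, of "\<psi> u g"]
      \<gamma>_commute[of u g]
    by (simp add: \<iota>_def)
  have "\<iota> \<in> hom G E"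
  proof (rule homI)
    show "\<iota> g \<in> carrier E" if "g \<in> carrier G" for g
      using \<Phi>.hom_closed \<gamma>P[OF that] by (simp add: \<iota>_def PG)
    show "\<iota> (g \<otimes>\<^bsub>G\<^esub> h) = \<iota> g \<otimes>\<^bsub>E\<^esub> \<iota> h" if "g \<in> carrier G" "h \<in> carrier G" for g h
      using that \<Phi>_mult[OF \<gamma>P \<gamma>P, of g h] by (simp add: \<iota>_def)
  qed
  then interpret \<iota>: group_hom G E \<iota>
    by (simp add: group_G E group_hom_def group_hom_axioms_def)
  have "g = \<one>\<^bsub>G\<^esub>" if g: "g \<in> carrier G" "\<iota> g = \<one>\<^bsub>E\<^esub>" for g
  proof -
    obtain z where z: "z \<in> centre G" "\<one>\<^bsub>S\<^esub> = \<kappa> z" "\<gamma> g = \<gamma> (inv\<^bsub>G\<^esub> z)"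
      using g \<Phi>_one[of "(\<one>\<^bsub>S\<^esub>, \<gamma> g)"] \<gamma>P[OF g(1)] by (auto simp: \<iota>_def PG N_def a_def)
    then have "z = \<one>\<^bsub>G\<^esub>" using \<kappa>_inj by simp
    then show ?thesis using z g \<gamma>_eq_iff[of g "\<one>\<^bsub>G\<^esub>"] by simp
  qed
  then have \<iota>_inj: "inj_on \<iota> (carrier G)" by (simp add: \<iota>.inj_on_one_iff)
  have \<iota>_normal: "\<iota> ` carrier G \<lhd> E"
  proof (rule E.normal_of_commute[OF \<iota>.img_is_subgroup])
    fix e n assume "e \<in> carrier E" "n \<in> \<iota> ` carrier G"
    then obtain g where g: "g \<in> carrier G" "n = \<iota> g" by blast
    obtain s u where "(s, u) \<in> P" "e = \<Phi> (s, u)"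
      using \<open>e \<in> carrier E\<close> unfolding \<Phi>(2)[symmetric] PG by auto
    with g show "\<exists>n' \<in> \<iota> ` carrier G. n \<otimes>\<^bsub>E\<^esub> e = e \<otimes>\<^bsub>E\<^esub> n'"
      using \<iota>_commute[of s u g] P_closed[of s u] by auto
  qed
  define K where "K = {(s, u, e). (s, u) \<in> P \<and> e = \<Phi> (s, u)}"
  have "linking G U \<psi> \<gamma> S \<kappa> \<phi> E \<iota> K"
  proof (intro linking.intro[OF outer_lift_axioms] linking_axioms.intro)
    show "(S, \<kappa>, \<phi>) \<in> Zphi_extensions G" by (rule S_ext)
    show "(E, \<iota>) \<in> extensions G"
      using E \<iota>.homh \<iota>_inj \<iota>_normal by (simp add: extensions_def)
    show "K \<subseteq> carrier S \<times> carrier U \<times> carrier E"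
      using \<Phi>.hom_closed by (auto simp: K_def P_closed PG)
    show "(s \<otimes>\<^bsub>S\<^esub> s', u \<otimes>\<^bsub>U\<^esub> u', e \<otimes>\<^bsub>E\<^esub> e') \<in> K" if "(s, u, e) \<in> K" "(s', u', e') \<in> K" for s u e s' u' e'
      using that by (auto simp: K_def P_mult \<Phi>_mult)
    show "(inv\<^bsub>S\<^esub> s, inv\<^bsub>U\<^esub> u, inv\<^bsub>E\<^esub> e) \<in> K" if "(s, u, e) \<in> K" for s u e
    proof -
      have P': "(s, u) \<in> P" "e = \<Phi> (s, u)" using that by (auto simp: K_def)
      have "inv\<^bsub>PG\<^esub> (s, u) = inv\<^bsub>S \<times>\<times> U\<^esub> (s, u)"
        unfolding PG_def by (rule SU.m_inv_consistent[OF P P'(1)])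
      also have "\<dots> = (inv\<^bsub>S\<^esub> s, inv\<^bsub>U\<^esub> u)"
        using P_closed[OF P'(1)] by (simp add: S.is_group U.is_group)
      finally show ?thesis
        using PG.inv_closed[of "(s, u)"] \<Phi>.hom_inv[of "(s, u)"] P' by (simp add: PG K_def)
    qed
    show "\<exists>u e. (s, u, e) \<in> K" if "s \<in> carrier S" for s
      using v[OF that] by (auto simp: K_def)
    show "\<exists>s u. (s, u, e) \<in> K" if "e \<in> carrier E" for e
      using that unfolding \<Phi>(2)[symmetric] by (auto simp: PG K_def)
    show "s = \<one>\<^bsub>S\<^esub>" if "(s, \<one>\<^bsub>U\<^esub>, \<one>\<^bsub>E\<^esub>) \<in> K" for s
    proof -
      have "(s, \<one>\<^bsub>U\<^esub>) \<in> P" "\<Phi> (s, \<one>\<^bsub>U\<^esub>) = \<one>\<^bsub>E\<^esub>" using that by (auto simp: K_def)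
      then obtain z where z: "z \<in> centre G" "s = \<kappa> z" "\<gamma> (inv\<^bsub>G\<^esub> z) = \<one>\<^bsub>U\<^esub>"
        using \<Phi>_one[of "(s, \<one>\<^bsub>U\<^esub>)"] by (auto simp: PG N_def a_def simp del: \<gamma>.hom_inv)
      then have "inv\<^bsub>G\<^esub> z = \<one>\<^bsub>G\<^esub>"
        using \<gamma>_eq_iff[of "inv\<^bsub>G\<^esub> z" "\<one>\<^bsub>G\<^esub>"] by simp
      then show ?thesis using z \<kappa>.hom_one by simp
    qed
    show "e = \<one>\<^bsub>E\<^esub>" if "(\<one>\<^bsub>S\<^esub>, \<one>\<^bsub>U\<^esub>, e) \<in> K" for e
      using that \<Phi>.hom_one by (simp add: K_def PG)
    show "(\<kappa> z, \<one>\<^bsub>U\<^esub>, \<iota> z) \<in> K" if z: "z \<in> centre G" for z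
    proof -
      have kP: "(\<kappa> z, \<one>\<^bsub>U\<^esub>) \<in> P"
        using z o.hom_one by (simp add: P_def del: \<psi>.hom_one)
      have "a z \<in> carrier PG" "\<Phi> (a z) = \<one>\<^bsub>E\<^esub>"
        using z a.hom_closed \<Phi>_one[of "a z"] by (simp_all add: N_def)
      \<comment> \<open>Inserting the trivial factor \<Phi> (a z) trades \<gamma> z in the second
        component for \<kappa> z in the first.\<close>
      then have "\<iota> z = \<Phi> (a z) \<otimes>\<^bsub>E\<^esub> \<iota> z" using z by simp
      also have "\<dots> = \<Phi> (\<kappa> z, \<one>\<^bsub>U\<^esub>)"
        using \<Phi>_mult[of "\<kappa> z" "\<gamma> (inv\<^bsub>G\<^esub> z)" "\<one>\<^bsub>S\<^esub>" "\<gamma> z"] \<gamma>P[of z] \<open>a z \<in> carrier PG\<close> z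
        by (simp add: \<iota>_def a_def PG)
      finally show ?thesis using kP by (simp add: K_def)
    qed
    show "(\<one>\<^bsub>S\<^esub>, \<gamma> g, \<iota> g) \<in> K" if "g \<in> carrier G" for g
      using \<gamma>P[OF that] by (simp add: K_def \<iota>_def)
    show "\<phi> s = outer_class G (\<psi> u)" if "(s, u, e) \<in> K" for s u e
      using that by (auto simp: K_def P_closed)
    show "\<iota> g \<otimes>\<^bsub>E\<^esub> e = e \<otimes>\<^bsub>E\<^esub> \<iota> (\<psi> u g)" if "(s, u, e) \<in> K" "g \<in> carrier G" for s u e g
      using that \<iota>_commute by (auto simp: K_def)
  qed
  then show ?thesis by blast
qed

text \<open>K is again the graph of a quotient map, now from the fibre product T over
  \<open>Aut G\<close> modulo the diagonal copy of G. What survives of G in the quotient is the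
  centre, since (\<iota> z, 1) lies in T for central z.\<close>

lemma (in outer_lift) ex_linking_of_extension:
  fixes E :: "'u monoid"
  assumes E_ext: "(E, \<iota>) \<in> extensions G"
    and "infinite (UNIV :: 'u set)" "carrier G \<lesssim> (UNIV :: 'u set)"
  shows "\<exists>(S :: 'u monoid) \<kappa> \<phi> K. linking G U \<psi> \<gamma> S \<kappa> \<phi> E \<iota> K"
proof -
  interpret G: group G by (rule group_G)
  interpret U: group U by (rule group_U)
  interpret E: group E using E_ext by (simp add: extensions_def)
  interpret Zc: comm_group "G\<lparr>carrier := centre G\<rparr>" by (rule comm_group_centre[OF group_G])
  interpret Aut: group "Aut G" by (rule group_Aut[OF group_G])
  interpret Out: group "Out G" by (rule group_Out[OF group_G])
  interpret \<psi>: group_hom U "Aut G" \<psi>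
    by (simp add: group_U group_Aut[OF group_G] \<psi>_hom group_hom_def group_hom_axioms_def)
  interpret \<gamma>: group_hom G U \<gamma>
    by (simp add: group_G group_U \<gamma>_hom group_hom_def group_hom_axioms_def)
  interpret \<iota>: group_hom G E \<iota>
    using E_ext by (simp add: extensions_def G.is_group E.is_group group_hom_def group_hom_axioms_def)
  interpret o: group_hom U "Out G" "\<lambda>u. outer_class G (\<psi> u)"
    using Group.hom_compose[OF \<psi>_hom outer_class_hom[OF group_G]]
    by (simp add: comp_def U.is_group Out.is_group group_hom_def group_hom_axioms_def)
  interpret Z: subgroup "centre G" G by (rule subgroup_centre[OF group_G])
  interpret \<iota>G: normal "\<iota> ` carrier G" E using E_ext by (simp add: extensions_def)
  have \<iota>_inj: "inj_on \<iota> (carrier G)" using E_ext by (simp add: extensions_def)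
  note \<iota>_eq_iff = inj_on_eq_iff[OF \<iota>_inj]
  note [simp] = Z.mem_carrier Aut_closed[OF group_G] Aut_centre[OF group_G] Aut_inv[OF group_G]
    mult_Aut_apply[OF group_G] Aut_inv_apply[OF group_G] one_Aut_apply[OF group_G]
  \<comment> \<open>The fibre product over \<open>Aut G\<close> is expressed by a commutation rule,
    which avoids naming the homomorphism from E to \<open>Aut G\<close>.\<close>
  define T where "T = {(e, u). e \<in> carrier E \<and> u \<in> carrier U \<and>
    (\<forall>g \<in> carrier G. \<iota> g \<otimes>\<^bsub>E\<^esub> e = e \<otimes>\<^bsub>E\<^esub> \<iota> (\<psi> u g))}"
  have T_closed: "e \<in> carrier E" "u \<in> carrier U"
    and T_commute: "\<And>g. g \<in> carrier G \<Longrightarrow> \<iota> g \<otimes>\<^bsub>E\<^esub> e = e \<otimes>\<^bsub>E\<^esub> \<iota> (\<psi> u g)" if "(e, u) \<in> T" for e u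
    using that by (auto simp: T_def)
  have T_mult: "(e \<otimes>\<^bsub>E\<^esub> e', u \<otimes>\<^bsub>U\<^esub> u') \<in> T" if T: "(e, u) \<in> T" "(e', u') \<in> T" for e u e' u'
  proof -
    note c = T_closed[OF T(1)] T_closed[OF T(2)]
    have "\<iota> g \<otimes>\<^bsub>E\<^esub> (e \<otimes>\<^bsub>E\<^esub> e') = e \<otimes>\<^bsub>E\<^esub> e' \<otimes>\<^bsub>E\<^esub> \<iota> (\<psi> (u \<otimes>\<^bsub>U\<^esub> u') g)" if g: "g \<in> carrier G" for g
    proof -
      have "\<iota> g \<otimes>\<^bsub>E\<^esub> (e \<otimes>\<^bsub>E\<^esub> e') = e \<otimes>\<^bsub>E\<^esub> (\<iota> (\<psi> u g) \<otimes>\<^bsub>E\<^esub> e')"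
        using g c by (simp add: E.m_assoc[symmetric] T_commute[OF T(1) g])
      also have "\<dots> = e \<otimes>\<^bsub>E\<^esub> e' \<otimes>\<^bsub>E\<^esub> \<iota> (\<psi> (u \<otimes>\<^bsub>U\<^esub> u') g)"
        using g c T_commute[OF T(2), of "\<psi> u g"] by (simp add: E.m_assoc)
      finally show ?thesis .
    qed
    then show ?thesis using c by (simp add: T_def del: \<psi>.hom_mult)
  qed
  have T_inv: "(inv\<^bsub>E\<^esub> e, inv\<^bsub>U\<^esub> u) \<in> T" if T: "(e, u) \<in> T" for e u
  proof -
    note c = T_closed[OF T]
    have "\<iota> g \<otimes>\<^bsub>E\<^esub> inv\<^bsub>E\<^esub> e = inv\<^bsub>E\<^esub> e \<otimes>\<^bsub>E\<^esub> \<iota> (\<psi> (inv\<^bsub>U\<^esub> u) g)" if g: "g \<in> carrier G" for g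
    proof -
      define h where "h = (inv\<^bsub>Aut G\<^esub> (\<psi> u)) g"
      have h: "h \<in> carrier G" "\<psi> u h = g" "\<psi> (inv\<^bsub>U\<^esub> u) g = h" using g c by (simp_all add: h_def)
      have "\<iota> h \<otimes>\<^bsub>E\<^esub> e = e \<otimes>\<^bsub>E\<^esub> \<iota> g" using T_commute[OF T h(1)] h by simp
      then have "inv\<^bsub>E\<^esub> e \<otimes>\<^bsub>E\<^esub> (\<iota> h \<otimes>\<^bsub>E\<^esub> e) \<otimes>\<^bsub>E\<^esub> inv\<^bsub>E\<^esub> e = inv\<^bsub>E\<^esub> e \<otimes>\<^bsub>E\<^esub> (e \<otimes>\<^bsub>E\<^esub> \<iota> g) \<otimes>\<^bsub>E\<^esub> inv\<^bsub>E\<^esub> e"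
        by simp
      then show ?thesis using c h(1) g unfolding h(3) by (simp add: E.m_assoc E.mult_inv_cancel)
    qed
    then show ?thesis using c by (simp add: T_def del: \<psi>.hom_inv)
  qed
  have T_\<iota>\<gamma>: "(\<iota> g, \<gamma> g) \<in> T" if g: "g \<in> carrier G" for g
  proof -
    have "\<iota> h \<otimes>\<^bsub>E\<^esub> \<iota> g = \<iota> g \<otimes>\<^bsub>E\<^esub> \<iota> (\<psi> (\<gamma> g) h)" if h: "h \<in> carrier G" for h
    proof -
      have "h \<otimes>\<^bsub>G\<^esub> g = g \<otimes>\<^bsub>G\<^esub> \<psi> (\<gamma> g) h"
        using g h by (simp add: \<psi>_\<gamma> conj_aut_apply[OF group_G] G.m_assoc G.mult_inv_cancel)
      then have "\<iota> (h \<otimes>\<^bsub>G\<^esub> g) = \<iota> (g \<otimes>\<^bsub>G\<^esub> \<psi> (\<gamma> g) h)" by simp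
      then show ?thesis using g h by simp
    qed
    then show ?thesis using g by (simp add: T_def)
  qed
  have T_\<iota>: "(\<iota> z, \<one>\<^bsub>U\<^esub>) \<in> T" if z: "z \<in> centre G" for z
  proof -
    have "\<iota> h \<otimes>\<^bsub>E\<^esub> \<iota> z = \<iota> z \<otimes>\<^bsub>E\<^esub> \<iota> h" if h: "h \<in> carrier G" for h
      using arg_cong[OF centre_commute[OF group_G z h], of \<iota>] z h by simp
    then show ?thesis using z by (simp add: T_def)
  qed
  interpret EU: group "E \<times>\<times> U" by (rule DirProd_group[OF E.is_group U.is_group])
  have T: "subgroup T (E \<times>\<times> U)"
  proof (rule EU.subgroupI)
    show "T \<noteq> {}" using T_\<iota>\<gamma>[OF G.one_closed] by blast
    show "T \<subseteq> carrier (E \<times>\<times> U)" by (auto simp: carrier_DirProd T_closed)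
    show "inv\<^bsub>E \<times>\<times> U\<^esub> x \<in> T" if "x \<in> T" for x
      using that T_inv T_closed by (cases x) (simp add: E.is_group U.is_group)
    show "x \<otimes>\<^bsub>E \<times>\<times> U\<^esub> y \<in> T" if "x \<in> T" "y \<in> T" for x y
      using that T_mult by (cases x; cases y) simp
  qed
  define TG where "TG = (E \<times>\<times> U)\<lparr>carrier := T\<rparr>"
  interpret TG: group TG
    unfolding TG_def by (rule EU.subgroup_imp_group[OF T])
  have TG: "carrier TG = T" "\<one>\<^bsub>TG\<^esub> = (\<one>\<^bsub>E\<^esub>, \<one>\<^bsub>U\<^esub>)"
      "(e, u) \<otimes>\<^bsub>TG\<^esub> (e', u') = (e \<otimes>\<^bsub>E\<^esub> e', u \<otimes>\<^bsub>U\<^esub> u')" for e u e' u'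
    by (simp_all add: TG_def)
  have TG_inv: "inv\<^bsub>TG\<^esub> (e, u) = (inv\<^bsub>E\<^esub> e, inv\<^bsub>U\<^esub> u)" if "(e, u) \<in> T" for e u
    using EU.m_inv_consistent[OF T that] T_closed[OF that]
    by (simp add: TG_def E.is_group U.is_group)
  define d where "d g = (\<iota> g, \<gamma> g)" for g
  have "d \<in> hom G TG"
    by (rule homI) (simp_all add: d_def TG T_\<iota>\<gamma>)
  then interpret d: group_hom G TG d
    by (simp add: TG.is_group G.is_group group_hom_def group_hom_axioms_def)
  define N where "N = d ` carrier G"
  have N: "N \<lhd> TG"
  proof (rule TG.normal_of_commute)
    show "subgroup N TG" using d.img_is_subgroup by (simp add: N_def)
    show "\<exists>n' \<in> N. n \<otimes>\<^bsub>TG\<^esub> x = x \<otimes>\<^bsub>TG\<^esub> n'" if x: "x \<in> carrier TG" and n: "n \<in> N" for x n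
    proof -
      obtain g where g: "g \<in> carrier G" "n = d g" using n by (auto simp: N_def)
      obtain e u where eu: "x = (e, u)" "(e, u) \<in> T" using x by (cases x) (simp add: TG)
      have "n \<otimes>\<^bsub>TG\<^esub> x = x \<otimes>\<^bsub>TG\<^esub> d (\<psi> u g)"
        using T_commute[OF eu(2) g(1)] \<gamma>_commute[of u g] T_closed[OF eu(2)] g eu
        by (simp add: d_def TG)
      then show ?thesis using g T_closed[OF eu(2)] by (auto simp: N_def)
    qed
  qed
  \<comment> \<open>Normality of the embedded G makes conjugation by e an automorphism of G, and
    surjectivity of \<psi> lifts it to U.\<close>
  have "\<exists>u. (e, u) \<in> T" if e: "e \<in> carrier E" for e
  proof -
    define c where "c g = inv\<^bsub>E\<^esub> e \<otimes>\<^bsub>E\<^esub> \<iota> g \<otimes>\<^bsub>E\<^esub> e" for g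
    have "c \<in> hom G E"
      by (rule homI) (use e in \<open>simp_all add: c_def E.m_assoc E.mult_inv_cancel\<close>)
    moreover have "inj_on c (carrier G)"
      using e by (intro inj_onI) (simp add: c_def E.m_assoc \<iota>_eq_iff)
    moreover have "c ` carrier G = \<iota> ` carrier G"
    proof
      show "c ` carrier G \<subseteq> \<iota> ` carrier G"
        using \<iota>G.inv_op_closed1[OF e] by (auto simp: c_def)
      show "\<iota> ` carrier G \<subseteq> c ` carrier G"
      proof
        fix y assume y: "y \<in> \<iota> ` carrier G"
        then obtain a where a: "a \<in> carrier G" "\<iota> a = e \<otimes>\<^bsub>E\<^esub> y \<otimes>\<^bsub>E\<^esub> inv\<^bsub>E\<^esub> e"
          using \<iota>G.inv_op_closed2[OF e y] by force
        then have "y = c a"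
          using y e \<iota>G.mem_carrier by (simp add: c_def E.m_assoc E.mult_inv_cancel)
        then show "y \<in> c ` carrier G" using a by blast
      qed
    qed
    ultimately have "\<exists>\<alpha> \<in> carrier (Aut G). \<forall>g \<in> carrier G. \<iota> (\<alpha> g) = c g"
      by (rule Aut_of_embeddings[OF group_G \<iota>.homh \<iota>_inj])
    then obtain \<alpha> where \<alpha>: "\<alpha> \<in> carrier (Aut G)" "\<And>g. g \<in> carrier G \<Longrightarrow> \<iota> (\<alpha> g) = c g"
      by blast
    obtain u where u: "u \<in> carrier U" "\<psi> u = \<alpha>"
      using \<alpha>(1) unfolding \<psi>_onto[symmetric] by blast
    have "\<iota> g \<otimes>\<^bsub>E\<^esub> e = e \<otimes>\<^bsub>E\<^esub> \<iota> (\<psi> u g)" if "g \<in> carrier G" for g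
      using that e by (simp add: u(2) \<alpha>(2) c_def E.m_assoc E.mult_inv_cancel)
    then show ?thesis using e u(1) by (auto simp: T_def)
  qed
  then obtain v where v: "\<And>e. e \<in> carrier E \<Longrightarrow> (e, v e) \<in> T" by metis
  have same: "\<psi> u = \<psi> u'" if T': "(e, u) \<in> T" "(e, u') \<in> T" for e u u'
  proof (rule Aut_eqI[OF group_G])
    fix g assume g: "g \<in> carrier G"
    note c = T_closed[OF T'(1)] T_closed[OF T'(2)]
    have "e \<otimes>\<^bsub>E\<^esub> \<iota> (\<psi> u g) = e \<otimes>\<^bsub>E\<^esub> \<iota> (\<psi> u' g)"
      using T_commute[OF T'(1) g] T_commute[OF T'(2) g] by simp
    then show "\<psi> u g = \<psi> u' g" using c g by (simp add: \<iota>_eq_iff)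
  qed (use T_closed[OF T'(1)] T_closed[OF T'(2)] in auto)
  \<comment> \<open>Since e determines \<psi> u, the fibres of T over E are cosets of the copy of
    the centre; this bounds T independently of the type of U.\<close>
  have "T \<subseteq> (\<lambda>(e, z). (e, v e \<otimes>\<^bsub>U\<^esub> \<gamma> z)) ` (carrier E \<times> centre G)"
  proof
    fix x assume "x \<in> T"
    then obtain e u where x: "x = (e, u)" "(e, u) \<in> T" by (cases x) auto
    note c = T_closed[OF x(2)]
    obtain z where "z \<in> centre G" "u = v e \<otimes>\<^bsub>U\<^esub> \<gamma> z"
      using same_\<psi>[OF c(2) T_closed(2)[OF v[OF c(1)]] same[OF x(2) v[OF c(1)]]] by blast
    then show "x \<in> (\<lambda>(e, z). (e, v e \<otimes>\<^bsub>U\<^esub> \<gamma> z)) ` (carrier E \<times> centre G)"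
      using x c by force
  qed
  then have "T \<lesssim> carrier E \<times> centre G"
    by (meson image_lepoll lepoll_trans subset_imp_lepoll)
  moreover have "centre G \<lesssim> (UNIV :: 'u set)"
    using assms(3) by (meson Z.subset lepoll_trans subset_imp_lepoll)
  then have "carrier E \<times> centre G \<lesssim> (UNIV :: 'u set)"
    using assms(2) by (intro times_lepoll_infinite) (simp_all add: subset_imp_lepoll)
  ultimately have "carrier TG \<lesssim> (UNIV :: 'u set)"
    using lepoll_trans by (simp add: TG) blast
  then obtain S :: "'u monoid" and \<Psi> where S: "group S" and \<Psi>: "\<Psi> \<in> hom TG S" "\<Psi> ` carrier TG = carrier S"
    and \<Psi>_one: "\<And>x. x \<in> carrier TG \<Longrightarrow> \<Psi> x = \<one>\<^bsub>S\<^esub> \<longleftrightarrow> x \<in> N"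
    using quotient_on_type[OF N] by blast
  interpret S: group S by (rule S)
  interpret \<Psi>: group_hom TG S \<Psi>
    by (simp add: TG.is_group S \<Psi>(1) group_hom_def group_hom_axioms_def)
  have \<Psi>_closed: "\<Psi> (e, u) \<in> carrier S" if "(e, u) \<in> T" for e u
    using \<Psi>.hom_closed that by (simp add: TG)
  have \<Psi>_mult: "\<Psi> (e \<otimes>\<^bsub>E\<^esub> e', u \<otimes>\<^bsub>U\<^esub> u') = \<Psi> (e, u) \<otimes>\<^bsub>S\<^esub> \<Psi> (e', u')"
    if "(e, u) \<in> T" "(e', u') \<in> T" for e u e' u'
    using \<Psi>.hom_mult[of "(e, u)" "(e', u')"] that by (simp add: TG)
  have \<Psi>_inv: "\<Psi> (inv\<^bsub>E\<^esub> e, inv\<^bsub>U\<^esub> u) = inv\<^bsub>S\<^esub> (\<Psi> (e, u))" if "(e, u) \<in> T" for e u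
    using \<Psi>.hom_inv[of "(e, u)"] that by (simp add: TG TG_inv)
  have \<Psi>_d: "\<Psi> (\<iota> g, \<gamma> g) = \<one>\<^bsub>S\<^esub>" if "g \<in> carrier G" for g
    using \<Psi>_one[of "d g"] that T_\<iota>\<gamma>[OF that] by (simp add: TG N_def) (simp add: d_def)
  have \<Psi>_oneD: "\<exists>g \<in> carrier G. e = \<iota> g \<and> u = \<gamma> g" if "(e, u) \<in> T" "\<Psi> (e, u) = \<one>\<^bsub>S\<^esub>" for e u
    using \<Psi>_one[of "(e, u)"] that by (auto simp: TG N_def d_def)
  have \<Psi>_onto: "\<exists>e u. (e, u) \<in> T \<and> s = \<Psi> (e, u)" if "s \<in> carrier S" for s
    using that unfolding \<Psi>(2)[symmetric] TG by auto
  define \<kappa> where "\<kappa> z = \<Psi> (\<iota> z, \<one>\<^bsub>U\<^esub>)" for z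
  \<comment> \<open>Collecting \<psi> u over all preimages of s avoids a choice. Preimages differ by
    diagonal elements of G, so the set is a full coset of \<open>Inn G\<close>.\<close>
  define \<phi> where "\<phi> s = \<psi> ` {u. \<exists>e. (e, u) \<in> T \<and> \<Psi> (e, u) = s}" for s
  have \<phi>\<Psi>: "\<phi> (\<Psi> (e, u)) = outer_class G (\<psi> u)" if T': "(e, u) \<in> T" for e u
  proof
    note c = T_closed[OF T']
    note mem = mem_outer_class_iff[OF group_G \<psi>.hom_closed[OF c(2)]]
    show "\<phi> (\<Psi> (e, u)) \<subseteq> outer_class G (\<psi> u)"
    proof
      fix \<alpha> assume "\<alpha> \<in> \<phi> (\<Psi> (e, u))"
      then obtain e' u' where k: "\<alpha> = \<psi> u'" "(e', u') \<in> T" "\<Psi> (e', u') = \<Psi> (e, u)"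
        by (auto simp: \<phi>_def)
      note c' = T_closed[OF k(2)]
      have "\<Psi> (e' \<otimes>\<^bsub>E\<^esub> inv\<^bsub>E\<^esub> e, u' \<otimes>\<^bsub>U\<^esub> inv\<^bsub>U\<^esub> u) = \<one>\<^bsub>S\<^esub>"
        using k T' \<Psi>_closed[OF T'] by (simp add: \<Psi>_mult[OF k(2) T_inv[OF T']] \<Psi>_inv)
      then obtain g where g: "g \<in> carrier G" "u' \<otimes>\<^bsub>U\<^esub> inv\<^bsub>U\<^esub> u = \<gamma> g"
        using \<Psi>_oneD[OF T_mult[OF k(2) T_inv[OF T']]] by blast
      then have "u' = \<gamma> g \<otimes>\<^bsub>U\<^esub> u" using c c' by (simp add: U.inv_solve_right')
      then show "\<alpha> \<in> outer_class G (\<psi> u)"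
        unfolding mem using g c by (auto simp: k \<psi>_\<gamma>)
    qed
    show "outer_class G (\<psi> u) \<subseteq> \<phi> (\<Psi> (e, u))"
    proof
      fix \<alpha> assume "\<alpha> \<in> outer_class G (\<psi> u)"
      then obtain t where t: "t \<in> carrier G" "\<alpha> = conj_aut G t \<otimes>\<^bsub>Aut G\<^esub> \<psi> u"
        unfolding mem by blast
      have "\<alpha> = \<psi> (\<gamma> t \<otimes>\<^bsub>U\<^esub> u)" using t c by (simp add: \<psi>_\<gamma>)
      moreover have "\<Psi> (\<iota> t \<otimes>\<^bsub>E\<^esub> e, \<gamma> t \<otimes>\<^bsub>U\<^esub> u) = \<Psi> (e, u)"
        using \<Psi>_mult[OF T_\<iota>\<gamma>[OF t(1)] T'] \<Psi>_d[OF t(1)] \<Psi>_closed[OF T'] by simp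
      ultimately show "\<alpha> \<in> \<phi> (\<Psi> (e, u))"
        unfolding \<phi>_def using T_mult[OF T_\<iota>\<gamma>[OF t(1)] T'] by blast
    qed
  qed
  have \<kappa>_commute: "\<kappa> z \<otimes>\<^bsub>S\<^esub> \<Psi> (e, u) = \<Psi> (e, u) \<otimes>\<^bsub>S\<^esub> \<kappa> (\<psi> u z)"
    if T': "(e, u) \<in> T" and z: "z \<in> centre G" for e u z
  proof -
    note c = T_closed[OF T']
    have z': "\<psi> u z \<in> centre G" using z c by simp
    show ?thesis
      using T_commute[OF T', of z] z c \<Psi>_mult[OF T_\<iota>[OF z] T'] \<Psi>_mult[OF T' T_\<iota>[OF z']]
      by (simp add: \<kappa>_def)
  qed
  have "\<kappa> \<in> hom (G\<lparr>carrier := centre G\<rparr>) S"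
  proof (rule homI)
    show "\<kappa> z \<in> carrier S" if "z \<in> carrier (G\<lparr>carrier := centre G\<rparr>)" for z
      using that T_\<iota> \<Psi>_closed by (simp add: \<kappa>_def)
    show "\<kappa> (y \<otimes>\<^bsub>G\<lparr>carrier := centre G\<rparr>\<^esub> z) = \<kappa> y \<otimes>\<^bsub>S\<^esub> \<kappa> z"
      if "y \<in> carrier (G\<lparr>carrier := centre G\<rparr>)" "z \<in> carrier (G\<lparr>carrier := centre G\<rparr>)" for y z
      using that \<Psi>_mult[OF T_\<iota> T_\<iota>, of y z] by (simp add: \<kappa>_def)
  qed
  then interpret \<kappa>: group_hom "G\<lparr>carrier := centre G\<rparr>" S \<kappa>
    by (simp add: S Zc.is_group group_hom_def group_hom_axioms_def)
  have \<kappa>_closed: "\<kappa> z \<in> carrier S" if "z \<in> centre G" for z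
    using \<kappa>.hom_closed that by simp
  have "z = \<one>\<^bsub>G\<^esub>" if z: "z \<in> centre G" "\<kappa> z = \<one>\<^bsub>S\<^esub>" for z
  proof -
    obtain g where "g \<in> carrier G" "\<iota> z = \<iota> g" "\<gamma> \<one>\<^bsub>G\<^esub> = \<gamma> g"
      using \<Psi>_oneD[OF T_\<iota>[OF z(1)]] z(2) by (auto simp: \<kappa>_def)
    then show ?thesis using z \<gamma>_eq_iff[OF G.one_closed, of g] \<iota>_eq_iff by auto
  qed
  then have \<kappa>_inj: "inj_on \<kappa> (centre G)" using \<kappa>.inj_on_one_iff by simp
  have \<kappa>_normal: "\<kappa> ` centre G \<lhd> S"
  proof (rule S.normal_of_commute)
    show "subgroup (\<kappa> ` centre G) S" using \<kappa>.img_is_subgroup by simp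
    fix s n assume "s \<in> carrier S" "n \<in> \<kappa> ` centre G"
    then obtain z where z: "z \<in> centre G" "n = \<kappa> z" by blast
    obtain e u where eu: "(e, u) \<in> T" "s = \<Psi> (e, u)" using \<Psi>_onto \<open>s \<in> carrier S\<close> by blast
    then show "\<exists>n' \<in> \<kappa> ` centre G. n \<otimes>\<^bsub>S\<^esub> s = s \<otimes>\<^bsub>S\<^esub> n'"
      using \<kappa>_commute[OF eu(1) z(1)] z T_closed[OF eu(1)] by auto
  qed
  have \<phi>_hom: "\<phi> \<in> hom S (Out G)"
  proof (rule homI)
    fix s assume "s \<in> carrier S"
    then obtain e u where eu: "(e, u) \<in> T" "s = \<Psi> (e, u)" using \<Psi>_onto by blast
    then show "\<phi> s \<in> carrier (Out G)"
      using T_closed[OF eu(1)] o.hom_closed by (simp add: \<phi>\<Psi>)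
    fix s' assume "s' \<in> carrier S"
    then obtain e' u' where eu': "(e', u') \<in> T" "s' = \<Psi> (e', u')" using \<Psi>_onto by blast
    then show "\<phi> (s \<otimes>\<^bsub>S\<^esub> s') = \<phi> s \<otimes>\<^bsub>Out G\<^esub> \<phi> s'"
      using T_closed[OF eu(1)] T_closed[OF eu'(1)] o.hom_mult[of u u'] \<phi>\<Psi>[OF T_mult[OF eu(1) eu'(1)]] eu
      by (simp add: \<phi>\<Psi> \<Psi>_mult)
  qed
  have \<phi>\<kappa>: "\<phi> (\<kappa> z) = \<one>\<^bsub>Out G\<^esub>" if "z \<in> centre G" for z
    using \<phi>\<Psi>[OF T_\<iota>[OF that]] o.hom_one by (simp only: \<kappa>_def)
  \<comment> \<open>The condition concerns every representative \<alpha> of the coset; by the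
    definition of \<phi>, each one is \<psi> u for some preimage (e, u) of s.\<close>
  have act: "inv\<^bsub>S\<^esub> s \<otimes>\<^bsub>S\<^esub> \<kappa> z \<otimes>\<^bsub>S\<^esub> s = \<kappa> (\<alpha> z)"
    if s: "s \<in> carrier S" and z: "z \<in> centre G" and "\<alpha> \<in> \<phi> s" for s z \<alpha>
  proof -
    obtain e u where eu: "(e, u) \<in> T" "s = \<Psi> (e, u)" "\<alpha> = \<psi> u"
      using \<open>\<alpha> \<in> \<phi> s\<close> by (auto simp: \<phi>_def)
    have "\<kappa> (\<psi> u z) \<in> carrier S" using z T_closed[OF eu(1)] by (intro \<kappa>_closed) simp
    then show ?thesis
      using \<kappa>_commute[OF eu(1) z] s \<kappa>_closed[OF z]
      by (simp add: eu(2,3)[symmetric] S.m_assoc S.mult_inv_cancel)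
  qed
  define K where "K = {(s, u, e). (e, u) \<in> T \<and> s = \<Psi> (e, u)}"
  have "linking G U \<psi> \<gamma> S \<kappa> \<phi> E \<iota> K"
  proof (intro linking.intro[OF outer_lift_axioms] linking_axioms.intro)
    show "(S, \<kappa>, \<phi>) \<in> Zphi_extensions G"
      using S \<kappa>.homh \<kappa>_inj \<kappa>_normal \<phi>_hom \<phi>\<kappa> \<kappa>_closed act
      by (auto simp: Zphi_extensions_def kernel_def)
    show "(E, \<iota>) \<in> extensions G" by (rule E_ext)
    show "K \<subseteq> carrier S \<times> carrier U \<times> carrier E"
      using \<Psi>_closed T_closed by (auto simp: K_def)
    show "(s \<otimes>\<^bsub>S\<^esub> s', u \<otimes>\<^bsub>U\<^esub> u', e \<otimes>\<^bsub>E\<^esub> e') \<in> K" if "(s, u, e) \<in> K" "(s', u', e') \<in> K" for s u e s' u' e'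
      using that by (auto simp: K_def T_mult \<Psi>_mult)
    show "(inv\<^bsub>S\<^esub> s, inv\<^bsub>U\<^esub> u, inv\<^bsub>E\<^esub> e) \<in> K" if "(s, u, e) \<in> K" for s u e
      using that by (auto simp: K_def T_inv \<Psi>_inv)
    show "\<exists>u e. (s, u, e) \<in> K" if "s \<in> carrier S" for s
      using \<Psi>_onto[OF that] by (auto simp: K_def)
    show "\<exists>s u. (s, u, e) \<in> K" if "e \<in> carrier E" for e
      using v[OF that] by (auto simp: K_def)
    show "s = \<one>\<^bsub>S\<^esub>" if "(s, \<one>\<^bsub>U\<^esub>, \<one>\<^bsub>E\<^esub>) \<in> K" for s
      using that \<Psi>.hom_one by (simp add: K_def TG)
    show "e = \<one>\<^bsub>E\<^esub>" if "(\<one>\<^bsub>S\<^esub>, \<one>\<^bsub>U\<^esub>, e) \<in> K" for e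
    proof -
      have "(e, \<one>\<^bsub>U\<^esub>) \<in> T" "\<Psi> (e, \<one>\<^bsub>U\<^esub>) = \<one>\<^bsub>S\<^esub>" using that by (auto simp: K_def)
      then obtain g where g: "g \<in> carrier G" "e = \<iota> g" "\<one>\<^bsub>U\<^esub> = \<gamma> g"
        using \<Psi>_oneD by blast
      then have "g = \<one>\<^bsub>G\<^esub>" using \<gamma>_eq_iff[OF g(1) G.one_closed] by simp
      then show ?thesis using g(2) by simp
    qed
    show "(\<kappa> z, \<one>\<^bsub>U\<^esub>, \<iota> z) \<in> K" if "z \<in> centre G" for z
      using T_\<iota>[OF that] by (simp add: K_def \<kappa>_def)
    show "(\<one>\<^bsub>S\<^esub>, \<gamma> g, \<iota> g) \<in> K" if "g \<in> carrier G" for g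
      using T_\<iota>\<gamma>[OF that] \<Psi>_d[OF that] by (simp add: K_def)
    show "\<phi> s = outer_class G (\<psi> u)" if "(s, u, e) \<in> K" for s u e
      using that \<phi>\<Psi> by (auto simp: K_def)
    show "\<iota> g \<otimes>\<^bsub>E\<^esub> e = e \<otimes>\<^bsub>E\<^esub> \<iota> (\<psi> u g)" if "(s, u, e) \<in> K" "g \<in> carrier G" for s u e g
      using that T_commute by (auto simp: K_def)
  qed
  then show ?thesis by blast
qed

section \<open>The correspondence of classes\<close>

lemma G_isomorphism_rel_equiv:
  fixes G :: "('a, 'b) monoid_scheme"
  shows "equiv (extensions G :: ('u monoid \<times> ('a \<Rightarrow> 'u)) set) (G_isomorphism_rel G)"
proof (rule equivI)
  show "G_isomorphism_rel G \<subseteq> (extensions G :: ('u monoid \<times> ('a \<Rightarrow> 'u)) set) \<times> extensions G"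
    by (auto simp: G_isomorphism_rel_def)
  show "refl_on (extensions G :: ('u monoid \<times> ('a \<Rightarrow> 'u)) set) (G_isomorphism_rel G)"
    by (rule refl_onI) (force simp: G_isomorphism_rel_def intro: iso_set_refl)
  show "sym (G_isomorphism_rel G :: (('u monoid \<times> ('a \<Rightarrow> 'u)) \<times> _) set)"
  proof (rule symI)
    fix x y :: "'u monoid \<times> ('a \<Rightarrow> 'u)" assume "(x, y) \<in> G_isomorphism_rel G"
    then obtain E1 i1 E2 i2 h where xy: "x = (E1, i1)" "y = (E2, i2)" "x \<in> extensions G" "y \<in> extensions G"
      and h: "h \<in> iso E1 E2" "h ` (i1 ` carrier G) = i2 ` carrier G"
      by (auto simp: G_isomorphism_rel_def)
    have E1: "group E1" and i1: "i1 ` carrier G \<subseteq> carrier E1"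
      using xy by (auto simp: extensions_def hom_def)
    have "inv_into (carrier E1) h \<in> iso E2 E1"
      using group.iso_set_sym[OF E1 h(1)] .
    moreover have "inv_into (carrier E1) h ` (i2 ` carrier G) = i1 ` carrier G"
      unfolding h(2)[symmetric] using h(1) i1
      by (intro inv_into_image_cancel) (simp_all add: iso_def bij_betw_def)
    ultimately show "(y, x) \<in> G_isomorphism_rel G"
      using xy by (auto simp: G_isomorphism_rel_def)
  qed
  show "trans (G_isomorphism_rel G :: (('u monoid \<times> ('a \<Rightarrow> 'u)) \<times> _) set)"
  proof (rule transI)
    fix x y z :: "'u monoid \<times> ('a \<Rightarrow> 'u)"
    assume "(x, y) \<in> G_isomorphism_rel G" "(y, z) \<in> G_isomorphism_rel G"
    then obtain E1 i1 E2 i2 E3 i3 h k where xyz: "x = (E1, i1)" "y = (E2, i2)" "z = (E3, i3)"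
        "x \<in> extensions G" "z \<in> extensions G"
      and h: "h \<in> iso E1 E2" "h ` (i1 ` carrier G) = i2 ` carrier G"
      and k: "k \<in> iso E2 E3" "k ` (i2 ` carrier G) = i3 ` carrier G"
      by (auto simp: G_isomorphism_rel_def)
    have "k \<circ> h \<in> iso E1 E3" by (rule iso_set_trans[OF h(1) k(1)])
    moreover have "(k \<circ> h) ` (i1 ` carrier G) = i3 ` carrier G"
      using h(2) k(2) by (metis image_comp)
    ultimately show "(x, z) \<in> G_isomorphism_rel G"
      using xyz by (auto simp: G_isomorphism_rel_def intro!: bexI[of _ "k \<circ> h"])
  qed
qed

text \<open>The type \<open>'u\<close> carries the groups on both sides. Being infinite and at least
  as large as G, it has room for the quotients that realise the correspondence.\<close>

theorem corollary5p2p1: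
  fixes G :: "('a, 'b) monoid_scheme"
  assumes "group G"
    and "finite (centre G)"
    and "finite (carrier (Out G))"
    and "coprime (card (centre G)) (card (carrier (Out G)))"
    and "infinite (UNIV :: 'u set)"
    and "carrier G \<lesssim> (UNIV :: 'u set)"
  shows "\<exists>F. bij_betw F
           (Zphi_extensions G // Zphi_equivalence_rel G ::
              ('u monoid \<times> ('a \<Rightarrow> 'u) \<times> ('u \<Rightarrow> ('a \<Rightarrow> 'a) set)) set set)
           (extensions G // G_isomorphism_rel G :: ('u monoid \<times> ('a \<Rightarrow> 'u)) set set) \<and>
         (\<forall>c \<in> Zphi_extensions G // Zphi_equivalence_rel G. \<forall>\<sigma> \<in> c. \<exists>\<epsilon> \<in> F c.
            same_coupling G \<sigma> \<epsilon>)"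
proof -
  obtain U :: "(('a \<Rightarrow> 'a) \<times> (('a \<Rightarrow> 'a) set \<Rightarrow> 'a)) set monoid" and \<psi> \<gamma>
    where "outer_lift G U \<psi> \<gamma>"
    using outer_lift_exists[OF assms(1-4)] .
  then interpret outer_lift G U \<psi> \<gamma> .
  \<comment> \<open>U is fixed before R, so any two linked pairs share the same lift and the
    transport lemmas can compare them.\<close>
  define R :: "'u monoid \<times> ('a \<Rightarrow> 'u) \<times> ('u \<Rightarrow> ('a \<Rightarrow> 'a) set) \<Rightarrow> 'u monoid \<times> ('a \<Rightarrow> 'u) \<Rightarrow> bool"
    where "R = (\<lambda>(S, \<kappa>, \<phi>) (E, \<iota>). \<exists>K. linking G U \<psi> \<gamma> S \<kappa> \<phi> E \<iota> K)"
  obtain F where F: "bij_betw F (Zphi_extensions G // Zphi_equivalence_rel G) (extensions G // G_isomorphism_rel G)"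
      "\<forall>c \<in> Zphi_extensions G // Zphi_equivalence_rel G. \<forall>\<sigma> \<in> c. \<exists>\<epsilon> \<in> F c. R \<sigma> \<epsilon>"
  proof (atomize_elim, rule bij_betw_quotients[OF G_isomorphism_rel_equiv])
    show "Zphi_equivalence_rel G \<subseteq> Zphi_extensions G \<times> Zphi_extensions G"
      by (auto simp: Zphi_equivalence_rel_def)
    show "\<sigma> \<in> Zphi_extensions G \<and> \<epsilon> \<in> extensions G" if "R \<sigma> \<epsilon>" for \<sigma> \<epsilon>
      using that linking.S_ext linking.E_ext by (cases \<sigma>; cases \<epsilon>) (auto simp: R_def)
    show "\<exists>\<epsilon>. R \<sigma> \<epsilon>" if "\<sigma> \<in> Zphi_extensions G" for \<sigma>
      using that ex_linking_of_Zphi_extension[OF _ assms(5,6)] by (cases \<sigma>) (force simp: R_def)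
    show "\<exists>\<sigma>. R \<sigma> \<epsilon>" if "\<epsilon> \<in> extensions G" for \<epsilon>
      using that ex_linking_of_extension[OF _ assms(5,6)] by (cases \<epsilon>) (force simp: R_def)
    show "(\<sigma>, \<sigma>') \<in> Zphi_equivalence_rel G \<longleftrightarrow> (\<epsilon>, \<epsilon>') \<in> G_isomorphism_rel G"
      if "R \<sigma> \<epsilon>" "R \<sigma>' \<epsilon>'" for \<sigma> \<epsilon> \<sigma>' \<epsilon>'
    proof -
      obtain S \<kappa> \<phi> E \<iota> K where A: "\<sigma> = (S, \<kappa>, \<phi>)" "\<epsilon> = (E, \<iota>)" "linking G U \<psi> \<gamma> S \<kappa> \<phi> E \<iota> K"
        using \<open>R \<sigma> \<epsilon>\<close> by (auto simp: R_def)
      obtain S' \<kappa>' \<phi>' E' \<iota>' K'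
        where B: "\<sigma>' = (S', \<kappa>', \<phi>')" "\<epsilon>' = (E', \<iota>')" "linking G U \<psi> \<gamma> S' \<kappa>' \<phi>' E' \<iota>' K'"
        using \<open>R \<sigma>' \<epsilon>'\<close> by (auto simp: R_def)
      show ?thesis
        unfolding A(1,2) B(1,2)
        using linking_equivalence_imp_isomorphism[OF A(3) B(3)]
          linking_isomorphism_imp_equivalence[OF A(3) B(3)] by (rule iffI)
    qed
  qed
  have "same_coupling G \<sigma> \<epsilon>" if "R \<sigma> \<epsilon>" for \<sigma> \<epsilon>
    using that linking.same_coupling by (cases \<sigma>; cases \<epsilon>) (auto simp: R_def simp del: same_coupling.simps)
  then have "\<forall>c \<in> Zphi_extensions G // Zphi_equivalence_rel G. \<forall>\<sigma> \<in> c. \<exists>\<epsilon> \<in> F c.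
      same_coupling G \<sigma> \<epsilon>"
    using F(2) by fast
  with F(1) show ?thesis by (intro exI[of _ F] conjI)
qed

end
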